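(* Let $q=2^r$. Let $N_1=|SO^+(2,q)|=q-1$, $N_2=|O^+(2,q)|=2(q-1)$, $N_3=|SO^+(4,q)|=q^2(q^2-1)^2$, and for $i=1,2,3$ let $\{C_{i,j}\}_{j=0}^{N_i}$ be the weight distributions of the binary codes $C(SO^+(2,q))$, $C(O^+(2,q))$, $C(SO^+(4,q))$ respectively. Then: (a) For $r\ge 3$ and $h=1,2,\ldots$, $$MK^h=\sum_{l=0}^{h-1}(-1)^{h+l+1}\binom{h}{l}(q-1)^{h-l}MK^l+q\sum_{j=0}^{\min\{N_1,h\}}(-1)^{h+j}C_{1,j}\sum_{t=j}^{h}t!\,S(h,t)\,2^{h-t}\binom{N_1-j}{N_1-t},$$ where $$C_{1,j}=\sum\binom{1}{\nu_0}\prod_{\beta\in\mathbb{F}_q^*,\ tr(\beta^{-1})=0}\binom{2}{\nu_\beta}\quad(j=0,\ldots,N_1),$$ the sum being over all sets of nonnegative integers $\{\nu_0\}\cup\{\nu_\beta\}_{\beta\in\mathbb{F}_q^*,\,tr(\beta^{-1})=0}$ with $\nu_0+\sum_{tr(\beta^{-1})=0}\nu_\beta=j$ and $\sum_{tr(\beta^{-1})=0}\nu_\beta\beta=0$ (in $\mathbb{F}_q$). (b) For $r\ge 3$ and $h=1,2,\ldots$, $$MK^h=\sum_{l=0}^{h-1}(-1)^{h+l+1}\binom{h}{l}(q-1)^{h-l}MK^l+q\sum_{j=0}^{\min\{N_2,h\}}(-1)^{h+j}C_{2,j}\sum_{t=j}^{h}t!\,S(h,t)\,2^{h-t}\binom{N_2-j}{N_2-t},$$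 where $$C_{2,j}=\sum\binom{q}{\nu_0}\prod_{\beta\in\mathbb{F}_q^*,\ tr(\beta^{-1})=0}\binom{2}{\nu_\beta}\quad(j=0,\ldots,N_2),$$ the sum being over all sets of nonnegative integers $\{\nu_0\}\cup\{\nu_\beta\}_{\beta\in\mathbb{F}_q^*,\,tr(\beta^{-1})=0}$ with $\nu_0+\sum_{tr(\beta^{-1})=0}\nu_\beta=j$ and $\sum_{tr(\beta^{-1})=0}\nu_\beta\beta=0$. (c) For $r\ge 2$ and $h=1,2,\ldots$, $$MK_2^h=\sum_{l=0}^{h-1}(-1)^{h+l+1}\binom{h}{l}(q^4-q^3-2q^2+1)^{h-l}MK_2^l+q^{1-2h}\sum_{j=0}^{\min\{N_3,h\}}(-1)^{h+j}C_{3,j}\sum_{t=j}^{h}t!\,S(h,t)\,2^{h-t}\binom{N_3-j}{N_3-t},$$ $$MK^{2h}=\sum_{l=0}^{h-1}(-1)^{h+l+1}\binom{h}{l}(q^4-q^3-2q^2+q+1)^{h-l}MK^{2l}+q^{1-2h}\sum_{j=0}^{\min\{N_3,h\}}(-1)^{h+j}C_{3,j}\sum_{t=j}^{h}t!\,S(h,t)\,2^{h-t}\binom{N_3-j}{N_3-t},$$ where $$C_{3,j}=\sum\binom{m_0}{\nu_0}\prod_{\substack{t\in\mathbb{Z},\ |t|<2\sqrt q\\ t\equiv -1\ (\mathrm{mod}\ 4)}}\ \prod_{\beta\in\mathbb{F}_q^*,\ K(\lambda;\beta^{-1})=t}\binom{m_t}{\nu_\beta}\quad(j=0,\ldots,N_3),$$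 the sum being over all sets of nonnegative integers $\{\nu_\beta\}_{\beta\in\mathbb{F}_q}$ with $\sum_{\beta\in\mathbb{F}_q}\nu_\beta=j$ and $\sum_{\beta\in\mathbb{F}_q}\nu_\beta\beta=0$, and where $m_0=q^3(2q^2-q-2)$ and $m_t=q^2(q^3-q^2-2q+t)$.
   Context: $\mathbb{F}_q$ is the field with $q=2^r$ elements; $tr(x)=x+x^2+\cdots+x^{2^{r-1}}$ is the absolute trace $\mathbb{F}_q\to\mathbb{F}_2$ and $\lambda(x)=(-1)^{tr(x)}$ is the canonical additive character. For $a\in\mathbb{F}_q^*$: $K(\lambda;a)=\sum_{\alpha\in\mathbb{F}_q^*}\lambda(\alpha+a\alpha^{-1})$ (Kloosterman sum) and $K_2(\lambda;a)=\sum_{\alpha_1,\alpha_2\in\mathbb{F}_q^*}\lambda(\alpha_1+\alpha_2+a\alpha_1^{-1}\alpha_2^{-1})$. For $h\ge 0$, $MK^h=\sum_{a\in\mathbb{F}_q^*}K(\lambda;a)^h$ and $MK_2^h=\sum_{a\in\mathbb{F}_q^*}K_2(\lambda;a)^h$ (so $MK^0=MK_2^0=q-1$). $S(h,t)=\frac{1}{t!}\sum_{j=0}^t(-1)^{t-j}\binom{t}{j}j^h$ is the Stirling number of the second kind; binomial coefficients $\binom{n}{k}$ are $0$ when $k<0$ or $k>n$. Orthogonal groups: on column vectors $x\in\mathbb{F}_q^{2n}$ let $\theta^+(x)=\sum_{i=1}^n x_ix_{n+i}$; $O^+(2n,q)$ is the group of $g\in GL(2n,q)$ with $\theta^+(gx)=\theta^+(x)$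 for all $x$; equivalently, writing $g=\begin{bmatrix}A&B\\C&D\end{bmatrix}$ with $n\times n$ blocks, ${}^tAC$ and ${}^tBD$ are alternating (symmetric with zero diagonal) and ${}^tAD+{}^tCB=1_n$. The map $\delta^+(g)=\mathrm{Tr}(B\,{}^tC)$ is a surjective homomorphism $O^+(2n,q)\to\mathbb{F}_2$ and $SO^+(2n,q)=\ker\delta^+$. Codes: for a finite group $G$ of square matrices over $\mathbb{F}_q$, with its elements listed as $g_1,\ldots,g_N$, the binary code $C(G)=\{u\in\mathbb{F}_2^N:\ \sum_{j=1}^N u_j\,\mathrm{Tr}(g_j)=0 \text{ in } \mathbb{F}_q\}$; its weight distribution is $\{C_j\}_{j=0}^N$ with $C_j$ the number of codewords of Hamming weight $j$. *)

theory Defs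
  imports
    "HOL-Analysis.Analysis"
    "HOL-Combinatorics.Stirling"
    "HOL-Library.Z2"
    "HOL-Number_Theory.Cong"
begin

text \<open>
  The field with \<open>q = 2 ^ r\<close> elements is a type of class \<open>{field, finite}\<close> with \<open>2 ^ r\<close> elements;
  the exponent \<open>r\<close> is passed explicitly to the notions that depend on it.
\<close>

definition abs_trace :: "nat \<Rightarrow> 'a::{field,finite} \<Rightarrow> 'a"
  where "abs_trace r x = (\<Sum>i<r. x ^ (2 ^ i))"

text \<open>When the field has \<open>2 ^ r\<close> elements, the absolute trace only takes the values \<open>0\<close> and \<open>1\<close>.\<close>

definition add_char :: "nat \<Rightarrow> 'a::{field,finite} \<Rightarrow> int"
  where "add_char r x = (if abs_trace r x = 0 then 1 else -1)"

definition kloosterman :: "nat \<Rightarrow> 'a::{field,finite} \<Rightarrow> int"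
  where "kloosterman r a = (\<Sum>\<alpha>\<in>-{0}. add_char r (\<alpha> + a * inverse \<alpha>))"

definition kloosterman2 :: "nat \<Rightarrow> 'a::{field,finite} \<Rightarrow> int"
  where "kloosterman2 r a =
    (\<Sum>\<alpha>\<^sub>1\<in>-{0}. \<Sum>\<alpha>\<^sub>2\<in>-{0}. add_char r (\<alpha>\<^sub>1 + \<alpha>\<^sub>2 + a * inverse \<alpha>\<^sub>1 * inverse \<alpha>\<^sub>2))"

definition MK :: "'a::{field,finite} itself \<Rightarrow> nat \<Rightarrow> nat \<Rightarrow> int"
  where "MK _ r h = (\<Sum>a\<in>-{0::'a}. kloosterman r a ^ h)"

definition MK2 :: "'a::{field,finite} itself \<Rightarrow> nat \<Rightarrow> nat \<Rightarrow> int"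
  where "MK2 _ r h = (\<Sum>a\<in>-{0::'a}. kloosterman2 r a ^ h)"

text \<open>
  Integer arguments, so that differences such as \<open>N - t\<close> are not truncated; the library's
  \<open>choose\<close> on the naturals would turn \<open>N - t\<close> with \<open>t > N\<close> into \<open>0\<close>.
\<close>

definition binom :: "int \<Rightarrow> int \<Rightarrow> int"
  where "binom n k = (if 0 \<le> k \<and> k \<le> n then int (nat n choose nat k) else 0)"

text \<open>
  A vector of length \<open>2 n\<close> is indexed by \<open>'n + 'n\<close>, where \<open>'n\<close> has \<open>n\<close> elements: \<open>Inl\<close> selects the
  first \<open>n\<close> coordinates and \<open>Inr\<close> the last \<open>n\<close>.
\<close>

definition theta_plus :: "'a::field ^ ('n::finite + 'n) \<Rightarrow> 'a"
  where "theta_plus x = (\<Sum>i\<in>UNIV. x $ Inl i * x $ Inr i)"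

definition O_plus :: "('a::field ^ ('n::finite + 'n) ^ ('n + 'n)) set"
  where "O_plus = {g. invertible g \<and> (\<forall>x. theta_plus (g *v x) = theta_plus x)}"

definition block_B :: "'a ^ ('n::finite + 'n) ^ ('n + 'n) \<Rightarrow> 'a ^ 'n ^ 'n"
  where "block_B g = (\<chi> i j. g $ Inl i $ Inr j)"

definition block_C :: "'a ^ ('n::finite + 'n) ^ ('n + 'n) \<Rightarrow> 'a ^ 'n ^ 'n"
  where "block_C g = (\<chi> i j. g $ Inr i $ Inl j)"

definition delta_plus :: "'a::field ^ ('n::finite + 'n) ^ ('n + 'n) \<Rightarrow> 'a"
  where "delta_plus g = trace (block_B g ** transpose (block_C g))"

definition SO_plus :: "('a::field ^ ('n::finite + 'n) ^ ('n + 'n)) set"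
  where "SO_plus = {g \<in> O_plus. delta_plus g = 0}"

text \<open>
  The list \<open>gs\<close> enumerates the elements of the group without repetition. A bit acts on the field,
  which has characteristic 2, through the inclusion of the prime field.
\<close>

definition trace_code :: "('a::field ^ 'n::finite ^ 'n) list \<Rightarrow> bit list set"
  where "trace_code gs = {u. length u = length gs \<and>
    (\<Sum>j<length gs. of_bool (u ! j = 1) * trace (gs ! j)) = 0}"

definition hamming_weight :: "bit list \<Rightarrow> nat"
  where "hamming_weight u = card {j. j < length u \<and> u ! j \<noteq> 0}"

definition weight_distribution :: "bit list set \<Rightarrow> nat \<Rightarrow> nat"
  where "weight_distribution C j = card {u \<in> C. hamming_weight u = j}"

text \<open>The library's Stirling numbers of the second kind satisfy the usual explicit formula.\<close>

lemma Stirling_explicit: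
  "real (Stirling h t) = 1 / fact t * (\<Sum>j=0..t. (-1) ^ (t - j) * real (t choose j) * real j ^ h)"
proof -
  define F :: "nat \<Rightarrow> nat \<Rightarrow> real" where
    "F h t = (\<Sum>j\<le>t. (-1) ^ (t - j) * real (t choose j) * real j ^ h)" for h t
  have F0: "F 0 t = (if t = 0 then 1 else 0)" for t
  proof -
    have "F 0 t = (\<Sum>j\<le>t. of_nat (t choose j) * 1 ^ j * (-1) ^ (t - j))"
      unfolding F_def by (intro sum.cong) auto
    also have "\<dots> = (1 + (-1)) ^ t"
      by (rule binomial_ring[symmetric])
    finally show ?thesis by (simp add: power_0_left)
  qed
  have FS0: "F (Suc h) 0 = 0" for h by (simp add: F_def)
  have FSS: "F (Suc h) (Suc t) = real (Suc t) * (F h (Suc t) + F h t)" for h t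
  proof -
    have c: "(-1) ^ (Suc t - j) * real (Suc t choose j) * real j ^ Suc h =
        real (Suc t) * ((-1) ^ (Suc t - j) * real (Suc t choose j) * real j ^ h
          - (-1) ^ (Suc t - j) * real (t choose j) * real j ^ h)" for j
    proof (cases j)
      case 0
      then show ?thesis by simp
    next
      case (Suc k)
      have "real (Suc k) * real (Suc t choose Suc k) = real (Suc t) * real (t choose k)"
        by (metis Suc_times_binomial_eq mult.commute of_nat_mult)
      moreover have "real (t choose k) = real (Suc t choose Suc k) - real (t choose Suc k)"
        by simp
      ultimately have e: "real j * real (Suc t choose j) =
          real (Suc t) * (real (Suc t choose j) - real (t choose j))"
        using Suc by metis
      have "(-1) ^ (Suc t - j) * real (Suc t choose j) * real j ^ Suc h =
          (-1) ^ (Suc t - j) * real j ^ h * (real j * real (Suc t choose j))"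
        by (simp add: ac_simps)
      then show ?thesis unfolding e by (simp add: algebra_simps)
    qed
    have "F (Suc h) (Suc t) = real (Suc t) * (F h (Suc t)
        - (\<Sum>j\<le>Suc t. (-1) ^ (Suc t - j) * real (t choose j) * real j ^ h))"
      unfolding F_def c sum_distrib_left[symmetric] sum_subtractf ..
    also have "(\<Sum>j\<le>Suc t. (-1) ^ (Suc t - j) * real (t choose j) * real j ^ h) = - F h t"
    proof -
      have "(\<Sum>j\<le>t. (-1) ^ (Suc t - j) * real (t choose j) * real j ^ h) =
          (\<Sum>j\<le>t. - ((-1) ^ (t - j) * real (t choose j) * real j ^ h))"
        by (rule sum.cong) (auto simp: Suc_diff_le)
      then show ?thesis by (simp add: F_def sum_negf)
    qed
    finally show ?thesis by simp
  qed
  have "fact t * real (Stirling h t) = F h t"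
  proof (induction h t rule: Stirling.induct)
    case (4 n k)
    then show ?case by (simp add: FSS algebra_simps)
  qed (simp_all add: F0 FS0)
  then show ?thesis by (simp add: F_def atLeast0AtMost field_simps)
qed

end

theory Submission
  imports Defs "HOL-Computational_Algebra.Polynomial"
begin

text \<open>
  For a group \<open>G\<close> of matrices and \<open>a \<in> F\<close> put \<open>w(a) = #{g \<in> G. tr (a Tr g) = 1}\<close>. Writing \<open>w(a)\<^sup>h\<close> through
  Stirling numbers and counting \<open>t\<close>-subsets with characters gives the Pless identity for
  \<open>\<Sum>\<^sub>a w(a)\<^sup>h\<close> directly in terms of the weights of \<open>C(G)\<close>, without the dual code. The recursions follow once
  \<open>|G| - 2 w(a) = \<Sum>\<^sub>g \<lambda>(a Tr g)\<close> is known. For \<open>O\<^sup>+(2,q)\<close> this sum is read off the diagonal and antidiagonal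
  matrices. For \<open>SO\<^sup>+(4,q)\<close> one uses the isomorphism with \<open>SL\<^sub>2 \<times> SL\<^sub>2\<close> acting on \<open>2 \<times> 2\<close> matrices, under which
  the trace is the product of the two traces, together with
  \<open>#{A \<in> SL\<^sub>2. Tr A = t} = q\<^sup>2 + q \<lambda>(t\<inverse>)\<close> for \<open>t \<noteq> 0\<close> and Carlitz' identity \<open>K(a)\<^sup>2 = K\<^sub>2(a) + q\<close>.
  The same computations give the number of elements of each trace, hence the weights. The product over
  \<open>|t| < 2 \<surd>q\<close>, \<open>t \<equiv> -1 (mod 4)\<close> runs over all \<open>\<beta> \<noteq> 0\<close> because of the Weil bound, which is proved by
  Manin's method: the degrees of the first coordinates of \<open>Frob + n\<close> on \<open>y\<^sup>2 + x y = x\<^sup>3 + a\<^sup>2\<close> are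
  \<open>n\<^sup>2 \<plusminus> K(a) n + q\<close>, and these are nonnegative.
\<close>

section \<open>Finite fields of characteristic 2\<close>

text \<open>The Kloosterman sums have one common source: \<open>x^2 + t x + 1 = 0\<close> has
  \<open>1 + \<psi> (1/t)\<close> roots for \<open>t \<noteq> 0\<close>, which counts the
  \<open>u\<close> with \<open>u + 1/u = t\<close> and also governs the matrices of trace
  \<open>t\<close> in \<open>SL2\<close>. For the Weil bound neither the group law nor the function
  field of the curve is set up. They are replaced by a symmetric relation between the first
  coordinates of \<open>P\<close>, \<open>Q\<close> and \<open>P \<plusminus> Q\<close>: read as a
  quadratic, it has the coordinates of \<open>P + Q\<close> and \<open>P - Q\<close> as roots, so
  one of them yields the other by Vieta. A Gauss lemma for degrees turns this into
  \<open>d (n+1) + d (n-1) = 2 d n + 2\<close>, so the degrees form a quadratic in \<open>n\<close>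
  fixed by \<open>d 0 = q\<close> and \<open>d 1\<close>. The Kloosterman sum enters through
  \<open>d 1\<close>: with \<open>y = x z\<close> the curve reads
  \<open>z^2 + z = x + a^2/x^2\<close>, and the zeros that cancel in the coordinate of
  \<open>Frob \<plusminus> Q\<close> are the \<open>s\<close> at which the trace of
  \<open>s + a/s\<close> has a prescribed value. Nonnegativity is known at integers \<open>n\<close>
  only; the strict bound \<open>K^2 < 4 q\<close> therefore also uses that \<open>K\<close> is odd
  and that \<open>q\<close> is a power of 2.\<close>

locale binary_field =
  fixes r :: nat and F :: "'a::{field,finite} itself"
  assumes card_field: "CARD('a) = 2 ^ r"
begin

abbreviation q :: nat where "q \<equiv> 2 ^ r"

abbreviation \<psi> :: "'a \<Rightarrow> int" where "\<psi> \<equiv> add_char r"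

abbreviation tr :: "'a \<Rightarrow> 'a" where "tr \<equiv> abs_trace r"

lemma r_pos: "r > 0"
proof (rule ccontr)
  assume "\<not> r > 0"
  then have "card (UNIV :: 'a set) = 1" using card_field by simp
  then obtain z :: 'a where "UNIV = {z}" by (auto simp: card_1_singleton_iff)
  then show False by (metis UNIV_I singletonD zero_neq_one)
qed

text \<open>Translation by 1 permutes the field, so the sum of all elements does not change when
  \<open>2^r\<close> ones are added to it.\<close>

lemma two_eq_0: "(2::'a) = 0"
proof -
  have "(\<Sum>x\<in>UNIV. x + 1) = (\<Sum>x\<in>UNIV. x::'a)"
    by (rule sum.reindex_bij_witness[of _ "\<lambda>x. x - 1" "\<lambda>x. x + 1"]) auto
  then have "of_nat (2 ^ r) = (0::'a)" by (simp add: sum.distrib card_field)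
  then show ?thesis by simp
qed

lemma CHAR_eq_2: "CHAR('a) = 2"
proof -
  have "CHAR('a) dvd 2" using two_eq_0 of_nat_eq_0_iff_char_dvd[of 2, where ?'a = 'a] by simp
  moreover have "CHAR('a) \<noteq> 1" using of_nat_CHAR[where ?'a = 'a] by auto
  ultimately show ?thesis by (metis prime_nat_iff two_is_prime_nat)
qed

lemma add_self [simp]: "x + x = (0::'a)"
  using two_eq_0 by (metis mult_2 mult_zero_left)

lemma add_self_left [simp]: "x + (x + y) = (y::'a)"
  by (simp flip: add.assoc)

lemma uminus_eq_self [simp]: "- x = (x::'a)"
  using add_self[of x] by (simp add: minus_unique)

lemma minus_eq_add [simp]: "x - y = x + (y::'a)"
  by (simp add: diff_conv_add_uminus del: add_uminus_conv_diff)

lemma add_eq_0_iff_eq: "x + y = 0 \<longleftrightarrow> x = (y::'a)"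
  by (metis add_self_left add.right_neutral)

lemma power_add_char2: "(x + y :: 'a) ^ (2 ^ n) = x ^ (2 ^ n) + y ^ (2 ^ n)"
  by (rule freshmans_dream') (simp_all add: CHAR_eq_2)

lemma power2_add: "(x + y :: 'a)\<^sup>2 = x\<^sup>2 + y\<^sup>2"
  using power_add_char2[of x y 1] by simp

lemma power_card: "(x::'a) ^ q = x"
proof (cases "x = 0")
  case False
  have "x * (\<Prod>y\<in>UNIV-{0}. x * y) = x * x ^ (q - 1) * \<Prod>(UNIV-{0})"
    by (simp add: prod.distrib mult_ac card_Diff_singleton card_field)
  also have "x * x ^ (q - 1) = x ^ Suc (q - 1)" by (rule power_Suc[symmetric])
  also have "Suc (q - 1) = q" by simp
  also have "(\<Prod>y\<in>UNIV-{0}. x * y) = (\<Prod>y\<in>UNIV-{0}. y)"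
    by (rule prod.reindex_bij_witness[of _ "\<lambda>y. y / x" "\<lambda>y. x * y"]) (use False in auto)
  finally show ?thesis by simp
qed auto

lemma inj_square: "inj (\<lambda>x::'a. x\<^sup>2)"
  by (rule injI) (metis add_eq_0_iff_eq power2_add power_eq_0_iff)

lemma bij_square: "bij (\<lambda>x::'a. x\<^sup>2)"
  using inj_square by (simp add: bij_def finite_UNIV_inj_surj)

lemma ex_sqrt: obtains y :: 'a where "y\<^sup>2 = x"
  using bij_square by (metis bij_pointE)

lemma tr_0 [simp]: "tr 0 = 0"
  by (simp add: abs_trace_def power_0_left)

lemma tr_add: "tr (x + y) = tr x + tr y"
  by (simp add: abs_trace_def power_add_char2 sum.distrib)

lemma tr_square_self: "(tr x)\<^sup>2 = tr x"
proof -
  have "(tr x)\<^sup>2 = (\<Sum>i<r. (x ^ 2 ^ i)\<^sup>2)"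
    unfolding abs_trace_def by (rule freshmans_dream_sum) (simp_all add: CHAR_eq_2)
  also have "\<dots> = (\<Sum>i<r. x ^ 2 ^ Suc i)" by (simp add: mult.commute flip: power_mult)
  also have "\<dots> = tr x + x ^ 2 ^ r + x"
    using sum.lessThan_Suc_shift[of "\<lambda>i. x ^ 2 ^ i" r] sum.lessThan_Suc[of "\<lambda>i. x ^ 2 ^ i" r]
    by (simp add: abs_trace_def algebra_simps)
  finally show ?thesis by (simp add: power_card add.assoc)
qed

lemma tr_cases: "tr x = 0 \<or> tr x = 1"
  using tr_square_self[of x] by (simp add: power2_eq_square)

lemma tr_square: "tr (x\<^sup>2) = tr x"
proof -
  have "tr (x\<^sup>2) = (tr x)\<^sup>2"
    unfolding abs_trace_def
    by (subst freshmans_dream_sum) (simp_all add: CHAR_eq_2 mult.commute flip: power_mult)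
  then show ?thesis by (simp add: tr_square_self)
qed

text \<open>The trace polynomial is nonzero, since only \<open>i = 0\<close> contributes to its
  coefficient at 1, and its degree is at most \<open>2^(r-1)\<close>, too small for \<open>q\<close>
  roots.\<close>

lemma ex_tr_nonzero: "\<exists>x. tr x \<noteq> 0"
proof (rule ccontr)
  assume "\<not> (\<exists>x. tr x \<noteq> 0)"
  then have 0: "tr x = 0" for x by blast
  define p :: "'a poly" where "p = (\<Sum>i<r. monom 1 (2 ^ i))"
  have "poly p x = 0" for x
    using 0[of x] by (simp add: p_def poly_sum poly_monom abs_trace_def)
  then have roots: "{x. poly p x = 0} = UNIV" by auto
  have "coeff p 1 = (\<Sum>i<r. if i = 0 then 1 else 0)"
    unfolding p_def coeff_sum by (intro sum.cong) auto
  also have "\<dots> = 1" using r_pos by simp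
  finally have "p \<noteq> 0" by auto
  have "degree p \<le> 2 ^ (r - 1)"
    unfolding p_def by (rule degree_sum_le) (auto simp: degree_monom_eq intro: power_increasing)
  moreover have "q \<le> degree p"
    using card_poly_roots_bound[OF \<open>p \<noteq> 0\<close>] roots card_field by simp
  moreover have "(2::nat) ^ (r - 1) < 2 ^ r" using r_pos by simp
  ultimately show False by linarith
qed

lemma char_0 [simp]: "\<psi> 0 = 1"
  by (simp add: add_char_def)

lemma char_add: "\<psi> (x + y) = \<psi> x * \<psi> y"
  using tr_cases[of x] tr_cases[of y] by (auto simp: add_char_def tr_add)

lemma char_square: "\<psi> (x\<^sup>2) = \<psi> x"
  by (simp add: add_char_def tr_square)

lemma char_cases: "\<psi> x = 1 \<or> \<psi> x = -1"
  by (simp add: add_char_def)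

lemma char_sum: "finite A \<Longrightarrow> \<psi> (\<Sum>i\<in>A. f i) = (\<Prod>i\<in>A. \<psi> (f i))"
  by (induction A rule: finite_induct) (simp_all add: char_add)

lemma sum_char: "(\<Sum>x\<in>UNIV. \<psi> x) = 0"
proof -
  obtain y where "tr y \<noteq> 0" using ex_tr_nonzero by blast
  then have y: "\<psi> y = -1" by (simp add: add_char_def)
  have "(\<Sum>x\<in>UNIV. \<psi> x) = (\<Sum>x\<in>UNIV. \<psi> (x + y))"
    by (rule sum.reindex_bij_witness[of _ "\<lambda>x. x + y" "\<lambda>x. x + y"]) (auto simp: add.assoc)
  also have "\<dots> = - (\<Sum>x\<in>UNIV. \<psi> x)" by (simp add: char_add y sum_negf)
  finally show ?thesis by simp
qed

lemma sum_char_mult: "(\<Sum>x\<in>UNIV. \<psi> (x * a)) = (if a = 0 then int q else 0)"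
proof (cases "a = 0")
  case True
  then show ?thesis by (simp add: card_field)
next
  case False
  then have "(\<Sum>x\<in>UNIV. \<psi> (x * a)) = (\<Sum>x\<in>UNIV. \<psi> x)"
    by (intro sum.reindex_bij_witness[of _ "\<lambda>x. x / a" "\<lambda>x. x * a"]) auto
  with False show ?thesis by (simp add: sum_char)
qed

lemma sum_nonzero: "(\<Sum>x\<in>-{0::'a}. f x) = (\<Sum>x\<in>UNIV. f x) - (f 0 :: int)"
proof -
  have "(\<Sum>x\<in>UNIV - {0::'a}. f x) = (\<Sum>x\<in>UNIV. f x) - f 0"
    by (subst sum_diff) auto
  then show ?thesis by (simp add: Compl_eq_Diff_UNIV)
qed

lemma card_nonzero: "card (-{0::'a}) = q - 1"
  by (simp add: Compl_eq_Diff_UNIV card_Diff_singleton card_field)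

lemma sum_char_nonzero: "(\<Sum>x\<in>-{0}. \<psi> x) = -1"
  by (simp add: sum_nonzero sum_char)

lemma artin_schreier_fibre:
  assumes "x\<^sup>2 + x = (c::'a)"
  shows "{y. y\<^sup>2 + y = c} = {x, x + 1}"
proof -
  have "y = x \<or> y = x + 1" if "y\<^sup>2 + y = c" for y
  proof -
    have "(y + x) * (y + x + 1) = (y\<^sup>2 + y) + (x\<^sup>2 + x)"
      by (simp add: power2_eq_square algebra_simps)
    also have "\<dots> = 0" using that assms by simp
    finally have "y + x = 0 \<or> y + (x + 1) = 0" by (simp add: add.assoc)
    then show ?thesis by (simp only: add_eq_0_iff_eq)
  qed
  moreover have "(x + 1)\<^sup>2 + (x + 1) = c"
    using assms by (simp add: power2_add algebra_simps)
  ultimately show ?thesis using assms by auto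
qed

text \<open>The map \<open>x^2 + x\<close> has fibres \<open>{x, x + 1}\<close>, and its image lies
  in the set of elements of trace 0. Both sets have \<open>q/2\<close> elements, the first by
  counting fibres and the second because the character sums to 0, so they coincide.\<close>

lemma card_artin_schreier: "int (card {x::'a. x\<^sup>2 + x = c}) = 1 + \<psi> c"
proof -
  let ?f = "\<lambda>x::'a. x\<^sup>2 + x"
  have fib: "card {x. ?f x = c} = 2" if "c \<in> range ?f" for c :: 'a
    using that artin_schreier_fibre by fastforce
  have sub: "range ?f \<subseteq> {c. tr c = 0}"
    by (auto simp: tr_add tr_square)
  have "q = (\<Sum>c\<in>range ?f. card {x. ?f x = c})"
  proof -
    have "UNIV = (\<Union>c\<in>range ?f. {x. ?f x = c})" by auto
    then have "card (UNIV::'a set) = card (\<Union>c\<in>range ?f. {x. ?f x = c})" by simp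
    also have "\<dots> = (\<Sum>c\<in>range ?f. card {x. ?f x = c})"
      by (rule card_UN_disjoint) auto
    finally show ?thesis by (simp add: card_field)
  qed
  then have 1: "q = 2 * card (range ?f)" by (simp add: fib)
  have "(\<Sum>c\<in>UNIV. \<psi> c) = (\<Sum>c\<in>UNIV. (if tr c = 0 then 2 else 0) - 1)"
    by (intro sum.cong) (auto simp: add_char_def)
  also have "\<dots> = 2 * int (card {c. tr c = 0}) - int q"
    by (simp add: sum_subtractf card_field sum.If_cases)
  finally have 2: "q = 2 * card {c. tr c = 0}" using sum_char by linarith
  have "range ?f = {c. tr c = 0}"
    using 1 2 by (intro card_subset_eq sub) auto
  then show ?thesis using fib[of c] by (auto simp: add_char_def card_eq_0_iff)
qed

text \<open>The substitution \<open>x = t z\<close> leads to \<open>z^2 + z = 1/t^2\<close>, and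
  \<open>1/t^2\<close> has the same trace as \<open>1/t\<close>.\<close>

lemma card_quadratic_roots:
  "int (card {x::'a. x\<^sup>2 + t * x + 1 = 0}) = (if t = 0 then 1 else 1 + \<psi> (inverse t))"
proof (cases "t = 0")
  case True
  have "{x::'a. x\<^sup>2 + 1 = 0} = {1}"
    using inj_square by (auto simp: add_eq_0_iff_eq inj_def)
  with True show ?thesis by simp
next
  case False
  have "bij_betw (\<lambda>x. t * x) {x. x\<^sup>2 + x = (inverse t)\<^sup>2} {x. x\<^sup>2 + t * x + 1 = 0}"
    by (rule bij_betwI[where g = "\<lambda>x. x / t"])
      (use False in \<open>auto simp: field_simps power2_eq_square add_eq_0_iff_eq\<close>)
  then have "card {x. x\<^sup>2 + t * x + 1 = 0} = card {x. x\<^sup>2 + x = (inverse t)\<^sup>2}"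
    by (simp add: bij_betw_same_card)
  then show ?thesis using False by (simp only: card_artin_schreier char_square) simp
qed

section \<open>Kloosterman sums\<close>

abbreviation K :: "'a \<Rightarrow> int" where "K \<equiv> kloosterman r"

abbreviation K2 :: "'a \<Rightarrow> int" where "K2 \<equiv> kloosterman2 r"

lemma kloosterman_scale:
  assumes "s \<noteq> 0"
  shows "(\<Sum>x\<in>-{0}. \<psi> (s * x + t * inverse x)) = K (s * t)"
  unfolding kloosterman_def
  by (rule sum.reindex_bij_witness[of _ "\<lambda>x. x / s" "\<lambda>x. s * x"])
    (use assms in \<open>auto simp: field_simps\<close>)

lemma sum_kloosterman: "(\<Sum>a\<in>-{0}. K a) = 1"
proof -
  have inner: "(\<Sum>a\<in>-{0}. \<psi> (x + a * inverse x)) = - \<psi> x" if "x \<noteq> 0" for x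
    using that by (simp add: char_add sum_distrib_left[symmetric] sum_nonzero sum_char_mult)
  have "(\<Sum>a\<in>-{0}. K a) = (\<Sum>x\<in>-{0}. \<Sum>a\<in>-{0}. \<psi> (x + a * inverse x))"
    unfolding kloosterman_def by (rule sum.swap)
  also have "\<dots> = (\<Sum>x\<in>-{0}. - \<psi> x)"
    by (rule sum.cong) (auto simp: inner)
  finally show ?thesis by (simp add: sum_negf sum_char_nonzero)
qed

lemma sum_kloosterman_mult: "a \<noteq> 0 \<Longrightarrow> (\<Sum>t\<in>-{0}. K (a * t)) = 1"
  using sum.reindex_bij_witness[of "-{0}" "\<lambda>x. x / a" "\<lambda>x. a * x" "-{0}" K "\<lambda>t. K (a * t)"]
  by (auto simp: sum_kloosterman)

lemma kloosterman2_eq: "K2 a = (\<Sum>u\<in>-{0}. \<psi> (inverse u) * K (a * u))"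
proof -
  have "K2 a = (\<Sum>y\<in>-{0}. \<psi> y * K (a * inverse y))"
    unfolding kloosterman2_def kloosterman_def
    by (simp add: char_add sum_distrib_left ac_simps)
  also have "\<dots> = (\<Sum>u\<in>-{0}. \<psi> (inverse u) * K (a * u))"
    by (rule sum.reindex_bij_witness[of _ inverse inverse]) auto
  finally show ?thesis .
qed

lemma card_add_inverse_eq:
  "int (card {u::'a. u \<noteq> 0 \<and> u + inverse u = t}) = (if t = 0 then 1 else 1 + \<psi> (inverse t))"
proof -
  have "{u::'a. u \<noteq> 0 \<and> u + inverse u = t} = {x. x\<^sup>2 + t * x + 1 = 0}"
  proof -
    have "u + inverse u = t \<longleftrightarrow> u\<^sup>2 + t * u + 1 = 0" if "u \<noteq> 0" for u :: 'a
    proof -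
      have "u\<^sup>2 + t * u + 1 = u * (u + inverse u + t)"
        using that by (simp add: field_simps power2_eq_square)
      then show ?thesis using that by (simp add: add_eq_0_iff_eq)
    qed
    moreover have "x \<noteq> 0" if "x\<^sup>2 + t * x + 1 = 0" for x using that by auto
    ultimately show ?thesis by (intro Collect_cong) metis
  qed
  then show ?thesis by (simp only: card_quadratic_roots)
qed

lemma sum_add_inverse:
  "(\<Sum>u\<in>-{0::'a}. g (u + inverse u)) = g 0 + (\<Sum>t\<in>-{0}. (1 + \<psi> (inverse t)) * (g t :: int))"
proof -
  have "(\<Sum>u\<in>-{0::'a}. g (u + inverse u)) =
      (\<Sum>t\<in>UNIV. \<Sum>u\<in>{u\<in>-{0}. u + inverse u = t}. g (u + inverse u))"
    by (rule sum.group[symmetric]) auto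
  also have "\<dots> = (\<Sum>t\<in>UNIV. int (card {u. u \<noteq> 0 \<and> u + inverse u = t}) * g t)"
    by (intro sum.cong) (auto simp: Compl_eq)
  also have "\<dots> = (\<Sum>t\<in>UNIV. if t = 0 then g 0 else (1 + \<psi> (inverse t)) * g t)"
    by (intro sum.cong) (auto simp: card_add_inverse_eq)
  also have "\<dots> = g 0 + (\<Sum>t\<in>-{0}. if t = 0 then g 0 else (1 + \<psi> (inverse t)) * g t)"
    by (subst sum_nonzero) simp
  also have "(\<Sum>t\<in>-{0}. if t = 0 then g 0 else (1 + \<psi> (inverse t)) * g t) =
      (\<Sum>t\<in>-{0}. (1 + \<psi> (inverse t)) * g t)"
    by (intro sum.cong) auto
  finally show ?thesis .
qed

text \<open>
  Substituting \<open>y = x u\<close> in the square of the Kloosterman sum turns the sum over \<open>x\<close> into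
  the Kloosterman sum at \<open>a (1 + u) (1 + u\<inverse>) = a (u + u\<inverse>)\<close>.
\<close>

lemma kloosterman_square:
  assumes "a \<noteq> 0"
  shows "(K a)\<^sup>2 = K2 a + int q"
proof -
  \<comment> \<open>The value at 0 belongs to \<open>u = 1\<close>, where the two factors coincide
    and each product is 1. It is not \<open>K 0\<close>, which equals -1; the difference
    \<open>q\<close> is the one in the final identity.\<close>
  define g where "g t = (if t = 0 then int q - 1 else K (a * t))" for t
  have inner: "(\<Sum>x\<in>-{0}. \<psi> (x + a * inverse x) * \<psi> (x * u + a * inverse (x * u))) = g (u + inverse u)"
    if u: "u \<noteq> 0" for u
  proof -
    have eq: "\<psi> (x + a * inverse x) * \<psi> (x * u + a * inverse (x * u)) =
        \<psi> ((1 + u) * x + a * (1 + inverse u) * inverse x)" for x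
      by (simp add: char_add[symmetric] algebra_simps)
    have iff: "u + inverse u = 0 \<longleftrightarrow> u = 1"
      using u by (auto simp: add_eq_0_iff_eq) (metis u add_eq_0_iff_eq inj_square injD one_power2 power2_eq_square right_inverse)
    show ?thesis
    proof (cases "u = 1")
      case True
      moreover have "\<psi> x * \<psi> x = 1" for x using char_cases[of x] by auto
      ultimately show ?thesis by (simp add: g_def card_nonzero of_nat_diff)
    next
      case False
      then have "1 + u \<noteq> 0" by (metis add_eq_0_iff_eq)
      then have "(\<Sum>x\<in>-{0}. \<psi> (x + a * inverse x) * \<psi> (x * u + a * inverse (x * u))) =
          K ((1 + u) * (a * (1 + inverse u)))"
        unfolding eq by (rule kloosterman_scale)
      also have "(1 + u) * (a * (1 + inverse u)) = a * (u + inverse u)"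
        using u by (simp add: algebra_simps)
      also have "K (a * (u + inverse u)) = g (u + inverse u)"
        using False iff by (simp add: g_def)
      finally show ?thesis .
    qed
  qed
  have "(K a)\<^sup>2 = (\<Sum>x\<in>-{0}. \<Sum>y\<in>-{0}. \<psi> (x + a * inverse x) * \<psi> (y + a * inverse y))"
    unfolding kloosterman_def power2_eq_square by (rule sum_product)
  also have "\<dots> = (\<Sum>x\<in>-{0}. \<Sum>u\<in>-{0}. \<psi> (x + a * inverse x) * \<psi> (x * u + a * inverse (x * u)))"
  proof (rule sum.cong[OF refl])
    fix x :: 'a assume "x \<in> -{0}"
    then show "(\<Sum>y\<in>-{0}. \<psi> (x + a * inverse x) * \<psi> (y + a * inverse y)) =
        (\<Sum>u\<in>-{0}. \<psi> (x + a * inverse x) * \<psi> (x * u + a * inverse (x * u)))"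
      by (intro sum.reindex_bij_witness[of _ "\<lambda>u. x * u" "\<lambda>y. y / x"]) auto
  qed
  also have "\<dots> = (\<Sum>u\<in>-{0}. \<Sum>x\<in>-{0}. \<psi> (x + a * inverse x) * \<psi> (x * u + a * inverse (x * u)))"
    by (rule sum.swap)
  also have "\<dots> = (\<Sum>u\<in>-{0}. g (u + inverse u))"
    by (intro sum.cong refl inner) simp
  also have "\<dots> = g 0 + (\<Sum>t\<in>-{0}. (1 + \<psi> (inverse t)) * g t)"
    by (rule sum_add_inverse)
  also have "(\<Sum>t\<in>-{0}. (1 + \<psi> (inverse t)) * g t) =
      (\<Sum>t\<in>-{0}. K (a * t) + \<psi> (inverse t) * K (a * t))"
    by (intro sum.cong) (auto simp: g_def algebra_simps)
  also have "\<dots> = 1 + K2 a"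
    by (simp add: sum.distrib sum_kloosterman_mult assms kloosterman2_eq)
  finally show ?thesis by (simp add: g_def)
qed

text \<open>With \<open>c^2 = a\<close> the sum becomes one of \<open>\<psi> (c (u + 1/u))\<close>.
  Grouped by \<open>t = u + 1/u\<close>, the weights \<open>1 + \<psi> (1/t)\<close> are 0 or 2, so
  replacing every sign \<open>\<psi> (c t)\<close> by 1 changes the sum by a multiple of 4 and
  leaves \<open>q - 1\<close>. The condition \<open>r \<ge> 2\<close> makes 4 divide
  \<open>q\<close>.\<close>

lemma kloosterman_cong_4:
  assumes "r \<ge> 2" "a \<noteq> 0"
  shows "[K a = -1] (mod 4)"
proof -
  obtain c where c: "c\<^sup>2 = a" using ex_sqrt by blast
  with assms have c0: "c \<noteq> 0" by auto
  have "(\<Sum>u\<in>-{0}. \<psi> (c * (u + inverse u))) = K (c * c)"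
    using kloosterman_scale[OF c0, of c] by (simp add: algebra_simps)
  then have K: "K a = 1 + (\<Sum>t\<in>-{0}. (1 + \<psi> (inverse t)) * \<psi> (c * t))"
    using sum_add_inverse[of "\<lambda>t. \<psi> (c * t)"] c by (simp add: power2_eq_square)
  have "(\<Sum>u\<in>-{0::'a}. 1) = 1 + (\<Sum>t\<in>-{0}. 1 + \<psi> (inverse t))"
    using sum_add_inverse[of "\<lambda>t. 1"] by simp
  then have S: "1 + (\<Sum>t\<in>-{0}. 1 + \<psi> (inverse t)) = int q - 1"
    by (simp add: card_nonzero of_nat_diff)
  have "[\<Sum>t\<in>-{0}. (1 + \<psi> (inverse t)) * \<psi> (c * t) = \<Sum>t\<in>-{0}. 1 + \<psi> (inverse t)] (mod 4)"
  proof (rule cong_sum)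
    fix t
    show "[(1 + \<psi> (inverse t)) * \<psi> (c * t) = 1 + \<psi> (inverse t)] (mod 4)"
      using char_cases[of "inverse t"] char_cases[of "c * t"] by (auto simp: cong_def)
  qed
  then have "[K a = int q - 1] (mod 4)"
    unfolding K S[symmetric] by (intro cong_add cong_refl)
  moreover have "[int q - 1 = 0 - 1] (mod 4)"
  proof (intro cong_diff cong_refl)
    have "(2::int) ^ 2 dvd 2 ^ r" by (rule le_imp_power_dvd) (use assms in simp)
    then show "[int q = 0] (mod 4)" by (simp add: cong_0_iff)
  qed
  ultimately show ?thesis using cong_trans by fastforce
qed

end

section \<open>Pless power moments\<close>

text \<open>Since \<open>fact t * (x choose t)\<close> is the falling factorial of length
  \<open>t\<close>, this is the expansion that characterises the Stirling numbers. The induction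
  rests on: \<open>x\<close> times the falling factorial of length \<open>t\<close> is
  \<open>t\<close> times itself plus the one of length \<open>t + 1\<close>.\<close>

lemma falling_sum_Stirling:
  "(\<Sum>t\<le>h. fact t * Stirling h t * (x choose t)) = x ^ h"
proof (induction h)
  case 0
  then show ?case by simp
next
  case (Suc h)
  have rec: "x * (fact t * (x choose t)) = t * (fact t * (x choose t)) + fact (Suc t) * (x choose Suc t)" for t
  proof (cases "t \<le> x")
    case True
    have "Suc t * (x choose Suc t) = (x - t) * (x choose t)"
      by (metis binomial_absorb_comp binomial_absorption mult.commute)
    then have "fact (Suc t) * (x choose Suc t) = fact t * ((x - t) * (x choose t))"
      by (metis fact_Suc mult.assoc mult.commute of_nat_id)
    then show ?thesis using True by (simp add: algebra_simps diff_mult_distrib)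
  qed (simp add: binomial_eq_0)
  have "x ^ Suc h = (\<Sum>t\<le>h. Stirling h t * (x * (fact t * (x choose t))))"
    by (simp add: Suc.IH[symmetric] sum_distrib_left ac_simps)
  also have "\<dots> = (\<Sum>t\<le>h. t * Stirling h t * (fact t * (x choose t))) +
      (\<Sum>t\<le>h. Stirling h t * (fact (Suc t) * (x choose Suc t)))"
    unfolding rec by (simp add: algebra_simps sum.distrib)
  also have "(\<Sum>t\<le>h. t * Stirling h t * (fact t * (x choose t))) =
      (\<Sum>t\<le>Suc h. t * Stirling h t * (fact t * (x choose t)))"
    by simp
  also have "\<dots> = (\<Sum>t\<le>h. Suc t * Stirling h (Suc t) * (fact (Suc t) * (x choose Suc t)))"
    by (subst sum.atMost_Suc_shift) simp
  also have "\<dots> + (\<Sum>t\<le>h. Stirling h t * (fact (Suc t) * (x choose Suc t))) =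
      (\<Sum>t\<le>h. Stirling (Suc h) (Suc t) * (fact (Suc t) * (x choose Suc t)))"
    unfolding sum.distrib[symmetric] by (intro sum.cong) (simp_all add: algebra_simps del: fact_Suc binomial_Suc_Suc)
  also have "\<dots> = (\<Sum>t\<le>Suc h. Stirling (Suc h) t * (fact t * (x choose t)))"
    by (subst sum.atMost_Suc_shift) simp
  finally show ?case by (simp only: ac_simps)
qed

lemma card_supersets:
  assumes "finite G" "B \<subseteq> G" "card B \<le> t"
  shows "card {A. B \<subseteq> A \<and> A \<subseteq> G \<and> card A = t} = (card G - card B) choose (t - card B)"
proof -
  have fB: "finite B" using assms finite_subset by blast
  have "bij_betw (\<lambda>A. A \<union> B) {A. A \<subseteq> G - B \<and> card A = t - card B}
      {A. B \<subseteq> A \<and> A \<subseteq> G \<and> card A = t}"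
  proof (rule bij_betwI[where g = "\<lambda>A. A - B"])
    have "card (A \<union> B) = t" if "A \<subseteq> G - B" "card A = t - card B" for A
      using that assms fB by (subst card_Un_disjoint) (auto intro: finite_subset[of A "G - B"])
    then show "(\<lambda>A. A \<union> B) \<in> {A. A \<subseteq> G - B \<and> card A = t - card B} \<rightarrow>
        {A. B \<subseteq> A \<and> A \<subseteq> G \<and> card A = t}"
      using assms by auto
    show "(\<lambda>A. A - B) \<in> {A. B \<subseteq> A \<and> A \<subseteq> G \<and> card A = t} \<rightarrow>
        {A. A \<subseteq> G - B \<and> card A = t - card B}"
      using fB by (auto simp: card_Diff_subset)
  qed auto
  then have "card {A. B \<subseteq> A \<and> A \<subseteq> G \<and> card A = t} = card {A. A \<subseteq> G - B \<and> card A = t - card B}"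
    by (simp add: bij_betw_same_card)
  also have "\<dots> = (card G - card B) choose (t - card B)"
    using assms fB by (simp add: n_subsets card_Diff_subset)
  finally show ?thesis .
qed

text \<open>
  Choosing a codeword amounts to choosing its support, so the \<open>j\<close>-th weight is the number of
  \<open>j\<close>-element sets of matrices whose traces add up to zero.
\<close>

definition zero_sum_sets :: "'b set \<Rightarrow> ('b \<Rightarrow> 'a::comm_monoid_add) \<Rightarrow> nat \<Rightarrow> 'b set set" where
  "zero_sum_sets G f j = {A. A \<subseteq> G \<and> card A = j \<and> sum f A = 0}"

lemma finite_zero_sum_sets [simp]: "finite G \<Longrightarrow> finite (zero_sum_sets G f j)"
  by (rule finite_subset[of _ "Pow G"]) (auto simp: zero_sum_sets_def)

lemma weight_distribution_trace_code:
  fixes gs :: "('a::field ^ 'n::finite ^ 'n) list"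
  assumes "distinct gs"
  shows "weight_distribution (trace_code gs) j = card (zero_sum_sets (set gs) trace j)"
proof -
  define n where "n = length gs"
  define supp where "supp u = (\<lambda>i. gs ! i) ` {i. i < n \<and> u ! i = (1::bit)}" for u
  have inj: "inj_on (\<lambda>i. gs ! i) {..<n}"
    using assms by (auto simp: n_def inj_on_def distinct_conv_nth)
  have inj': "inj_on (\<lambda>i. gs ! i) {i. i < n \<and> u ! i = (1::bit)}" for u
    by (rule inj_on_subset[OF inj]) auto
  have tr_supp: "sum trace (supp u) = (\<Sum>j<n. of_bool (u ! j = 1) * trace (gs ! j))" for u
  proof -
    have "sum trace (supp u) = (\<Sum>i | i < n \<and> u ! i = 1. trace (gs ! i))"
      unfolding supp_def by (subst sum.reindex[OF inj']) simp
    also have "\<dots> = (\<Sum>i<n. if u ! i = 1 then trace (gs ! i) else 0)"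
      by (subst sum.inter_filter[symmetric]) auto
    also have "\<dots> = (\<Sum>j<n. of_bool (u ! j = 1) * trace (gs ! j))"
      by (intro sum.cong) auto
    finally show ?thesis .
  qed
  have "bij_betw supp {u \<in> trace_code gs. hamming_weight u = j} (zero_sum_sets (set gs) trace j)"
  proof (rule bij_betwI[where g = "\<lambda>A. map (\<lambda>g. of_bool (g \<in> A)) gs"])
    show "supp \<in> {u \<in> trace_code gs. hamming_weight u = j} \<rightarrow> zero_sum_sets (set gs) trace j"
    proof
      fix u assume u: "u \<in> {u \<in> trace_code gs. hamming_weight u = j}"
      then have len: "length u = n" by (simp add: trace_code_def n_def)
      have "sum trace (supp u) = 0" using u by (simp add: tr_supp trace_code_def n_def)
      moreover have "card (supp u) = j"
        using u len unfolding supp_def by (simp add: card_image[OF inj'] hamming_weight_def)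
      ultimately show "supp u \<in> zero_sum_sets (set gs) trace j"
        by (auto simp: zero_sum_sets_def supp_def n_def)
    qed
    have supp_ind: "supp (map (\<lambda>g. of_bool (g \<in> A)) gs) = A" if "A \<subseteq> set gs" for A
    proof -
      have "supp (map (\<lambda>g. of_bool (g \<in> A)) gs) = (\<lambda>i. gs ! i) ` {i. i < n \<and> gs ! i \<in> A}"
        unfolding supp_def n_def by (intro image_cong Collect_cong) auto
      also have "\<dots> = A"
      proof (intro equalityI subsetI)
        fix x assume "x \<in> A"
        then have "x \<in> set gs" using that by (rule rev_subsetD)
        then obtain i where "i < length gs" "gs ! i = x" unfolding in_set_conv_nth by (elim exE conjE)
        then show "x \<in> (\<lambda>i. gs ! i) ` {i. i < n \<and> gs ! i \<in> A}"
          using \<open>x \<in> A\<close> by (intro image_eqI[of _ _ i]) (simp_all add: n_def)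
      qed (elim imageE CollectE conjE, simp only:)
      finally show ?thesis .
    qed
    show "(\<lambda>A. map (\<lambda>g. of_bool (g \<in> A)) gs) \<in> zero_sum_sets (set gs) trace j \<rightarrow>
        {u \<in> trace_code gs. hamming_weight u = j}"
    proof
      fix A assume "A \<in> zero_sum_sets (set gs) trace j"
      then have A: "A \<subseteq> set gs" "card A = j" "sum trace A = 0"
        by (auto simp: zero_sum_sets_def)
      let ?u = "map (\<lambda>g. of_bool (g \<in> A)) gs :: bit list"
      have "(\<Sum>j<n. of_bool (?u ! j = 1) * trace (gs ! j)) = 0"
        unfolding tr_supp[symmetric] supp_ind[OF A(1)] by (rule A(3))
      then have "?u \<in> trace_code gs"
        by (simp only: trace_code_def mem_Collect_eq length_map n_def simp_thms)
      moreover have "hamming_weight ?u = j"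
      proof -
        have "hamming_weight ?u = card (supp ?u)"
          unfolding supp_def card_image[OF inj'] hamming_weight_def
          by (simp add: n_def)
        then show ?thesis using A supp_ind[OF A(1)] by simp
      qed
      ultimately show "?u \<in> {u \<in> trace_code gs. hamming_weight u = j}" by simp
    qed
    show "map (\<lambda>g. of_bool (g \<in> supp u)) gs = u"
      if "u \<in> {u \<in> trace_code gs. hamming_weight u = j}" for u
    proof (rule nth_equalityI)
      show len: "length (map (\<lambda>g. of_bool (g \<in> supp u)) gs) = length u"
        using that by (simp add: trace_code_def)
      fix i assume "i < length (map (\<lambda>g. of_bool (g \<in> supp u) :: bit) gs)"
      then have i: "i < n" by (simp add: n_def)
      have "gs ! i \<in> supp u \<longleftrightarrow> u ! i = 1"
        using i inj unfolding supp_def by (auto simp: inj_on_def)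
      then show "map (\<lambda>g. of_bool (g \<in> supp u)) gs ! i = u ! i"
        using i by (cases "u ! i") (auto simp: n_def)
    qed
    show "supp (map (\<lambda>g. of_bool (g \<in> A)) gs) = A" if "A \<in> zero_sum_sets (set gs) trace j" for A
      using that by (intro supp_ind) (simp add: zero_sum_sets_def)
  qed
  then show ?thesis unfolding weight_distribution_def by (rule bij_betw_same_card)
qed

lemma binom_of_nat: "binom (int n) (int k) = int (n choose k)"
  by (simp add: binom_def)

text \<open>
  A set of elements of \<open>G\<close> is chosen by first deciding how many elements it takes from each
  fibre of \<open>f\<close>.
\<close>

lemma card_zero_sum_sets:
  fixes f :: "'b \<Rightarrow> 'a::comm_ring_1"
  assumes fin: "finite G" "finite S" and img: "f ` G \<subseteq> S"
  shows "card (zero_sum_sets G f j) =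
    (\<Sum>\<nu> | \<nu> \<in> S \<rightarrow>\<^sub>E UNIV \<and> (\<Sum>b\<in>S. \<nu> b) = j \<and> (\<Sum>b\<in>S. of_nat (\<nu> b) * b) = 0.
       \<Prod>b\<in>S. card {g\<in>G. f g = b} choose \<nu> b)"
proof -
  define fib where "fib b = {g\<in>G. f g = b}" for b
  define V where "V = {\<nu>. \<nu> \<in> S \<rightarrow>\<^sub>E UNIV \<and> (\<Sum>b\<in>S. \<nu> b) = j \<and> (\<Sum>b\<in>S. of_nat (\<nu> b) * b) = (0::'a)}"
  define pr where "pr A = (\<lambda>b\<in>S. card (A \<inter> fib b))" for A
  have finfib: "finite (fib b)" for b using fin by (simp add: fib_def)
  have "V \<subseteq> S \<rightarrow>\<^sub>E {..j}"
    using fin by (force simp: V_def PiE_iff intro: member_le_sum)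
  then have finV: "finite V" using fin by (auto intro: finite_subset finite_PiE)
  have split: "A = (\<Union>b\<in>S. A \<inter> fib b)" if "A \<subseteq> G" for A
    using that img by (auto simp: fib_def)
  have cardA: "card A = (\<Sum>b\<in>S. card (A \<inter> fib b))" if "A \<subseteq> G" for A
    using arg_cong[OF split[OF that], of card] finfib fin
    by (subst (asm) card_UN_disjoint) (auto simp: fib_def)
  have sumA: "sum f A = (\<Sum>b\<in>S. of_nat (card (A \<inter> fib b)) * b)" if "A \<subseteq> G" for A
  proof -
    have "sum f A = sum f (\<Union>b\<in>S. A \<inter> fib b)" using split[OF that] by simp
    also have "\<dots> = (\<Sum>b\<in>S. sum f (A \<inter> fib b))"
      using fin finfib by (intro sum.UNION_disjoint) (auto simp: fib_def)
    also have "\<dots> = (\<Sum>b\<in>S. of_nat (card (A \<inter> fib b)) * b)"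
      by (intro sum.cong refl) (simp add: fib_def)
    finally show ?thesis .
  qed
  have "zero_sum_sets G f j = (\<Union>\<nu>\<in>V. {A. A \<subseteq> G \<and> pr A = \<nu>})"
  proof (intro equalityI subsetI)
    fix A assume "A \<in> zero_sum_sets G f j"
    then have "A \<subseteq> G" "pr A \<in> V"
      using cardA[of A] sumA[of A] by (auto simp: zero_sum_sets_def V_def pr_def)
    then show "A \<in> (\<Union>\<nu>\<in>V. {A. A \<subseteq> G \<and> pr A = \<nu>})" by auto
  next
    fix A assume "A \<in> (\<Union>\<nu>\<in>V. {A. A \<subseteq> G \<and> pr A = \<nu>})"
    then show "A \<in> zero_sum_sets G f j"
      using cardA[of A] sumA[of A] by (auto simp: zero_sum_sets_def V_def pr_def)
  qed
  then have "card (zero_sum_sets G f j) = (\<Sum>\<nu>\<in>V. card {A. A \<subseteq> G \<and> pr A = \<nu>})"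
    using fin finV by (simp only:) (subst card_UN_disjoint, auto intro: finite_subset[of _ "Pow G"])
  also have "\<dots> = (\<Sum>\<nu>\<in>V. \<Prod>b\<in>S. card (fib b) choose \<nu> b)"
  proof (rule sum.cong[OF refl])
    fix \<nu> assume \<nu>: "\<nu> \<in> V"
    have "bij_betw (\<lambda>A. \<lambda>b\<in>S. A \<inter> fib b) {A. A \<subseteq> G \<and> pr A = \<nu>}
        (\<Pi>\<^sub>E b\<in>S. {B. B \<subseteq> fib b \<and> card B = \<nu> b})"
    proof (rule bij_betwI[where g = "\<lambda>P. \<Union>b\<in>S. P b"])
      show "(\<lambda>A. \<lambda>b\<in>S. A \<inter> fib b) \<in> {A. A \<subseteq> G \<and> pr A = \<nu>} \<rightarrow>
          (\<Pi>\<^sub>E b\<in>S. {B. B \<subseteq> fib b \<and> card B = \<nu> b})"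
        by (auto simp: pr_def)
      have sub: "(\<Union>b\<in>S. P b) \<inter> fib b = P b"
        if "P \<in> (\<Pi>\<^sub>E b\<in>S. {B. B \<subseteq> fib b \<and> card B = \<nu> b})" "b \<in> S" for P b
      proof -
        have P: "x \<in> fib c" if "c \<in> S" "x \<in> P c" for c x
          using \<open>P \<in> _\<close> that by (auto simp: PiE_iff)
        show ?thesis
        proof (intro equalityI subsetI)
          fix x assume "x \<in> (\<Union>c\<in>S. P c) \<inter> fib b"
          then obtain c where "c \<in> S" "x \<in> P c" "x \<in> fib b" by blast
          moreover from this P have "x \<in> fib c" by simp
          ultimately show "x \<in> P b" by (simp add: fib_def)
        qed (use P \<open>b \<in> S\<close> in auto)
      qed
      show "(\<lambda>P. \<Union>b\<in>S. P b) \<in> (\<Pi>\<^sub>E b\<in>S. {B. B \<subseteq> fib b \<and> card B = \<nu> b}) \<rightarrow>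
          {A. A \<subseteq> G \<and> pr A = \<nu>}"
      proof
        fix P assume P: "P \<in> (\<Pi>\<^sub>E b\<in>S. {B. B \<subseteq> fib b \<and> card B = \<nu> b})"
        then have "P b \<subseteq> G" "card (P b) = \<nu> b" if "b \<in> S" for b
          using that by (auto simp: PiE_iff fib_def)
        then show "(\<Union>b\<in>S. P b) \<in> {A. A \<subseteq> G \<and> pr A = \<nu>}"
          using sub[OF P] \<nu> by (auto simp: pr_def V_def PiE_iff extensional_def fun_eq_iff)
      qed
      show "(\<Union>b\<in>S. (\<lambda>b\<in>S. A \<inter> fib b) b) = A" if "A \<in> {A. A \<subseteq> G \<and> pr A = \<nu>}" for A
        using that img by (auto simp: fib_def)
      show "(\<lambda>b\<in>S. (\<Union>b\<in>S. P b) \<inter> fib b) = P"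
        if "P \<in> (\<Pi>\<^sub>E b\<in>S. {B. B \<subseteq> fib b \<and> card B = \<nu> b})" for P
        using sub[OF that] that by (auto simp: PiE_iff extensional_def fun_eq_iff)
    qed
    then have "card {A. A \<subseteq> G \<and> pr A = \<nu>} = card (\<Pi>\<^sub>E b\<in>S. {B. B \<subseteq> fib b \<and> card B = \<nu> b})"
      by (rule bij_betw_same_card)
    also have "\<dots> = (\<Prod>b\<in>S. card (fib b) choose \<nu> b)"
      by (simp add: card_PiE fin n_subsets finfib)
    finally show "card {A. A \<subseteq> G \<and> pr A = \<nu>} = (\<Prod>b\<in>S. card (fib b) choose \<nu> b)" .
  qed
  finally show ?thesis by (simp add: V_def fib_def)
qed

context binary_field begin

text \<open>
  Both sides count, for each \<open>t\<close>, the \<open>t\<close>-subsets of \<open>G\<close> on which \<open>\<psi> (a f)\<close> is constantly \<open>-1\<close>,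
  summed over \<open>a\<close>; the right-hand side results from expanding the indicator
  \<open>\<Prod>g\<in>A. (1 - \<psi> (a f g)) / 2\<close> and applying orthogonality of characters.
\<close>

lemma power_moment:
  fixes f :: "'b \<Rightarrow> 'a"
  assumes fin: "finite G"
  shows "(\<Sum>a\<in>UNIV. (int (card G) - (\<Sum>g\<in>G. \<psi> (a * f g))) ^ h) =
    int q * (\<Sum>j=0..min (card G) h. (-1) ^ j * int (card (zero_sum_sets G f j)) *
      (\<Sum>t=j..h. fact t * int (Stirling h t) * 2 ^ (h - t) * binom (int (card G) - int j) (int (card G) - int t)))"
proof -
  define N where "N = card G"
  define W where "W a = {g\<in>G. \<psi> (a * f g) = -1}" for a
  \<comment> \<open>The factor \<open>2^h\<close> of \<open>(2 w)^h\<close> is split as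
    \<open>2^(h-t) * 2^t\<close>: the part \<open>2^t\<close> clears the halves in the indicator of
    a \<open>t\<close>-subset, the rest stays in the coefficient.\<close>
  define c where "c t = fact t * int (Stirling h t) * 2 ^ (h - t)" for t
  have finW: "finite (W a)" for a using fin by (simp add: W_def)
  have w: "int N - (\<Sum>g\<in>G. \<psi> (a * f g)) = 2 * int (card (W a))" for a
  proof -
    have "int N - (\<Sum>g\<in>G. \<psi> (a * f g)) = (\<Sum>g\<in>G. 1 - \<psi> (a * f g))"
      by (simp add: sum_subtractf N_def)
    also have "\<dots> = (\<Sum>g\<in>G. if \<psi> (a * f g) = -1 then 2 else 0)"
      by (intro sum.cong) (use char_cases in auto)
    finally show ?thesis by (simp add: fin sum.If_cases W_def Int_def)
  qed
  have ind: "2 ^ t * int (card (W a) choose t) =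
      (\<Sum>B | B \<subseteq> G \<and> card B \<le> t. (-1) ^ card B * \<psi> (a * sum f B) *
        int (card {A. B \<subseteq> A \<and> A \<subseteq> G \<and> card A = t}))" for t a
  proof -
    have "2 ^ t * int (card (W a) choose t) = (\<Sum>A | A \<subseteq> W a \<and> card A = t. 2 ^ t)"
      by (simp add: finW n_subsets)
    also have "\<dots> = (\<Sum>A | A \<subseteq> G \<and> card A = t. \<Prod>g\<in>A. 1 - \<psi> (a * f g))"
    proof (rule sum.mono_neutral_cong_left)
      show "finite {A. A \<subseteq> G \<and> card A = t}"
        by (rule finite_subset[of _ "Pow G"]) (use fin in auto)
      show "{A. A \<subseteq> W a \<and> card A = t} \<subseteq> {A. A \<subseteq> G \<and> card A = t}" by (auto simp: W_def)
      show "\<forall>A\<in>{A. A \<subseteq> G \<and> card A = t} - {A. A \<subseteq> W a \<and> card A = t}. (\<Prod>g\<in>A. 1 - \<psi> (a * f g)) = 0"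
      proof
        fix A assume "A \<in> {A. A \<subseteq> G \<and> card A = t} - {A. A \<subseteq> W a \<and> card A = t}"
        then obtain g where "A \<subseteq> G" "g \<in> A" "g \<notin> W a" by auto
        then have "\<psi> (a * f g) = 1" using char_cases[of "a * f g"] by (auto simp: W_def)
        then show "(\<Prod>g\<in>A. 1 - \<psi> (a * f g)) = 0"
          using \<open>A \<subseteq> G\<close> \<open>g \<in> A\<close> fin by (intro prod_zero) (auto intro: finite_subset)
      qed
      show "2 ^ t = (\<Prod>g\<in>A. 1 - \<psi> (a * f g))" if "A \<in> {A. A \<subseteq> W a \<and> card A = t}" for A
      proof -
        have "(\<Prod>g\<in>A. 1 - \<psi> (a * f g)) = (\<Prod>g\<in>A. 2)"
          using that by (intro prod.cong) (auto simp: W_def)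
        then show ?thesis using that by simp
      qed
    qed
    also have "\<dots> = (\<Sum>A | A \<subseteq> G \<and> card A = t. \<Sum>B | B \<subseteq> G \<and> card B \<le> t. if B \<subseteq> A then (-1) ^ card B * \<psi> (a * sum f B) else 0)"
    proof (rule sum.cong[OF refl])
      fix A assume A: "A \<in> {A. A \<subseteq> G \<and> card A = t}"
      then have fA: "finite A" using fin by (auto intro: finite_subset)
      have "(\<Prod>g\<in>A. 1 - \<psi> (a * f g)) = (\<Prod>g\<in>A. - \<psi> (a * f g) + 1)" by simp
      also have "\<dots> = (\<Sum>B\<in>Pow A. (\<Prod>g\<in>B. - \<psi> (a * f g)))"
        by (subst prod_add[OF fA]) simp
      also have "\<dots> = (\<Sum>B\<in>Pow A. (-1) ^ card B * \<psi> (a * sum f B))"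
      proof (rule sum.cong[OF refl])
        fix B assume "B \<in> Pow A"
        then have "finite B" using fA by (auto intro: finite_subset)
        then show "(\<Prod>g\<in>B. - \<psi> (a * f g)) = (-1) ^ card B * \<psi> (a * sum f B)"
          by (simp add: sum_distrib_left char_sum prod_uminus)
      qed
      also have "\<dots> = (\<Sum>B\<in>{B\<in>{B. B \<subseteq> G \<and> card B \<le> t}. B \<subseteq> A}. (-1) ^ card B * \<psi> (a * sum f B))"
        using A fA by (intro sum.cong) (auto intro: card_mono)
      also have "\<dots> = (\<Sum>B | B \<subseteq> G \<and> card B \<le> t. if B \<subseteq> A then (-1) ^ card B * \<psi> (a * sum f B) else 0)"
        by (rule sum.inter_filter, rule finite_subset[of _ "Pow G"]) (use fin in auto)
      finally show "(\<Prod>g\<in>A. 1 - \<psi> (a * f g)) = \<dots>" .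
    qed
    also have "\<dots> = (\<Sum>B | B \<subseteq> G \<and> card B \<le> t. \<Sum>A | A \<subseteq> G \<and> card A = t. if B \<subseteq> A then (-1) ^ card B * \<psi> (a * sum f B) else 0)"
      by (rule sum.swap)
    also have "\<dots> = (\<Sum>B | B \<subseteq> G \<and> card B \<le> t. (-1) ^ card B * \<psi> (a * sum f B) *
        int (card {A. B \<subseteq> A \<and> A \<subseteq> G \<and> card A = t}))"
    proof (rule sum.cong[OF refl])
      fix B
      have f: "finite {A. A \<subseteq> G \<and> card A = t}"
        by (rule finite_subset[of _ "Pow G"]) (use fin in auto)
      have "{A. A \<subseteq> G \<and> card A = t} \<inter> {A. B \<subseteq> A} = {A. B \<subseteq> A \<and> A \<subseteq> G \<and> card A = t}" by auto
      then show "(\<Sum>A | A \<subseteq> G \<and> card A = t. if B \<subseteq> A then (-1) ^ card B * \<psi> (a * sum f B) else 0) =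
          (-1) ^ card B * \<psi> (a * sum f B) * int (card {A. B \<subseteq> A \<and> A \<subseteq> G \<and> card A = t})"
        by (simp add: sum.If_cases[OF f])
    qed
    finally show ?thesis .
  qed
  \<comment> \<open>The number of supersets is \<open>(N-j) choose (t-j)\<close>, rewritten by
    symmetry as \<open>(N-j) choose (N-t)\<close>. For \<open>t > N\<close> there is no such set,
    and \<open>binom\<close> vanishes because its lower argument is negative.\<close>
  have sup: "int (card {A. B \<subseteq> A \<and> A \<subseteq> G \<and> card A = t}) = binom (int N - int j) (int N - int t)"
    if "B \<subseteq> G" "card B = j" "j \<le> t" for B j t
  proof -
    have jN: "j \<le> N" using that fin by (auto simp: N_def intro: card_mono)
    show ?thesis
    proof (cases "t \<le> N")
      case True
      have "binom (int N - int j) (int N - int t) = int ((N - j) choose (N - t))"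
        using True jN by (simp flip: of_nat_diff add: binom_of_nat)
      also have "(N - j) choose (N - t) = (N - j) choose (t - j)"
        using True jN that(3) by (subst binomial_symmetric) (auto simp: algebra_simps)
      finally show ?thesis using card_supersets[OF fin that(1), of t] that by (simp add: N_def)
    next
      case False
      then show ?thesis using card_supersets[OF fin that(1), of t] that jN
        by (simp add: N_def binom_def binomial_eq_0)
    qed
  qed
  have moment: "(\<Sum>a\<in>UNIV. 2 ^ t * int (card (W a) choose t)) =
      int q * (\<Sum>j\<le>min N t. (-1) ^ j * int (card (zero_sum_sets G f j)) * binom (int N - int j) (int N - int t))" for t
  proof -
    let ?X = "\<lambda>B. int (card {A. B \<subseteq> A \<and> A \<subseteq> G \<and> card A = t})"
    have finB: "finite {B. B \<subseteq> G \<and> card B \<le> t}"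
      by (rule finite_subset[of _ "Pow G"]) (use fin in auto)
    have "(\<Sum>a\<in>UNIV. 2 ^ t * int (card (W a) choose t)) =
        (\<Sum>B | B \<subseteq> G \<and> card B \<le> t. \<Sum>a\<in>UNIV. (-1) ^ card B * \<psi> (a * sum f B) * ?X B)"
      unfolding ind by (rule sum.swap)
    also have "\<dots> = (\<Sum>B | B \<subseteq> G \<and> card B \<le> t. if sum f B = 0 then int q * ((-1) ^ card B * ?X B) else 0)"
    proof (rule sum.cong[OF refl])
      fix B
      have "(\<Sum>a\<in>UNIV. (-1) ^ card B * \<psi> (a * sum f B) * ?X B) =
          (-1) ^ card B * ?X B * (\<Sum>a\<in>UNIV. \<psi> (a * sum f B))"
        by (subst sum_distrib_left) (intro sum.cong refl, simp only: mult_ac)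
      then show "(\<Sum>a\<in>UNIV. (-1) ^ card B * \<psi> (a * sum f B) * ?X B) =
          (if sum f B = 0 then int q * ((-1) ^ card B * ?X B) else 0)"
        by (simp add: sum_char_mult)
    qed
    also have "\<dots> = (\<Sum>B\<in>{B\<in>{B. B \<subseteq> G \<and> card B \<le> t}. sum f B = 0}. int q * ((-1) ^ card B * ?X B))"
      by (rule sum.inter_filter[OF finB, symmetric])
    also have "{B\<in>{B. B \<subseteq> G \<and> card B \<le> t}. sum f B = 0} = (\<Union>j\<le>min N t. zero_sum_sets G f j)"
      using fin by (auto simp: zero_sum_sets_def N_def intro: card_mono)
    also have "(\<Sum>B\<in>\<dots>. int q * ((-1) ^ card B * ?X B)) =
        (\<Sum>j\<le>min N t. \<Sum>B\<in>zero_sum_sets G f j. int q * ((-1) ^ card B * ?X B))"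
      using fin by (intro sum.UNION_disjoint) (simp_all, auto simp: zero_sum_sets_def)
    also have "\<dots> = (\<Sum>j\<le>min N t. \<Sum>B\<in>zero_sum_sets G f j. int q * ((-1) ^ j * binom (int N - int j) (int N - int t)))"
      by (intro sum.cong refl) (auto simp: zero_sum_sets_def sup)
    finally show ?thesis by (simp add: sum_distrib_left ac_simps)
  qed
  have "(\<Sum>a\<in>UNIV. (int N - (\<Sum>g\<in>G. \<psi> (a * f g))) ^ h) = (\<Sum>a\<in>UNIV. 2 ^ h * int (card (W a) ^ h))"
    by (simp add: w power_mult_distrib)
  also have "\<dots> = (\<Sum>a\<in>UNIV. \<Sum>t\<le>h. c t * (2 ^ t * int (card (W a) choose t)))"
  proof (rule sum.cong[OF refl])
    fix a
    have "2 ^ h * int (card (W a) ^ h) = 2 ^ h * int (\<Sum>t\<le>h. fact t * Stirling h t * (card (W a) choose t))"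
      by (simp only: falling_sum_Stirling)
    also have "\<dots> = (\<Sum>t\<le>h. 2 ^ h * (fact t * int (Stirling h t) * int (card (W a) choose t)))"
      by (simp add: sum_distrib_left)
    also have "\<dots> = (\<Sum>t\<le>h. c t * (2 ^ t * int (card (W a) choose t)))"
    proof (rule sum.cong[OF refl])
      fix t assume "t \<in> {..h}"
      then have "(2::int) ^ h = 2 ^ (h - t) * 2 ^ t" by (simp flip: power_add)
      then show "2 ^ h * (fact t * int (Stirling h t) * int (card (W a) choose t)) =
          c t * (2 ^ t * int (card (W a) choose t))"
        by (simp add: c_def)
    qed
    finally show "2 ^ h * int (card (W a) ^ h) = (\<Sum>t\<le>h. c t * (2 ^ t * int (card (W a) choose t)))" .
  qed
  also have "\<dots> = (\<Sum>t\<le>h. c t * (\<Sum>a\<in>UNIV. 2 ^ t * int (card (W a) choose t)))"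
    by (subst sum.swap) (simp add: sum_distrib_left)
  also have "\<dots> = (\<Sum>t\<le>h. \<Sum>j\<le>min N t. int q * ((-1) ^ j * int (card (zero_sum_sets G f j)) * (c t * binom (int N - int j) (int N - int t))))"
    unfolding moment by (simp add: sum_distrib_left ac_simps)
  also have "\<dots> = (\<Sum>j=0..min N h. \<Sum>t=j..h. int q * ((-1) ^ j * int (card (zero_sum_sets G f j)) * (c t * binom (int N - int j) (int N - int t))))"
    by (subst sum.Sigma, simp, simp, subst sum.Sigma, simp, simp)
      (rule sum.reindex_bij_witness[of _ "\<lambda>(j, t). (t, j)" "\<lambda>(t, j). (j, t)"], auto)
  finally show ?thesis by (simp only: N_def c_def sum_distrib_left mult.assoc)
qed

end

section \<open>The orthogonal groups\<close>

lemma sum_UNIV_Plus: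
  "(\<Sum>i\<in>(UNIV :: ('m::finite + 'n::finite) set). f i) = (\<Sum>i\<in>UNIV. f (Inl i)) + (\<Sum>i\<in>UNIV. f (Inr i))"
  by (simp flip: UNIV_Plus_UNIV add: sum.Plus)

text \<open>If \<open>x\<close> lies in the kernel of such a \<open>g\<close>, then
  \<open>theta_plus (x + y) = theta_plus y\<close> for all \<open>y\<close>, so \<open>x\<close> is
  in the radical of the polar form. Testing against the coordinate vectors shows
  \<open>x = 0\<close>.\<close>

lemma O_plus_eq: "O_plus = {g :: 'a::field ^ ('n::finite + 'n) ^ ('n + 'n). \<forall>x. theta_plus (g *v x) = theta_plus x}"
proof -
  have "invertible g" if g: "\<forall>x. theta_plus (g *v x) = theta_plus x"
    for g :: "'a ^ ('n + 'n) ^ ('n + 'n)"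
  proof -
    have "x = 0" if "g *v x = 0" for x
    proof -
      have x0: "theta_plus x = 0" using g[THEN spec, of x] that by (simp add: theta_plus_def)
      have shift: "theta_plus (x + y) = theta_plus y" for y
        using g that by (metis add_0 matrix_vector_right_distrib)
      have polar: "(\<Sum>i\<in>UNIV. x $ Inl i * y $ Inr i + y $ Inl i * x $ Inr i) = 0" for y
        using shift[of y] x0 by (simp add: theta_plus_def algebra_simps sum.distrib)
      have "x $ Inl i = 0" for i
      proof -
        let ?e = "axis (Inr i) 1 :: 'a ^ ('n + 'n)"
        have "(\<Sum>j\<in>UNIV. x $ Inl j * ?e $ Inr j + ?e $ Inl j * x $ Inr j) =
            (\<Sum>j\<in>UNIV. if j = i then x $ Inl j else 0)"
          by (intro sum.cong) (auto simp: axis_def)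
        then show ?thesis using polar[of ?e] by simp
      qed
      moreover have "x $ Inr i = 0" for i
      proof -
        let ?e = "axis (Inl i) 1 :: 'a ^ ('n + 'n)"
        have "(\<Sum>j\<in>UNIV. x $ Inl j * ?e $ Inr j + ?e $ Inl j * x $ Inr j) =
            (\<Sum>j\<in>UNIV. if j = i then x $ Inr j else 0)"
          by (intro sum.cong) (auto simp: axis_def)
        then show ?thesis using polar[of ?e] by simp
      qed
      ultimately have "x $ s = 0" for s by (cases s) auto
      then show ?thesis by (simp add: vec_eq_iff)
    qed
    then show ?thesis
      by (simp add: invertible_left_inverse matrix_left_invertible_ker)
  qed
  then show ?thesis unfolding O_plus_def by blast
qed

section \<open>The orthogonal groups in dimension 2\<close>

definition mat2 :: "'a \<Rightarrow> 'a \<Rightarrow> 'a \<Rightarrow> 'a \<Rightarrow> 'a ^ (1 + 1) ^ (1 + 1)" where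
  "mat2 a b c d = (\<chi> i j. case i of
     Inl _ \<Rightarrow> (case j of Inl _ \<Rightarrow> a | Inr _ \<Rightarrow> b) |
     Inr _ \<Rightarrow> (case j of Inl _ \<Rightarrow> c | Inr _ \<Rightarrow> d))"

lemma mat2_nth [simp]:
  "mat2 a b c d $ Inl i $ Inl j = a" "mat2 a b c d $ Inl i $ Inr j = b"
  "mat2 a b c d $ Inr i $ Inl j = c" "mat2 a b c d $ Inr i $ Inr j = d"
  by (simp_all add: mat2_def)

lemma mat2_eta: obtains a b c d where "g = mat2 a b c d"
proof
  show "g = mat2 (g $ Inl 1 $ Inl 1) (g $ Inl 1 $ Inr 1) (g $ Inr 1 $ Inl 1) (g $ Inr 1 $ Inr 1)"
    unfolding vec_eq_iff
  proof (intro allI)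
    fix i j :: "1 + 1"
    show "g $ i $ j = mat2 (g $ Inl 1 $ Inl 1) (g $ Inl 1 $ Inr 1) (g $ Inr 1 $ Inl 1) (g $ Inr 1 $ Inr 1) $ i $ j"
      by (cases i; cases j) (metis mat2_nth num1_eq1)+
  qed
qed

lemma mat2_eq_iff [simp]: "mat2 a b c d = mat2 a' b' c' d' \<longleftrightarrow> a = a' \<and> b = b' \<and> c = c' \<and> d = d'"
  by (metis mat2_nth)

lemma trace_mat2 [simp]: "trace (mat2 a b c d) = (a + d :: 'a::comm_ring_1)"
  by (simp add: trace_def sum_UNIV_Plus)

lemma delta_mat2 [simp]: "delta_plus (mat2 a b c d) = (b * c :: 'a::field)"
  by (simp add: delta_plus_def trace_def block_B_def block_C_def matrix_matrix_mult_def transpose_def)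

lemma theta_mat2: "theta_plus (mat2 a b c d *v x) =
    (a * x $ Inl 1 + b * x $ Inr 1) * (c * x $ Inl 1 + d * x $ Inr 1 :: 'a::field)"
  by (simp add: theta_plus_def matrix_vector_mult_def sum_UNIV_Plus)

lemma mat2_in_O_plus_iff:
  "mat2 a b c d \<in> O_plus \<longleftrightarrow> a * c = 0 \<and> b * d = 0 \<and> a * d + b * c = (1::'a::field)"
proof
  assume "mat2 a b c d \<in> O_plus"
  then have *: "(a * x + b * y) * (c * x + d * y) = x * y" for x y
    unfolding O_plus_eq mem_Collect_eq theta_mat2
    by (auto simp: theta_plus_def dest!: spec[of _ "\<chi> i. case i of Inl _ \<Rightarrow> x | Inr _ \<Rightarrow> y"])
  have 1: "a * c = 0" "b * d = 0" using *[of 1 0] *[of 0 1] by simp_all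
  moreover have "a * d + b * c = 1"
    using *[of 1 1] 1 by (simp add: algebra_simps)
  ultimately show "a * c = 0 \<and> b * d = 0 \<and> a * d + b * c = 1" by simp
next
  assume A: "a * c = 0 \<and> b * d = 0 \<and> a * d + b * c = 1"
  have "(a * x + b * y) * (c * x + d * y) = a * c * x\<^sup>2 + b * d * y\<^sup>2 + (a * d + b * c) * (x * y)" for x y
    by (simp add: algebra_simps power2_eq_square)
  then show "mat2 a b c d \<in> O_plus"
    using A by (simp add: O_plus_eq theta_mat2) (simp add: theta_plus_def)
qed

definition diag2 :: "'a::field \<Rightarrow> 'a ^ (1 + 1) ^ (1 + 1)" where
  "diag2 x = mat2 x 0 0 (inverse x)"

definition adiag2 :: "'a::field \<Rightarrow> 'a ^ (1 + 1) ^ (1 + 1)" where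
  "adiag2 x = mat2 0 x (inverse x) 0"

lemma O_plus_2: "O_plus = diag2 ` (-{0}) \<union> adiag2 ` (-{0 :: 'a::field})" (is "_ = ?R")
proof (intro equalityI subsetI)
  fix g :: "'a ^ (1 + 1) ^ (1 + 1)" assume g: "g \<in> O_plus"
  obtain a b c d where gd: "g = mat2 a b c d" by (rule mat2_eta)
  with g have *: "a * c = 0" "b * d = 0" "a * d + b * c = 1" by (auto simp: mat2_in_O_plus_iff)
  show "g \<in> ?R"
  proof (cases "a = 0")
    case True
    then have "b * c = 1" using * by simp
    then have "b \<noteq> 0" "c = inverse b" "d = 0" using * by (auto simp: inverse_unique)
    then show ?thesis using True gd by (auto simp: adiag2_def)
  next
    case False
    then have "c = 0" "a * d = 1" using * by auto
    then have "d = inverse a" "b = 0" using * False by (auto simp: inverse_unique)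
    then show ?thesis using False gd \<open>c = 0\<close> by (auto simp: diag2_def)
  qed
next
  fix g :: "'a ^ (1 + 1) ^ (1 + 1)" assume "g \<in> ?R"
  then show "g \<in> O_plus" by (elim UnE imageE) (simp_all add: mat2_in_O_plus_iff diag2_def adiag2_def)
qed

lemma SO_plus_2: "SO_plus = diag2 ` (-{0 :: 'a::field})"
  unfolding SO_plus_def O_plus_2 by (auto simp: diag2_def adiag2_def)

lemma inj_diag2: "inj diag2"
  by (auto simp: inj_def diag2_def)

lemma inj_adiag2: "inj adiag2"
  by (auto simp: inj_def adiag2_def)

lemma diag2_disjoint: "diag2 ` (-{0}) \<inter> adiag2 ` (-{0 :: 'a::field}) = {}"
  by (auto simp: diag2_def adiag2_def)

context binary_field begin

lemma sum_SO_plus_2: "(\<Sum>g\<in>SO_plus. w (trace (g :: 'a^(1+1)^(1+1)))) = (\<Sum>x\<in>-{0::'a}. w (x + inverse x) :: int)"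
  unfolding SO_plus_2 by (subst sum.reindex) (auto simp: inj_on_subset[OF inj_diag2] diag2_def)

text \<open>All \<open>q - 1\<close> antidiagonal elements have trace 0. They raise the number of
  elements of trace 0 from 1 to \<open>q\<close>, and they add \<open>q - 1\<close> both to the
  order and to every character sum, so the difference of the two is the same as for
  \<open>SO_plus\<close>.\<close>

lemma sum_O_plus_2:
  "(\<Sum>g\<in>O_plus. w (trace (g :: 'a^(1+1)^(1+1)))) = (int q - 1) * w 0 + (\<Sum>x\<in>-{0::'a}. w (x + inverse x) :: int)"
proof -
  have "(\<Sum>g\<in>adiag2 ` (-{0::'a}). w (trace g)) = (int q - 1) * w 0"
    by (subst sum.reindex) (auto simp: inj_on_subset[OF inj_adiag2] adiag2_def card_nonzero of_nat_diff)
  moreover have "(\<Sum>g\<in>diag2 ` (-{0::'a}). w (trace g)) = (\<Sum>x\<in>-{0::'a}. w (x + inverse x))"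
    using sum_SO_plus_2[of w] by (simp add: SO_plus_2)
  ultimately show ?thesis
    unfolding O_plus_2 by (subst sum.union_disjoint[OF _ _ diag2_disjoint]) auto
qed

lemma card_eq_sum_indicator:
  "finite G \<Longrightarrow> int (card {g\<in>G. f g = b}) = (\<Sum>g\<in>G. if f g = b then 1 else 0)"
  by (simp add: sum.If_cases Int_def)

lemma sum_indicator_add_inverse:
  "(\<Sum>x\<in>-{0::'a}. if x + inverse x = b then 1 else (0::int)) = (if b = 0 then 1 else 1 + \<psi> (inverse b))"
proof -
  have "(\<Sum>x\<in>-{0::'a}. if x + inverse x = b then 1 else (0::int)) = int (card {u. u \<noteq> 0 \<and> u + inverse u = b})"
    by (simp add: sum.If_cases Int_def)
  then show ?thesis by (simp only: card_add_inverse_eq)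
qed

lemma card_SO_plus_2_trace:
  "int (card {g\<in>SO_plus. trace (g :: 'a^(1+1)^(1+1)) = b}) = (if b = 0 then 1 else 1 + \<psi> (inverse b))"
  by (subst card_eq_sum_indicator)
    (simp, simp only: sum_SO_plus_2[of "\<lambda>t. if t = b then 1 else 0"] sum_indicator_add_inverse)

lemma card_O_plus_2_trace:
  "int (card {g\<in>O_plus. trace (g :: 'a^(1+1)^(1+1)) = b}) = (if b = 0 then int q else 1 + \<psi> (inverse b))"
  by (subst card_eq_sum_indicator)
    (simp, simp only: sum_O_plus_2[of "\<lambda>t. if t = b then 1 else 0"] sum_indicator_add_inverse, simp)

lemma card_SO_plus_2: "card (SO_plus :: ('a ^ (1 + 1) ^ (1 + 1)) set) = q - 1"
  unfolding SO_plus_2 by (simp add: card_image inj_on_subset[OF inj_diag2] card_nonzero)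

lemma card_O_plus_2: "card (O_plus :: ('a ^ (1 + 1) ^ (1 + 1)) set) = 2 * (q - 1)"
  unfolding O_plus_2
  by (subst card_Un_disjoint[OF _ _ diag2_disjoint])
    (simp_all add: card_image inj_on_subset[OF inj_diag2] inj_on_subset[OF inj_adiag2] card_nonzero)

lemma sum_char_add_inverse: "(\<Sum>x\<in>-{0}. \<psi> (a * (x + inverse x))) = K (a\<^sup>2)" if "a \<noteq> 0"
  using kloosterman_scale[OF that, of a] by (simp add: algebra_simps power2_eq_square)

lemma sum_char_SO_plus_2:
  assumes "a \<noteq> 0"
  shows "(\<Sum>g\<in>SO_plus. \<psi> (a * trace (g :: 'a^(1+1)^(1+1)))) = K (a\<^sup>2)"
  using sum_SO_plus_2[of "\<lambda>t. \<psi> (a * t)"] assms by (simp add: sum_char_add_inverse)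

lemma sum_char_O_plus_2:
  assumes "a \<noteq> 0"
  shows "(\<Sum>g\<in>O_plus. \<psi> (a * trace (g :: 'a^(1+1)^(1+1)))) = int q - 1 + K (a\<^sup>2)"
  using sum_O_plus_2[of "\<lambda>t. \<psi> (a * t)"] assms by (simp add: sum_char_add_inverse)

text \<open>In the power moment the term \<open>a = 0\<close> vanishes because
  \<open>h \<ge> 1\<close>; expanding \<open>(M - k a)^h\<close> and isolating the summand
  \<open>l = h\<close> gives the recursion. The factor \<open>c\<close> is 1 in dimension 2 and
  \<open>q^2\<close> in dimension 4; keeping \<open>c^h\<close> on both sides keeps the identity
  among integers.\<close>

lemma moment_recursion:
  fixes f :: "'b \<Rightarrow> 'a" and c M :: int and k :: "'a \<Rightarrow> int"
  assumes fin: "finite G" and h: "h \<ge> 1"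
    and w: "\<And>a. a \<noteq> 0 \<Longrightarrow> int (card G) - (\<Sum>g\<in>G. \<psi> (a * f g)) = c * (M - k a)"
  shows "c ^ h * (\<Sum>a\<in>-{0}. k a ^ h) =
    c ^ h * (\<Sum>l=0..<h. (-1) ^ (h + l + 1) * int (h choose l) * M ^ (h - l) * (\<Sum>a\<in>-{0}. k a ^ l)) +
    int q * (\<Sum>j=0..min (card G) h. (-1) ^ (h + j) * int (card (zero_sum_sets G f j)) *
      (\<Sum>t=j..h. fact t * int (Stirling h t) * 2 ^ (h - t) * binom (int (card G) - int j) (int (card G) - int t)))"
proof -
  define X where "X j = int (card (zero_sum_sets G f j)) *
      (\<Sum>t=j..h. fact t * int (Stirling h t) * 2 ^ (h - t) * binom (int (card G) - int j) (int (card G) - int t))" for j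
  define S where "S l = (\<Sum>a\<in>-{0}. k a ^ l)" for l
  have "(\<Sum>a\<in>UNIV. (int (card G) - (\<Sum>g\<in>G. \<psi> (a * f g))) ^ h) =
      (\<Sum>a\<in>-{0}. (int (card G) - (\<Sum>g\<in>G. \<psi> (a * f g))) ^ h)"
    using h by (simp add: sum_nonzero)
  also have "\<dots> = (\<Sum>a\<in>-{0}. c ^ h * (- k a + M) ^ h)"
    by (intro sum.cong) (auto simp: w power_mult_distrib)
  also have "\<dots> = (\<Sum>a\<in>-{0}. c ^ h * (\<Sum>l\<le>h. int (h choose l) * (- k a) ^ l * M ^ (h - l)))"
    by (subst binomial_ring) simp
  also have "\<dots> = (\<Sum>a\<in>-{0}. \<Sum>l\<le>h. c ^ h * ((-1) ^ l * int (h choose l) * M ^ (h - l)) * k a ^ l)"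
    by (simp add: sum_distrib_left power_minus[of "k _"] ac_simps)
  also have "\<dots> = (\<Sum>l\<le>h. c ^ h * ((-1) ^ l * int (h choose l) * M ^ (h - l)) * S l)"
    by (subst sum.swap) (simp add: S_def sum_distrib_left)
  also have "\<dots> = c ^ h * (\<Sum>l=0..<h. (-1) ^ l * int (h choose l) * M ^ (h - l) * S l) + c ^ h * (-1) ^ h * S h"
    by (simp add: sum_distrib_left ac_simps atLeast0LessThan flip: lessThan_Suc_atMost)
  finally have "c ^ h * (\<Sum>l=0..<h. (-1) ^ l * int (h choose l) * M ^ (h - l) * S l) + c ^ h * (-1) ^ h * S h =
      int q * (\<Sum>j=0..min (card G) h. (-1) ^ j * X j)"
    using power_moment[OF fin, of f h] by (simp add: X_def mult.assoc)
  then have "(-1) ^ h * (c ^ h * (-1) ^ h * S h) =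
      (-1) ^ h * (int q * (\<Sum>j=0..min (card G) h. (-1) ^ j * X j)
        - c ^ h * (\<Sum>l=0..<h. (-1) ^ l * int (h choose l) * M ^ (h - l) * S l))"
    by simp
  moreover have "(-1) ^ h * (c ^ h * (-1) ^ h * S h) = c ^ h * S h"
    by (simp add: power_add[symmetric] flip: mult.assoc)
  moreover have "(-1) ^ h * (\<Sum>j=0..min (card G) h. (-1) ^ j * X j) = (\<Sum>j=0..min (card G) h. (-1) ^ (h + j) * X j)"
    by (simp add: sum_distrib_left power_add mult.assoc)
  moreover have "(-1) ^ h * (\<Sum>l=0..<h. (-1) ^ l * int (h choose l) * M ^ (h - l) * S l) =
      - (\<Sum>l=0..<h. (-1) ^ (h + l + 1) * int (h choose l) * M ^ (h - l) * S l)"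
    by (simp add: sum_distrib_left power_add mult.assoc sum_negf)
  ultimately have "c ^ h * S h = c ^ h * (\<Sum>l=0..<h. (-1) ^ (h + l + 1) * int (h choose l) * M ^ (h - l) * S l) +
      int q * (\<Sum>j=0..min (card G) h. (-1) ^ (h + j) * X j)"
    by (simp add: algebra_simps)
  then show ?thesis by (simp add: S_def X_def mult.assoc)
qed

end

text \<open>
  A vector of length 4 is read as the \<open>2 \<times> 2\<close> matrix \<open>((x\<^sub>1, x\<^sub>2), (x\<^sub>4, x\<^sub>3))\<close>, whose determinant is
  \<open>\<theta>\<^sup>+\<close> in characteristic 2. The coordinate \<open>s\<close> is the entry in row \<open>row4 s\<close> and column \<open>col4 s\<close>.
  Then \<open>tensor4 A B\<close> is the map \<open>X \<mapsto> A X B\<^sup>T\<close> and \<open>tensor4' A B\<close> the map \<open>X \<mapsto> A X\<^sup>T B\<^sup>T\<close>.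
\<close>

definition row4 :: "2 + 2 \<Rightarrow> 2" where
  "row4 s = (case s of Inl _ \<Rightarrow> 1 | Inr _ \<Rightarrow> 2)"

definition col4 :: "2 + 2 \<Rightarrow> 2" where
  "col4 s = (case s of Inl i \<Rightarrow> i | Inr i \<Rightarrow> (if i = 1 then 2 else 1))"

lemma row4_simps [simp]: "row4 (Inl i) = 1" "row4 (Inr i) = 2"
  by (simp_all add: row4_def)

lemma col4_simps [simp]: "col4 (Inl i) = i" "col4 (Inr 1) = 2" "col4 (Inr 2) = 1"
  by (simp_all add: col4_def)

definition tensor4 :: "'a::times ^ 2 ^ 2 \<Rightarrow> 'a ^ 2 ^ 2 \<Rightarrow> 'a ^ (2 + 2) ^ (2 + 2)" where
  "tensor4 A B = (\<chi> s t. A $ row4 s $ row4 t * B $ col4 s $ col4 t)"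

definition tensor4' :: "'a::times ^ 2 ^ 2 \<Rightarrow> 'a ^ 2 ^ 2 \<Rightarrow> 'a ^ (2 + 2) ^ (2 + 2)" where
  "tensor4' A B = (\<chi> s t. A $ row4 s $ col4 t * B $ col4 s $ row4 t)"

lemma forall_4: "(\<forall>s :: 2 + 2. P s) \<longleftrightarrow> P (Inl 1) \<and> P (Inl 2) \<and> P (Inr 1) \<and> P (Inr 2)"
  by (simp add: split_sum_all forall_2)

lemma sum_4: "(\<Sum>s\<in>(UNIV :: (2 + 2) set). f s) = f (Inl 1) + f (Inl 2) + f (Inr 1) + f (Inr 2)"
  by (simp add: sum_UNIV_Plus sum_2 add.assoc)

lemma theta_4: "theta_plus (x :: 'a::field ^ (2 + 2)) = x $ Inl 1 * x $ Inr 1 + x $ Inl 2 * x $ Inr 2"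
  by (simp add: theta_plus_def sum_2)

lemma trace_tensor4: "trace (tensor4 A B) = trace A * trace (B :: 'a::comm_ring_1 ^ 2 ^ 2)"
  by (simp add: trace_def tensor4_def sum_4 sum_2 algebra_simps)

section \<open>The group SO+(4,q) and its description by SL2 x SL2\<close>

context binary_field begin

lemma det2_char2: "det (A :: 'a ^ 2 ^ 2) = A $ 1 $ 1 * A $ 2 $ 2 + A $ 1 $ 2 * A $ 2 $ 1"
  by (simp add: det_2)

lemma theta_tensor4: "theta_plus (tensor4 A B *v x) = det A * det (B :: 'a ^ 2 ^ 2) * theta_plus x"
  unfolding theta_4 det2_char2 tensor4_def matrix_vector_mult_def
  by (simp add: sum_4 algebra_simps)

lemma tensor4_in_SO_plus:
  assumes "det (A :: 'a ^ 2 ^ 2) = 1" "det B = 1"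
  shows "tensor4 A B \<in> SO_plus"
proof -
  have "delta_plus (tensor4 A B) = 0"
    by (simp add: delta_plus_def trace_def block_B_def block_C_def matrix_matrix_mult_def
        transpose_def tensor4_def sum_2 algebra_simps)
  then show ?thesis using assms by (simp add: SO_plus_def O_plus_eq theta_tensor4)
qed

text \<open>For two matrices of determinant 1 the value is 1, which excludes \<open>tensor4'\<close>
  from \<open>SO_plus\<close>.\<close>

lemma delta_tensor4': "delta_plus (tensor4' A B) = det A * det (B :: 'a ^ 2 ^ 2)"
  unfolding det2_char2
  by (simp add: delta_plus_def trace_def block_B_def block_C_def matrix_matrix_mult_def
      transpose_def tensor4'_def sum_2 algebra_simps)

text \<open>Multiplying the square of an entry of \<open>A\<close> by \<open>det B\<close> gives an
  expression in products of one entry of each matrix, hence in the entries of the tensor product. As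
  both determinants are 1 and squaring is injective in characteristic 2, not even a sign is
  lost.\<close>

lemma tensor4_inj:
  assumes "tensor4 A B = tensor4 A' (B' :: 'a ^ 2 ^ 2)" "det A = 1" "det B = 1" "det A' = 1" "det B' = 1"
  shows "A = A'" "B = B'"
proof -
  have eq: "A $ i $ j * B $ k $ l = A' $ i $ j * B' $ k $ l" for i j k l
  proof -
    obtain s where s: "row4 s = i" "col4 s = k"
      using exhaust_2[of i] exhaust_2[of k] row4_simps col4_simps by metis
    obtain t where t: "row4 t = j" "col4 t = l"
      using exhaust_2[of j] exhaust_2[of l] row4_simps col4_simps by metis
    have "tensor4 A B $ s $ t = tensor4 A' B' $ s $ t" using assms by simp
    then show ?thesis by (simp add: tensor4_def s t)
  qed
  have "(A $ i $ j)\<^sup>2 = (A' $ i $ j)\<^sup>2" for i j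
  proof -
    have "(A $ i $ j)\<^sup>2 * det B = (A $ i $ j * B $ 1 $ 1) * (A $ i $ j * B $ 2 $ 2) + (A $ i $ j * B $ 1 $ 2) * (A $ i $ j * B $ 2 $ 1)"
      by (simp add: det2_char2 power2_eq_square algebra_simps)
    also have "\<dots> = (A' $ i $ j)\<^sup>2 * det B'"
      unfolding eq by (simp add: det2_char2 power2_eq_square algebra_simps)
    finally show ?thesis using assms by simp
  qed
  then show "A = A'" using injD[OF inj_square] by (simp add: vec_eq_iff)
  have "(B $ i $ j)\<^sup>2 = (B' $ i $ j)\<^sup>2" for i j
  proof -
    have "(B $ i $ j)\<^sup>2 * det A = (A $ 1 $ 1 * B $ i $ j) * (A $ 2 $ 2 * B $ i $ j) + (A $ 1 $ 2 * B $ i $ j) * (A $ 2 $ 1 * B $ i $ j)"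
      by (simp add: det2_char2 power2_eq_square algebra_simps)
    also have "\<dots> = (B' $ i $ j)\<^sup>2 * det A'"
      unfolding eq by (simp add: det2_char2 power2_eq_square algebra_simps)
    finally show ?thesis using assms by simp
  qed
  then show "B = B'" using injD[OF inj_square] by (simp add: vec_eq_iff)
qed

text \<open>The determinant of the matrix with columns \<open>u\<close> and \<open>v\<close>, in
  characteristic 2; it detects parallel vectors.\<close>

definition cross :: "'a ^ 2 \<Rightarrow> 'a ^ 2 \<Rightarrow> 'a" where
  "cross u v = u $ 1 * v $ 2 + u $ 2 * v $ 1"

lemma cross_eq_0:
  assumes "cross u v = 0" "u \<noteq> 0"
  obtains k where "v = k *s u"
proof -
  have "u $ 1 \<noteq> 0 \<or> u $ 2 \<noteq> 0" using assms by (auto simp: vec_eq_iff forall_2)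
  moreover have *: "u $ 1 * v $ 2 = u $ 2 * v $ 1" using assms by (simp add: cross_def add_eq_0_iff_eq)
  ultimately have "v = (v $ 1 / u $ 1) *s u \<or> v = (v $ 2 / u $ 2) *s u"
    by (auto simp: vec_eq_iff forall_2 field_simps)
  then show thesis using that by blast
qed

lemma cross_0 [simp]: "cross 0 v = 0" "cross u 0 = 0"
  by (simp_all add: cross_def)

lemma cross_commute: "cross u v = cross v u"
  by (simp add: cross_def algebra_simps)

lemma cross_scale [simp]: "cross (k *s u) v = k * cross u v" "cross u (k *s v) = k * cross u v"
  by (simp_all add: cross_def algebra_simps)

lemma cross_eq_0_basis:
  assumes "cross u v \<noteq> 0" "cross u w = 0" "cross v w = 0"
  shows "w = 0"
proof -
  have "u \<noteq> 0" using assms by auto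
  then obtain k where "w = k *s u" using assms cross_eq_0 by blast
  then have "k * cross v u = 0" using assms by simp
  then show ?thesis using assms \<open>w = k *s u\<close> cross_commute[of v u] by simp
qed

definition outer4 :: "'a ^ 2 \<Rightarrow> 'a ^ 2 \<Rightarrow> 'a ^ (2 + 2)" where
  "outer4 u v = (\<chi> s. u $ row4 s * v $ col4 s)"

text \<open>An isotropic vector is a singular \<open>2 \<times> 2\<close> matrix, so it has rank at
  most 1. If its first row is nonzero, that row serves as \<open>v\<close>; otherwise the second row
  does.\<close>

lemma isotropic_outer4:
  assumes "theta_plus (x :: 'a ^ (2 + 2)) = 0"
  obtains u v where "x = outer4 u v"
proof -
  have *: "x $ Inl 1 * x $ Inr 1 = x $ Inl 2 * x $ Inr 2"
    using assms by (simp add: theta_4 add_eq_0_iff_eq)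
  consider "x $ Inl 1 \<noteq> 0" | "x $ Inl 1 = 0" "x $ Inl 2 \<noteq> 0" | "x $ Inl 1 = 0" "x $ Inl 2 = 0"
    by blast
  then show thesis
  proof cases
    case 1
    show thesis
      by (rule that[of "vector [1, x $ Inr 2 / x $ Inl 1]" "vector [x $ Inl 1, x $ Inl 2]"])
        (use 1 * in \<open>auto simp: outer4_def vec_eq_iff forall_4 field_simps\<close>)
  next
    case 2
    show thesis
      by (rule that[of "vector [1, x $ Inr 1 / x $ Inl 2]" "vector [x $ Inl 1, x $ Inl 2]"])
        (use 2 * in \<open>auto simp: outer4_def vec_eq_iff forall_4 field_simps\<close>)
  next
    case 3
    show thesis
      by (rule that[of "vector [0, 1]" "vector [x $ Inr 2, x $ Inr 1]"])
        (use 3 in \<open>auto simp: outer4_def vec_eq_iff forall_4\<close>)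
  qed
qed

lemma theta_outer4_add:
  "theta_plus (outer4 u v + outer4 u' v') = cross u u' * cross v v'"
  by (simp add: theta_4 outer4_def cross_def algebra_simps)

text \<open>The four products fix \<open>A\<close> and \<open>B\<close> up to scaling them by
  \<open>s\<close> and \<open>1/s\<close>. The choice \<open>s^2 = c / cross p p'\<close>, possible
  because every element is a square, makes \<open>det A = 1\<close>, and then the first hypothesis
  makes \<open>det B = 1\<close>.\<close>

lemma ex_SL2_factors:
  assumes "cross p p' * cross v v' = 1" "c \<noteq> 0"
  obtains A B :: "'a ^ 2 ^ 2" where "det A = 1" "det B = 1"
    "\<And>i j. A $ i $ 1 * B $ j $ 1 = p $ i * v $ j"
    "\<And>i j. A $ i $ 1 * B $ j $ 2 = c * (p $ i * v' $ j)"
    "\<And>i j. A $ i $ 2 * B $ j $ 1 = inverse c * (p' $ i * v $ j)"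
    "\<And>i j. A $ i $ 2 * B $ j $ 2 = p' $ i * v' $ j"
proof -
  have pn: "cross p p' \<noteq> 0" using assms by auto
  obtain s where s: "s\<^sup>2 = c / cross p p'" using ex_sqrt by blast
  then have s0: "s \<noteq> 0" using assms pn by auto
  have s': "s * s * cross p p' = c" using s pn by (simp add: power2_eq_square)
  define A :: "'a ^ 2 ^ 2" where "A = (\<chi> i j. if j = 1 then s * p $ i else s / c * p' $ i)"
  define B :: "'a ^ 2 ^ 2" where "B = (\<chi> i j. if j = 1 then v $ i / s else c / s * v' $ i)"
  have "det A = s * s * cross p p' / c"
    by (simp add: det2_char2 A_def cross_def algebra_simps add_divide_distrib)
  then have "det A = 1" using s' assms by simp
  moreover have "det B = c * cross v v' / (s * s)"
    by (simp add: det2_char2 B_def cross_def algebra_simps add_divide_distrib)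
  then have "det B = 1" using s'[symmetric] assms s0 by simp
  ultimately show thesis
    by (rule that) (use s0 assms in \<open>auto simp: A_def B_def field_simps\<close>)
qed

lemma column_outer4:
  assumes "column (Inl 1) g = outer4 u\<^sub>1 v\<^sub>1" "column (Inl 2) g = outer4 u\<^sub>2 v\<^sub>2"
    "column (Inr 1) g = outer4 u\<^sub>3 v\<^sub>3" "column (Inr 2) g = outer4 u\<^sub>4 v\<^sub>4"
  shows "g $ s $ Inl 1 = u\<^sub>1 $ row4 s * v\<^sub>1 $ col4 s" "g $ s $ Inl 2 = u\<^sub>2 $ row4 s * v\<^sub>2 $ col4 s"
    "g $ s $ Inr 1 = u\<^sub>3 $ row4 s * v\<^sub>3 $ col4 s" "g $ s $ Inr 2 = u\<^sub>4 $ row4 s * v\<^sub>4 $ col4 s"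
  using assms by (simp_all add: column_def outer4_def vec_eq_iff)

text \<open>
  The columns of \<open>g\<close> are isotropic, hence of the form \<open>u v\<^sup>T\<close>, and the polar form of two such
  matrices is the product of the two cross products. Orthogonality therefore forces the two
  columns that are orthogonal to the hyperbolic pair \<open>u\<^sub>1 v\<^sub>1\<^sup>T, u\<^sub>3 v\<^sub>3\<^sup>T\<close> to be multiples of
  \<open>u\<^sub>1 v\<^sub>3\<^sup>T\<close> and \<open>u\<^sub>3 v\<^sub>1\<^sup>T\<close>, in one of the two possible orders.
\<close>

lemma O_plus_4_cases:
  assumes "g \<in> (O_plus :: ('a ^ (2 + 2) ^ (2 + 2)) set)"
  obtains A B where "det A = 1" "det B = 1" "g = tensor4 A B \<or> g = tensor4' A B"
proof -
  have g: "theta_plus (g *v x) = theta_plus x" for x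
    using assms by (simp add: O_plus_eq)
  have col: "column t g = g *v axis t 1" for t
    by (simp add: vec_eq_iff column_def matrix_vector_mult_def axis_def if_distrib cong: if_cong)
  have "theta_plus (column t g) = 0" for t
    unfolding col g by (cases t) (auto simp: theta_plus_def axis_def intro!: sum.neutral)
  then have "\<exists>u v. column t g = outer4 u v" for t using isotropic_outer4 by blast
  then obtain u v where uv: "\<And>t. column t g = outer4 (u t) (v t)" by metis
  have polar: "cross (u s) (u t) * cross (v s) (v t) = theta_plus (axis s 1 + axis t 1 :: 'a ^ (2 + 2))" for s t
    unfolding theta_outer4_add[symmetric] uv[symmetric] col matrix_vector_right_distrib[symmetric] g ..
  define u1 u2 u3 u4 where "u1 = u (Inl 1)" "u2 = u (Inl 2)" "u3 = u (Inr 1)" "u4 = u (Inr 2)"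
  define v1 v2 v3 v4 where "v1 = v (Inl 1)" "v2 = v (Inl 2)" "v3 = v (Inr 1)" "v4 = v (Inr 2)"
  note defs = u1_u2_u3_u4_def v1_v2_v3_v4_def
  have P: "cross u1 u3 * cross v1 v3 = 1" "cross u2 u4 * cross v2 v4 = 1"
    "cross u1 u2 * cross v1 v2 = 0" "cross u1 u4 * cross v1 v4 = 0"
    "cross u3 u2 * cross v3 v2 = 0" "cross u3 u4 * cross v3 v4 = 0"
    unfolding defs polar by (simp_all add: theta_4 axis_def)
  have nz: "cross u1 u3 \<noteq> 0" "cross v1 v3 \<noteq> 0" "cross u2 u4 \<noteq> 0" "cross v2 v4 \<noteq> 0"
    using P(1,2) by auto
  then have nz': "u1 \<noteq> 0" "u3 \<noteq> 0" "v1 \<noteq> 0" "v3 \<noteq> 0" "u2 \<noteq> 0" "u4 \<noteq> 0" "v2 \<noteq> 0" "v4 \<noteq> 0" by auto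
  \<comment> \<open>A nonzero \<open>u2\<close> cannot be parallel to both \<open>u1\<close> and
    \<open>u3\<close>, nor \<open>v2\<close> to both \<open>v1\<close> and \<open>v3\<close>; so the
    two vanishing products vanish in opposite factors.\<close>
  have two: "(cross u1 u2 = 0 \<and> cross v3 v2 = 0) \<or> (cross v1 v2 = 0 \<and> cross u3 u2 = 0)"
    using P(3,5) cross_eq_0_basis[OF nz(1), of u2] cross_eq_0_basis[OF nz(2), of v2] nz'
    by (metis mult_eq_0_iff)
  have four: "(cross u1 u4 = 0 \<and> cross v3 v4 = 0) \<or> (cross v1 v4 = 0 \<and> cross u3 u4 = 0)"
    using P(4,6) cross_eq_0_basis[OF nz(1), of u4] cross_eq_0_basis[OF nz(2), of v4] nz'
    by (metis mult_eq_0_iff)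
  have par: "cross x y = 0" if z: "cross z x = 0" "cross z y = 0" "z \<noteq> 0" for x y z
  proof -
    obtain k where "x = k *s z" using cross_eq_0 z by blast
    then show ?thesis using z by simp
  qed
  note G = column_outer4[OF uv uv uv uv, folded defs]
  \<comment> \<open>The mixed combinations cannot occur: there \<open>u2\<close> and
    \<open>u4\<close> would be parallel to the same vector, against
    \<open>cross u2 u4 \<noteq> 0\<close> for the second hyperbolic pair.\<close>
  consider (1) "cross u1 u2 = 0" "cross v3 v2 = 0" "cross v1 v4 = 0" "cross u3 u4 = 0"
    | (2) "cross v1 v2 = 0" "cross u3 u2 = 0" "cross u1 u4 = 0" "cross v3 v4 = 0"
    using two four par[of u1 u2 u4] par[of u3 u2 u4] nz nz' by blast
  then show thesis
  proof cases
    case 1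
    obtain k where k: "u2 = k *s u1" using cross_eq_0 1 nz' by blast
    obtain k' where k': "v2 = k' *s v3" using cross_eq_0 1 nz' by blast
    obtain m where m: "u4 = m *s u3" using cross_eq_0 1 nz' by blast
    obtain m' where m': "v4 = m' *s v1" using cross_eq_0 1 nz' by blast
    have "cross u2 u4 * cross v2 v4 = k * k' * (m * m') * (cross u1 u3 * cross v1 v3)"
      by (simp add: k k' m m' cross_commute[of v3 v1] algebra_simps)
    then have c: "k * k' * (m * m') = 1" using P by simp
    then have c0: "k * k' \<noteq> 0" by auto
    have inv: "inverse (k * k') = m * m'" using c by (rule inverse_unique)
    obtain A B :: "'a ^ 2 ^ 2" where AB: "det A = 1" "det B = 1"
      "\<And>i j. A $ i $ 1 * B $ j $ 1 = u1 $ i * v1 $ j"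
      "\<And>i j. A $ i $ 1 * B $ j $ 2 = k * k' * (u1 $ i * v3 $ j)"
      "\<And>i j. A $ i $ 2 * B $ j $ 1 = inverse (k * k') * (u3 $ i * v1 $ j)"
      "\<And>i j. A $ i $ 2 * B $ j $ 2 = u3 $ i * v3 $ j"
      using ex_SL2_factors[OF P(1) c0] by metis
    have "\<forall>t. g $ s $ t = tensor4 A B $ s $ t" for s
      unfolding forall_4
      by (simp add: tensor4_def G AB inv k k' m m' del: inverse_mult_distrib)
    then have "g = tensor4 A B" by (simp add: vec_eq_iff)
    then show thesis using that AB by blast
  next
    case 2
    obtain k where k: "u2 = k *s u3" using cross_eq_0 2 nz' by blast
    obtain k' where k': "v2 = k' *s v1" using cross_eq_0 2 nz' by blast
    obtain m where m: "u4 = m *s u1" using cross_eq_0 2 nz' by blast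
    obtain m' where m': "v4 = m' *s v3" using cross_eq_0 2 nz' by blast
    have "cross u2 u4 * cross v2 v4 = m * m' * (k * k') * (cross u1 u3 * cross v1 v3)"
      by (simp add: k k' m m' cross_commute[of u3 u1] algebra_simps)
    then have c: "m * m' * (k * k') = 1" using P by simp
    then have c0: "m * m' \<noteq> 0" by auto
    have inv: "inverse (m * m') = k * k'" using c by (rule inverse_unique)
    obtain A B :: "'a ^ 2 ^ 2" where AB: "det A = 1" "det B = 1"
      "\<And>i j. A $ i $ 1 * B $ j $ 1 = u1 $ i * v1 $ j"
      "\<And>i j. A $ i $ 1 * B $ j $ 2 = m * m' * (u1 $ i * v3 $ j)"
      "\<And>i j. A $ i $ 2 * B $ j $ 1 = inverse (m * m') * (u3 $ i * v1 $ j)"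
      "\<And>i j. A $ i $ 2 * B $ j $ 2 = u3 $ i * v3 $ j"
      using ex_SL2_factors[OF P(1) c0] by metis
    have "\<forall>t. g $ s $ t = tensor4' A B $ s $ t" for s
      unfolding forall_4
      by (simp add: tensor4'_def G AB inv k k' m m' del: inverse_mult_distrib)
    then have "g = tensor4' A B" by (simp add: vec_eq_iff)
    then show thesis using that AB by blast
  qed
qed

definition SL2 :: "('a ^ 2 ^ 2) set" where
  "SL2 = {A. det A = 1}"

lemma SO_plus_4: "bij_betw (\<lambda>(A, B). tensor4 A B) (SL2 \<times> SL2) (SO_plus :: ('a ^ (2 + 2) ^ (2 + 2)) set)"
proof (rule bij_betw_imageI)
  show "inj_on (\<lambda>(A, B). tensor4 A B) (SL2 \<times> SL2)"
    using tensor4_inj by (fastforce simp: inj_on_def SL2_def)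
  show "(\<lambda>(A, B). tensor4 A B) ` (SL2 \<times> SL2) = SO_plus"
  proof (intro equalityI subsetI)
    fix g :: "'a ^ (2 + 2) ^ (2 + 2)" assume g: "g \<in> SO_plus"
    then have "g \<in> O_plus" "delta_plus g = 0" by (auto simp: SO_plus_def)
    then obtain A B where AB: "det A = 1" "det B = 1" "g = tensor4 A B \<or> g = tensor4' A B"
      using O_plus_4_cases by blast
    then have "g = tensor4 A B" using \<open>delta_plus g = 0\<close> delta_tensor4'[of A B] by auto
    then show "g \<in> (\<lambda>(A, B). tensor4 A B) ` (SL2 \<times> SL2)" using AB by (auto simp: SL2_def)
  next
    fix g assume "g \<in> (\<lambda>(A, B). tensor4 A B) ` (SL2 \<times> SL2)"
    then obtain z where z: "g = (\<lambda>(A, B). tensor4 A B) z" "z \<in> SL2 \<times> SL2" by (rule imageE)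
    then have "fst z \<in> SL2" "snd z \<in> SL2" "g = tensor4 (fst z) (snd z)"
      by (auto simp only: mem_Times_iff case_prod_beta)
    then show "g \<in> SO_plus" by (simp add: SL2_def tensor4_in_SO_plus)
  qed
qed

section \<open>Trace distribution and character sums on SL2 and SO+(4,q)\<close>

lemma card_mult_eq: "int (card {(b, c). b * c = (e::'a)}) = int q - 1 + (if e = 0 then int q else 0)"
proof -
  have "{(b, c). b * c = e} = (SIGMA b:UNIV. {c. b * c = e})" by auto
  then have "int (card {(b, c). b * c = e}) = (\<Sum>b\<in>UNIV. int (card {c. b * c = e}))"
    by (simp add: card_SigmaI)
  also have "\<dots> = (\<Sum>b\<in>-{0}. int (card {c. b * c = e})) + int (card {c. 0 * c = e})"
    by (simp add: sum_nonzero)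
  also have "(\<Sum>b\<in>-{0}. int (card {c. b * c = e})) = (\<Sum>b\<in>-{0::'a}. 1)"
  proof (rule sum.cong[OF refl])
    fix b :: 'a assume "b \<in> -{0}"
    then have "{c. b * c = e} = {e / b}" by (auto simp: field_simps)
    then show "int (card {c. b * c = e}) = 1" by simp
  qed
  finally show ?thesis by (auto simp: card_nonzero of_nat_diff card_field)
qed

definition sl2_count :: "'a \<Rightarrow> int" where
  "sl2_count t = int q ^ 2 + int q * (if t = 0 then 0 else \<psi> (inverse t))"

text \<open>The upper left entry \<open>a\<close> and the trace fix the diagonal, and the
  off-diagonal product must be \<open>a^2 + t a + 1\<close>. This leaves \<open>q - 1\<close>
  choices for each \<open>a\<close>, and \<open>q\<close> more when \<open>a\<close> is a root, so
  the root count of the quadratic decides.\<close>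

lemma card_SL2_trace: "int (card {A\<in>SL2. trace A = t}) = sl2_count t"
proof -
  let ?S = "SIGMA a:UNIV. {(b, c). b * c = a\<^sup>2 + t * a + 1}"
  have "bij_betw (\<lambda>A. (A $ 1 $ 1, (A $ 1 $ 2, A $ 2 $ 1))) {A\<in>SL2. trace A = t} ?S"
  proof (rule bij_betwI[where g = "\<lambda>(a, (b, c)). vector [vector [a, b], vector [c, a + t]]"])
    show "(\<lambda>A. (A $ 1 $ 1, (A $ 1 $ 2, A $ 2 $ 1))) \<in> {A\<in>SL2. trace A = t} \<rightarrow> ?S"
    proof
      fix A assume "A \<in> {A\<in>SL2. trace A = t}"
      then have d: "A $ 1 $ 1 * A $ 2 $ 2 + A $ 1 $ 2 * A $ 2 $ 1 = 1" and t: "t = A $ 1 $ 1 + A $ 2 $ 2"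
        by (auto simp: SL2_def det2_char2 trace_def sum_2)
      have "A $ 1 $ 2 * A $ 2 $ 1 = (A $ 1 $ 1)\<^sup>2 + t * A $ 1 $ 1 + 1"
        unfolding t d[symmetric] by (simp add: power2_eq_square algebra_simps)
      then show "(A $ 1 $ 1, (A $ 1 $ 2, A $ 2 $ 1)) \<in> ?S" by simp
    qed
    show "(\<lambda>(a, (b, c)). vector [vector [a, b], vector [c, a + t]]) \<in> ?S \<rightarrow> {A\<in>SL2. trace A = t}"
      by (auto simp: SL2_def det2_char2 trace_def sum_2 power2_eq_square algebra_simps)
    show "(case (A $ 1 $ 1, (A $ 1 $ 2, A $ 2 $ 1)) of (a, (b, c)) \<Rightarrow> vector [vector [a, b], vector [c, a + t]]) = A"
      if "A \<in> {A\<in>SL2. trace A = t}" for A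
      using that by (auto simp: trace_def sum_2 vec_eq_iff forall_2)
  qed auto
  then have "int (card {A\<in>SL2. trace A = t}) = int (card ?S)" by (simp add: bij_betw_same_card)
  also have "\<dots> = (\<Sum>a\<in>UNIV. int (card {(b, c). b * c = a\<^sup>2 + t * a + 1}))"
    by (simp add: card_SigmaI)
  also have "\<dots> = (\<Sum>a\<in>UNIV. (int q - 1) + (if a\<^sup>2 + t * a + 1 = 0 then int q else 0))"
    by (simp only: card_mult_eq)
  also have "\<dots> = int q * (int q - 1) + int q * int (card {a. a\<^sup>2 + t * a + 1 = 0})"
    by (subst sum.distrib) (simp add: sum.If_cases card_field)
  also have "\<dots> = sl2_count t"
    unfolding card_quadratic_roots sl2_count_def by (simp add: algebra_simps power2_eq_square)
  finally show ?thesis .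
qed

lemma sum_SL2: "(\<Sum>A\<in>SL2. w (trace A)) = (\<Sum>t\<in>UNIV. sl2_count t * (w t :: int))"
proof -
  have "(\<Sum>A\<in>SL2. w (trace A)) = (\<Sum>t\<in>UNIV. \<Sum>A\<in>{A\<in>SL2. trace A = t}. w (trace A))"
    by (rule sum.group[symmetric]) auto
  also have "\<dots> = (\<Sum>t\<in>UNIV. int (card {A\<in>SL2. trace A = t}) * w t)"
    by (intro sum.cong) auto
  finally show ?thesis by (simp only: card_SL2_trace)
qed

lemma sum_sl2_count: "(\<Sum>t\<in>UNIV. sl2_count t * (w t :: int)) =
    int q ^ 2 * (\<Sum>t\<in>UNIV. w t) + int q * (\<Sum>t\<in>-{0}. \<psi> (inverse t) * w t)"
proof -
  have "(\<Sum>t\<in>UNIV. (if t = 0 then 0 else \<psi> (inverse t)) * w t) =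
      (\<Sum>t\<in>-{0}. (if t = 0 then 0 else \<psi> (inverse t)) * w t)"
    by (subst sum_nonzero) simp
  also have "\<dots> = (\<Sum>t\<in>-{0}. \<psi> (inverse t) * w t)" by (intro sum.cong) auto
  finally show ?thesis
    unfolding sl2_count_def by (simp add: distrib_right sum.distrib mult.assoc flip: sum_distrib_left)
qed

lemma sum_char_inverse: "(\<Sum>t\<in>-{0}. \<psi> (inverse t)) = -1"
  using sum.reindex_bij_witness[of "-{0}" inverse inverse "-{0}" \<psi> "\<lambda>t. \<psi> (inverse t)"]
  by (auto simp: sum_char_nonzero)

lemma sum_char_mult_nonzero: "a \<noteq> 0 \<Longrightarrow> (\<Sum>t\<in>-{0}. \<psi> (t * a)) = -1"
  by (simp add: sum_nonzero sum_char_mult)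

lemma sum_sl2_count_1: "(\<Sum>t\<in>UNIV. sl2_count t) = int q ^ 3 - int q"
  using sum_sl2_count[of "\<lambda>t. 1"]
  by (simp add: sum_char_inverse card_field power3_eq_cube power2_eq_square)

text \<open>For \<open>s \<noteq> 0\<close> the constant part \<open>q^2\<close> of the count is
  killed by orthogonality, and the twisted part \<open>\<psi> (1/t) * \<psi> (s t)\<close> sums to a
  Kloosterman sum.\<close>

lemma sum_sl2_count_char:
  "(\<Sum>t\<in>UNIV. sl2_count t * \<psi> (s * t)) = (if s = 0 then int q ^ 3 - int q else int q * K s)"
proof (cases "s = 0")
  case True
  then show ?thesis by (simp add: sum_sl2_count_1)
next
  case False
  have "(\<Sum>t\<in>-{0}. \<psi> (inverse t) * \<psi> (s * t)) = K s"
    using kloosterman_scale[OF False, of 1] by (simp add: char_add mult.commute)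
  then show ?thesis
    using False sum_char_mult[of s] by (subst sum_sl2_count) (simp add: mult.commute)
qed

lemma sum_SO_plus_4: "(\<Sum>g\<in>SO_plus. w (trace (g :: 'a ^ (2 + 2) ^ (2 + 2)))) =
    (\<Sum>t\<in>UNIV. sl2_count t * (\<Sum>u\<in>UNIV. sl2_count u * (w (t * u) :: int)))"
proof -
  have "(\<Sum>g\<in>SO_plus. w (trace (g :: 'a ^ (2 + 2) ^ (2 + 2)))) =
      (\<Sum>(A, B)\<in>SL2 \<times> SL2. w (trace A * trace B))"
    by (subst sum.reindex_bij_betw[OF SO_plus_4, symmetric])
      (simp add: case_prod_beta trace_tensor4)
  also have "\<dots> = (\<Sum>A\<in>SL2. \<Sum>B\<in>SL2. w (trace A * trace B))"
    by (rule sum.cartesian_product[symmetric])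
  also have "\<dots> = (\<Sum>A\<in>SL2. (\<lambda>t. \<Sum>u\<in>UNIV. sl2_count u * w (t * u)) (trace A))"
    by (simp add: sum_SL2[of "\<lambda>u. w (_ * u)"])
  also have "\<dots> = (\<Sum>t\<in>UNIV. sl2_count t * (\<Sum>u\<in>UNIV. sl2_count u * w (t * u)))"
    by (rule sum_SL2)
  finally show ?thesis .
qed

lemma card_SO_plus_4: "int (card (SO_plus :: ('a ^ (2 + 2) ^ (2 + 2)) set)) = int q ^ 2 * (int q ^ 2 - 1) ^ 2"
proof -
  have "int (card (SO_plus :: ('a ^ (2 + 2) ^ (2 + 2)) set)) = (int q ^ 3 - int q) * (int q ^ 3 - int q)"
    using sum_SO_plus_4[of "\<lambda>t. 1"] by (simp add: sum_sl2_count_1 flip: sum_distrib_right)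
  then show ?thesis by (simp add: power2_eq_square power3_eq_cube algebra_simps)
qed

text \<open>Summing over the second factor gives \<open>q * K (a t)\<close> for
  \<open>t \<noteq> 0\<close>. The first factor then contributes the plain sum of
  \<open>K (a t)\<close>, which is 1, and the sum twisted by \<open>\<psi> (1/t)\<close>, which is
  \<open>K2 a\<close>.\<close>

lemma sum_char_SO_plus_4:
  assumes "a \<noteq> 0"
  shows "(\<Sum>g\<in>SO_plus. \<psi> (a * trace (g :: 'a ^ (2 + 2) ^ (2 + 2)))) = int q ^ 2 * (int q ^ 3 + K2 a)"
proof -
  have "(\<Sum>g\<in>SO_plus. \<psi> (a * trace (g :: 'a ^ (2 + 2) ^ (2 + 2)))) =
      (\<Sum>t\<in>UNIV. sl2_count t * (\<Sum>u\<in>UNIV. sl2_count u * \<psi> ((a * t) * u)))"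
    using sum_SO_plus_4[of "\<lambda>t. \<psi> (a * t)"] by (simp add: mult.assoc)
  also have "\<dots> = (\<Sum>t\<in>UNIV. sl2_count t * (if a * t = 0 then int q ^ 3 - int q else int q * K (a * t)))"
    by (simp only: sum_sl2_count_char)
  also have "\<dots> = int q ^ 2 * (\<Sum>t\<in>UNIV. if a * t = 0 then int q ^ 3 - int q else int q * K (a * t)) +
      int q * (\<Sum>t\<in>-{0}. \<psi> (inverse t) * (if a * t = 0 then int q ^ 3 - int q else int q * K (a * t)))"
    by (rule sum_sl2_count)
  also have "(\<Sum>t\<in>-{0}. \<psi> (inverse t) * (if a * t = 0 then int q ^ 3 - int q else int q * K (a * t))) =
      (\<Sum>t\<in>-{0}. int q * (\<psi> (inverse t) * K (a * t)))"
    by (intro sum.cong) (use assms in auto)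
  also have "\<dots> = int q * K2 a" by (simp add: kloosterman2_eq sum_distrib_left)
  also have "(\<Sum>t\<in>UNIV. if a * t = 0 then int q ^ 3 - int q else int q * K (a * t)) =
      int q ^ 3 - int q + (\<Sum>t\<in>-{0}. if a * t = 0 then int q ^ 3 - int q else int q * K (a * t))"
    by (subst sum_nonzero) simp
  also have "(\<Sum>t\<in>-{0}. if a * t = 0 then int q ^ 3 - int q else int q * K (a * t)) =
      (\<Sum>t\<in>-{0}. int q * K (a * t))"
    by (intro sum.cong) (use assms in auto)
  also have "\<dots> = int q" using sum_kloosterman_mult[OF assms] by (simp flip: sum_distrib_left)
  finally show ?thesis by (simp add: algebra_simps power2_eq_square)
qed

lemma card_SO_plus_4_trace_0:
  "int (card {g\<in>SO_plus. trace (g :: 'a ^ (2 + 2) ^ (2 + 2)) = 0}) = int q ^ 3 * (2 * int q ^ 2 - int q - 2)"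
proof -
  have n0: "sl2_count 0 = int q ^ 2" by (simp add: sl2_count_def)
  have "int (card {g\<in>SO_plus. trace (g :: 'a ^ (2 + 2) ^ (2 + 2)) = 0}) =
      (\<Sum>t\<in>UNIV. sl2_count t * (\<Sum>u\<in>UNIV. sl2_count u * (if t * u = 0 then 1 else 0)))"
    by (subst card_eq_sum_indicator) (simp, rule sum_SO_plus_4)
  also have "\<dots> = sl2_count 0 * (int q ^ 3 - int q) +
      (\<Sum>t\<in>-{0}. sl2_count t * (\<Sum>u\<in>UNIV. sl2_count u * (if t * u = 0 then 1 else 0)))"
    by (subst sum_nonzero) (simp add: sum_sl2_count_1)
  also have "(\<Sum>t\<in>-{0}. sl2_count t * (\<Sum>u\<in>UNIV. sl2_count u * (if t * u = 0 then 1 else 0))) =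
      (\<Sum>t\<in>-{0}. sl2_count t * sl2_count 0)"
  proof (rule sum.cong[OF refl])
    fix t :: 'a assume "t \<in> -{0}"
    then have "(\<Sum>u\<in>UNIV. sl2_count u * (if t * u = 0 then 1 else 0)) = (\<Sum>u\<in>UNIV. if u = 0 then sl2_count u else 0)"
      by (intro sum.cong) auto
    then show "sl2_count t * (\<Sum>u\<in>UNIV. sl2_count u * (if t * u = 0 then 1 else 0)) = sl2_count t * sl2_count 0"
      by simp
  qed
  also have "\<dots> = (int q ^ 3 - int q - sl2_count 0) * sl2_count 0"
    by (simp add: sum_nonzero sum_sl2_count_1 flip: sum_distrib_right)
  finally show ?thesis by (simp add: n0 algebra_simps power2_eq_square power3_eq_cube)
qed

text \<open>The traces of the two factors are \<open>t\<close> and \<open>b/t\<close>. In the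
  product of their counts the mixed term \<open>\<psi> (1/t) * \<psi> (t/b)\<close> sums to
  \<open>K (1/b)\<close>, and each single character to -1.\<close>

lemma card_SO_plus_4_trace:
  assumes "b \<noteq> 0"
  shows "int (card {g\<in>SO_plus. trace (g :: 'a ^ (2 + 2) ^ (2 + 2)) = b}) =
    int q ^ 2 * (int q ^ 3 - int q ^ 2 - 2 * int q + K (inverse b))"
proof -
  have "int (card {g\<in>SO_plus. trace (g :: 'a ^ (2 + 2) ^ (2 + 2)) = b}) =
      (\<Sum>t\<in>UNIV. sl2_count t * (\<Sum>u\<in>UNIV. sl2_count u * (if t * u = b then 1 else 0)))"
    by (subst card_eq_sum_indicator) (simp, rule sum_SO_plus_4)
  also have "\<dots> = (\<Sum>t\<in>-{0}. sl2_count t * (\<Sum>u\<in>UNIV. sl2_count u * (if t * u = b then 1 else 0)))"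
    using assms by (subst sum_nonzero) simp
  also have "\<dots> = (\<Sum>t\<in>-{0}. (int q ^ 2 + int q * \<psi> (inverse t)) * (int q ^ 2 + int q * \<psi> (t * inverse b)))"
  proof (rule sum.cong[OF refl])
    fix t :: 'a assume t: "t \<in> -{0}"
    then have "(\<Sum>u\<in>UNIV. sl2_count u * (if t * u = b then 1 else 0)) = (\<Sum>u\<in>UNIV. if u = b / t then sl2_count u else 0)"
      by (intro sum.cong) (auto simp: field_simps)
    then show "sl2_count t * (\<Sum>u\<in>UNIV. sl2_count u * (if t * u = b then 1 else 0)) =
        (int q ^ 2 + int q * \<psi> (inverse t)) * (int q ^ 2 + int q * \<psi> (t * inverse b))"
      using t assms by (simp add: sl2_count_def divide_inverse mult.commute)
  qed
  also have "\<dots> = (\<Sum>t\<in>-{0}. int q ^ 4 + int q ^ 3 * \<psi> (inverse t) + int q ^ 3 * \<psi> (t * inverse b)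
      + int q ^ 2 * \<psi> (inverse b * t + 1 * inverse t))"
    by (intro sum.cong refl) (simp add: char_add algebra_simps eval_nat_numeral)
  also have "\<dots> = int q ^ 4 * (int q - 1) + int q ^ 3 * (-1) + int q ^ 3 * (-1) + int q ^ 2 * K (inverse b)"
    using assms unfolding sum.distrib sum_distrib_left[symmetric]
    by (subst kloosterman_scale) (simp_all add: sum_char_inverse sum_char_mult_nonzero card_nonzero of_nat_diff mult.commute)
  finally show ?thesis by (simp add: algebra_simps eval_nat_numeral)
qed

end

section \<open>The Weil bound for Kloosterman sums\<close>

text \<open>Coprimality in Bezout form: the coefficients themselves enter the witnesses of
  \<open>other_root\<close>.\<close>

definition comaximal :: "'a::comm_ring_1 \<Rightarrow> 'a \<Rightarrow> bool" where
  "comaximal a b \<longleftrightarrow> (\<exists>u v. u * a + v * b = 1)"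

lemma comaximal_commute: "comaximal a b \<longleftrightarrow> comaximal b a"
  unfolding comaximal_def by (metis add.commute)

lemma comaximal_mult_right:
  assumes "comaximal a b" "comaximal a c"
  shows "comaximal a (b * c)"
proof -
  obtain u v u' v' where *: "u * a + v * b = 1" "u' * a + v' * c = 1"
    using assms unfolding comaximal_def by blast
  have "(u * (u' * a + v' * c) + v * b * u') * a + (v * v') * (b * c) = (u * a + v * b) * (u' * a + v' * c)"
    by (simp add: algebra_simps)
  also have "\<dots> = 1" by (simp add: *)
  finally show ?thesis unfolding comaximal_def by blast
qed

lemma comaximal_1 [simp]: "comaximal a 1"
  unfolding comaximal_def by (intro exI[of _ 0] exI[of _ 1]) simp

lemma comaximal_power: "comaximal a b \<Longrightarrow> comaximal a (b ^ n)"
  by (induction n) (auto intro: comaximal_mult_right)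

lemma comaximal_prod: "finite S \<Longrightarrow> (\<And>s. s \<in> S \<Longrightarrow> comaximal a (f s)) \<Longrightarrow> comaximal a (prod f S)"
  by (induction S rule: finite_induct) (auto intro: comaximal_mult_right)

lemma comaximal_dvd_mult:
  assumes "comaximal a b" "a dvd b * c"
  shows "a dvd c"
proof -
  obtain u v where "u * a + v * b = 1" using assms unfolding comaximal_def by blast
  then have "c = (u * a + v * b) * c" by simp
  also have "\<dots> = a * (u * c) + v * (b * c)" by (simp add: algebra_simps)
  finally show ?thesis using assms by (metis dvd_add dvd_mult dvd_triv_left)
qed

lemma comaximal_linear:
  fixes p :: "'a::field poly"
  assumes "poly p s \<noteq> 0"
  shows "comaximal p [:- s, 1:]"
proof -
  have eq: "[:- s, 1:] * synthetic_div p s + [:poly p s:] = p"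
    by (rule synthetic_div_correct')
  have "c * (l * S + e) + (- c * S) * l = c * e" for c l S e :: "'a poly"
    by (simp add: algebra_simps)
  from this[of "[:inverse (poly p s):]" "[:- s, 1:]" "synthetic_div p s" "[:poly p s:]"]
  have "[:inverse (poly p s):] * p + (- [:inverse (poly p s):] * synthetic_div p s) * [:- s, 1:] =
      [:inverse (poly p s):] * [:poly p s:]"
    unfolding eq .
  also have "\<dots> = 1" using assms by (simp add: one_pCons)
  finally show ?thesis unfolding comaximal_def by blast
qed

lemma prod_linear_dvd:
  fixes p :: "'a::field poly"
  assumes "finite S" "\<And>s. s \<in> S \<Longrightarrow> poly p s = 0"
  shows "(\<Prod>s\<in>S. [:- s, 1:]) dvd p"
  using assms
proof (induction S rule: finite_induct)
  case (insert s S)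
  then obtain k where k: "p = (\<Prod>s\<in>S. [:- s, 1:]) * k" by (auto simp: dvd_def)
  have "poly (\<Prod>s\<in>S. [:- s, 1:]) s \<noteq> 0" using insert by (auto simp: poly_prod)
  then have "poly k s = 0" using insert.prems[of s] by (simp add: k)
  then have "[:- s, 1:] dvd k" by (simp add: poly_eq_0_iff_dvd)
  then have "[:- s, 1:] * (\<Prod>s\<in>S. [:- s, 1:]) dvd k * (\<Prod>s\<in>S. [:- s, 1:])"
    by (rule mult_dvd_mono) simp
  then show ?case
    unfolding prod.insert[OF insert.hyps] k by (subst (2) mult.commute)
qed simp

lemma degree_prod_linear:
  fixes S :: "'a::field set"
  shows "finite S \<Longrightarrow> degree (\<Prod>s\<in>S. [:- s, 1:]) = card S"
  by (subst degree_prod_sum_eq) auto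

text \<open>For comaximal \<open>A\<close>, \<open>B\<close> this is the degree of
  \<open>A/B\<close> as a map of the projective line.\<close>

definition mdeg :: "'a::zero poly \<Rightarrow> 'a poly \<Rightarrow> nat" where
  "mdeg A B = max (degree A) (degree B)"

text \<open>A Gauss lemma for the degree: the three polynomials are the coefficients of the product
  of the linear forms \<open>C S + D T\<close> and \<open>E S + G T\<close>. Comparing degrees
  within each pair singles out one coefficient whose leading term cannot cancel.\<close>

lemma mdeg_mult:
  fixes C D E G :: "'a::field poly"
  assumes "C \<noteq> 0 \<or> D \<noteq> 0" "E \<noteq> 0 \<or> G \<noteq> 0"
  shows "max (degree (C * E)) (max (degree (C * G + E * D)) (degree (D * G))) = mdeg C D + mdeg E G"
proof (rule antisym)
  have "degree (P * Q) \<le> mdeg C D + mdeg E G" if "P \<in> {C, D}" "Q \<in> {E, G}" for P Q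
    using degree_mult_le[of P Q] that by (auto simp: mdeg_def)
  then have "degree (C * E) \<le> mdeg C D + mdeg E G" "degree (C * G) \<le> mdeg C D + mdeg E G"
    "degree (D * E) \<le> mdeg C D + mdeg E G" "degree (D * G) \<le> mdeg C D + mdeg E G" by blast+
  then show "max (degree (C * E)) (max (degree (C * G + E * D)) (degree (D * G))) \<le> mdeg C D + mdeg E G"
    by (simp add: degree_add_le mult.commute)
next
  have cross: "degree (P * Q + R * S) = degree P + degree Q"
    if "P \<noteq> 0" "Q \<noteq> 0" "degree S < degree P \<or> S = 0" "degree R < degree Q \<or> R = 0"
    for P Q R S :: "'a poly"
  proof (cases "R = 0 \<or> S = 0")
    case True
    then show ?thesis using that by (auto simp: degree_mult_eq)
  next
    case False
    then have "degree (R * S) < degree (P * Q)" using that by (auto simp: degree_mult_eq)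
    then show ?thesis using that by (simp add: degree_add_eq_left degree_mult_eq)
  qed
  consider (1) "C \<noteq> 0" "degree D \<le> degree C" "E \<noteq> 0" "degree G \<le> degree E"
    | (2) "D \<noteq> 0" "degree C \<le> degree D" "G \<noteq> 0" "degree E \<le> degree G"
    | (3) "C \<noteq> 0" "G \<noteq> 0" "degree D < degree C \<or> D = 0" "degree E < degree G \<or> E = 0"
    | (4) "D \<noteq> 0" "E \<noteq> 0" "degree C < degree D \<or> C = 0" "degree G < degree E \<or> G = 0"
    using assms by (metis linorder_not_le nat_le_linear degree_0 le0)
  then show "mdeg C D + mdeg E G \<le> max (degree (C * E)) (max (degree (C * G + E * D)) (degree (D * G)))"
  proof cases
    case 1
    then show ?thesis by (simp add: mdeg_def degree_mult_eq)
  next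
    case 2
    then show ?thesis by (simp add: mdeg_def degree_mult_eq)
  next
    case 3
    then have "mdeg C D = degree C" "mdeg E G = degree G" by (auto simp: mdeg_def)
    then show ?thesis using cross[of C G D E] 3 by simp
  next
    case 4
    then have "mdeg C D = degree D" "mdeg E G = degree E" by (auto simp: mdeg_def)
    then show ?thesis using cross[of D E C G] 4 by (simp add: add.commute mult.commute)
  qed
qed

context binary_field begin

lemma poly_add_self [simp]: "p + p = (0 :: 'a poly)"
  by (rule poly_eqI) (simp only: coeff_add add_self coeff_0)

lemma poly_add_self_left [simp]: "p + (p + s) = (s :: 'a poly)"
  by (simp flip: add.assoc)

lemma poly_add_eq_0_iff_eq: "p + s = 0 \<longleftrightarrow> p = (s :: 'a poly)"
  by (metis poly_add_self_left add.right_neutral)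

lemma poly_power2_add: "(p + s :: 'a poly)\<^sup>2 = p\<^sup>2 + s\<^sup>2"
  by (simp add: power2_eq_square algebra_simps)

section \<open>The chain of points and the degrees of its coordinates\<close>

abbreviation X :: "'a poly" where "X \<equiv> [:0, 1:]"

text \<open>
  For points \<open>P, Q\<close> of the elliptic curve \<open>y\<^sup>2 + x y = x\<^sup>3 + b\<close>, where \<open>Q\<close> is the generic point with
  first coordinate \<open>X\<close>, the form below vanishes when \<open>(A : B)\<close> and \<open>(C : D)\<close> are the first
  coordinates of \<open>P\<close> and \<open>P \<plusminus> Q\<close>. Its symmetry replaces the group law: starting from two related
  points, the chain \<open>P, P + Q, P + 2 Q, \<dots>\<close> is produced by always passing to the other root.
\<close>

definition corr :: "'a \<Rightarrow> 'a poly \<Rightarrow> 'a poly \<Rightarrow> 'a poly \<Rightarrow> 'a poly \<Rightarrow> 'a poly" where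
  "corr b A B C D = (A\<^sup>2 + X\<^sup>2 * B\<^sup>2) * C\<^sup>2 + X * A * B * (C * D) + (X\<^sup>2 * A\<^sup>2 + [:b:] * B\<^sup>2) * D\<^sup>2"

lemma corr_commute: "corr b A B C D = corr b C D A B"
  unfolding corr_def by (simp add: algebra_simps del: mult_pCons_left mult_pCons_right)

text \<open>Vieta over polynomials: the known root \<open>(E : G)\<close> splits the linear factor
  \<open>G S + E T\<close> off the quadratic form in \<open>(S, T)\<close>. The cofactor
  \<open>D S + C T\<close> is again polynomial because \<open>E\<close> and \<open>G\<close> are
  comaximal, and its root is \<open>(C : D)\<close>.\<close>

lemma other_root:
  assumes "b \<noteq> 0" "comaximal A B" "comaximal E G" "corr b A B E G = 0"
  obtains C D where "comaximal C D" "corr b A B C D = 0"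
    "C * E = X\<^sup>2 * A\<^sup>2 + [:b:] * B\<^sup>2" "C * G + E * D = X * A * B" "D * G = A\<^sup>2 + X\<^sup>2 * B\<^sup>2"
proof -
  define \<alpha> \<beta> \<gamma> where "\<alpha> = A\<^sup>2 + X\<^sup>2 * B\<^sup>2" "\<beta> = X * A * B" "\<gamma> = X\<^sup>2 * A\<^sup>2 + [:b:] * B\<^sup>2"
  note defs = \<alpha>_\<beta>_\<gamma>_def
  obtain u v where "u * E + v * G = 1" using assms unfolding comaximal_def by blast
  then have "(u * E + v * G)\<^sup>2 = 1" by simp
  then have one: "u\<^sup>2 * E\<^sup>2 + v\<^sup>2 * G\<^sup>2 = 1" by (simp add: poly_power2_add power_mult_distrib)
  have root: "\<alpha> * E\<^sup>2 + \<beta> * (E * G) + \<gamma> * G\<^sup>2 = 0"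
    using assms(4) unfolding corr_def defs .
  then have root1: "\<alpha> * E\<^sup>2 = \<beta> * (E * G) + \<gamma> * G\<^sup>2"
    by (metis add.assoc poly_add_eq_0_iff_eq)
  then have root2: "\<gamma> * G\<^sup>2 = \<alpha> * E\<^sup>2 + \<beta> * (E * G)"
    by (simp add: algebra_simps)
  \<comment> \<open>Both witnesses arise by multiplying the unknown by
    \<open>u^2 E^2 + v^2 G^2 = 1\<close> and eliminating it through the three desired
    equations.\<close>
  define C where "C = u\<^sup>2 * \<gamma> * E + v\<^sup>2 * \<alpha> * E + v\<^sup>2 * \<beta> * G"
  define D where "D = u\<^sup>2 * \<beta> * E + u\<^sup>2 * \<gamma> * G + v\<^sup>2 * \<alpha> * G"
  have "D * G = u\<^sup>2 * (\<beta> * (E * G) + \<gamma> * G\<^sup>2) + v\<^sup>2 * G\<^sup>2 * \<alpha>"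
    unfolding D_def by (simp add: algebra_simps power2_eq_square)
  also have "\<dots> = (u\<^sup>2 * E\<^sup>2 + v\<^sup>2 * G\<^sup>2) * \<alpha>"
    unfolding root1[symmetric] by (simp add: algebra_simps)
  finally have DG: "D * G = \<alpha>" by (simp add: one)
  have "C * E = u\<^sup>2 * E\<^sup>2 * \<gamma> + v\<^sup>2 * (\<alpha> * E\<^sup>2 + \<beta> * (E * G))"
    unfolding C_def by (simp add: algebra_simps power2_eq_square)
  also have "\<dots> = (u\<^sup>2 * E\<^sup>2 + v\<^sup>2 * G\<^sup>2) * \<gamma>"
    unfolding root2[symmetric] by (simp add: algebra_simps)
  finally have CE: "C * E = \<gamma>" by (simp add: one)
  have "C * G + E * D = (u\<^sup>2 * E\<^sup>2 + v\<^sup>2 * G\<^sup>2) * \<beta>"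
    unfolding C_def D_def by (simp add: algebra_simps power2_eq_square)
  then have CGED: "C * G + E * D = \<beta>" by (simp add: one)
  have "corr b A B C D = \<alpha> * C\<^sup>2 + \<beta> * (C * D) + \<gamma> * D\<^sup>2"
    unfolding corr_def defs ..
  also have "\<dots> = 0"
    unfolding DG[symmetric] CE[symmetric] CGED[symmetric] by (simp add: algebra_simps power2_eq_square)
  finally have "corr b A B C D = 0" .
  moreover have "comaximal C D"
  proof -
    \<comment> \<open>The three coefficients lie in the ideal generated by \<open>C\<close> and
      \<open>D\<close>, so it suffices to obtain \<open>B^4\<close> and \<open>A^4\<close> from
      them. Inverting \<open>b\<close>, that is, nonsingularity of the curve, enters here.\<close>
    have bB: "[:b:] * B ^ 4 = \<gamma> * B\<^sup>2 + \<beta>\<^sup>2"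
      unfolding defs by (simp add: algebra_simps eval_nat_numeral del: mult_pCons_left mult_pCons_right)
    have b1: "[:inverse b:] * [:b:] = 1" using assms(1) by (simp add: one_pCons)
    have "B ^ 4 = [:inverse b:] * ([:b:] * B ^ 4)"
      by (simp only: mult.assoc[symmetric] b1 mult_1)
    also have "\<dots> = ([:inverse b:] * (E * B\<^sup>2 + \<beta> * G)) * C + ([:inverse b:] * (\<beta> * E)) * D"
      unfolding bB CE[symmetric] power2_eq_square[of \<beta>] arg_cong[OF CGED[symmetric], of "\<lambda>z. \<beta> * z"]
      by (simp add: algebra_simps del: mult_pCons_left mult_pCons_right)
    finally obtain u2 v2 where B4: "B ^ 4 = u2 * C + v2 * D" by blast
    have "A ^ 4 = \<alpha>\<^sup>2 + X ^ 4 * B ^ 4"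
      unfolding defs by (simp add: algebra_simps eval_nat_numeral del: mult_pCons_left mult_pCons_right)
    also have "\<dots> = (X ^ 4 * u2) * C + (\<alpha> * G + X ^ 4 * v2) * D"
      unfolding B4 power2_eq_square arg_cong[OF DG[symmetric], of "\<lambda>z. \<alpha> * z"]
      by (simp add: algebra_simps del: mult_pCons_left mult_pCons_right)
    finally obtain u1 v1 where A4: "A ^ 4 = u1 * C + v1 * D" by blast
    have "comaximal (A ^ 4) (B ^ 4)"
      using assms(2) by (metis comaximal_commute comaximal_power)
    then obtain s t where "s * A ^ 4 + t * B ^ 4 = 1" unfolding comaximal_def by blast
    then have "(s * u1 + t * u2) * C + (s * v1 + t * v2) * D = 1"
      unfolding A4 B4 by (simp add: algebra_simps)
    then show ?thesis unfolding comaximal_def by blast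
  qed
  ultimately show thesis using that CE CGED DG unfolding defs by blast
qed

text \<open>Of \<open>A\<close> and \<open>B\<close>, the one of larger degree contributes its
  square times \<open>X^2\<close>, which strictly dominates the sum in which it stands; hence
  nothing cancels.\<close>

lemma mdeg_quadratic:
  assumes "A \<noteq> 0 \<or> B \<noteq> 0"
  shows "max (degree (X\<^sup>2 * A\<^sup>2 + [:b:] * B\<^sup>2)) (max (degree (X * A * B)) (degree (A\<^sup>2 + X\<^sup>2 * B\<^sup>2))) =
    2 * mdeg A B + 2"
proof (rule antisym)
  have X2: "degree (X\<^sup>2 * P\<^sup>2) \<le> 2 * degree P + 2" for P
    using degree_mult_le[of "X\<^sup>2" "P\<^sup>2"] degree_power_le[of X 2] degree_power_le[of P 2] by simp
  have P2: "degree (P\<^sup>2) \<le> 2 * degree P" for P :: "'a poly"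
    using degree_power_le[of P 2] by (simp add: mult.commute)
  have b2: "degree ([:b:] * P\<^sup>2) \<le> 2 * degree P" for P
    using P2[of P] degree_smult_le[of b "P\<^sup>2"] by simp
  have "degree (X * A * B) \<le> degree A + degree B + 1"
    using degree_mult_le[of "X * A" B] degree_mult_le[of X A] by simp
  moreover have "degree (X\<^sup>2 * A\<^sup>2 + [:b:] * B\<^sup>2) \<le> 2 * mdeg A B + 2"
    using X2[of A] b2[of B] by (intro degree_add_le) (auto simp: mdeg_def)
  moreover have "degree (A\<^sup>2 + X\<^sup>2 * B\<^sup>2) \<le> 2 * mdeg A B + 2"
    using X2[of B] P2[of A] by (intro degree_add_le) (auto simp: mdeg_def)
  ultimately show "max (degree (X\<^sup>2 * A\<^sup>2 + [:b:] * B\<^sup>2)) (max (degree (X * A * B)) (degree (A\<^sup>2 + X\<^sup>2 * B\<^sup>2))) \<le>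
      2 * mdeg A B + 2"
    by (simp add: mdeg_def)
  have X2eq: "degree (X\<^sup>2 * P\<^sup>2) = 2 * degree P + 2" if "P \<noteq> 0" for P
    using that by (simp add: degree_mult_eq degree_power_eq)
  consider "A \<noteq> 0" "degree B \<le> degree A" | "B \<noteq> 0" "degree A \<le> degree B"
    using assms by (metis degree_0 le0 nat_le_linear)
  then show "2 * mdeg A B + 2 \<le>
      max (degree (X\<^sup>2 * A\<^sup>2 + [:b:] * B\<^sup>2)) (max (degree (X * A * B)) (degree (A\<^sup>2 + X\<^sup>2 * B\<^sup>2)))"
  proof cases
    case 1
    then have "degree ([:b:] * B\<^sup>2) < degree (X\<^sup>2 * A\<^sup>2)" using X2eq[of A] b2[of B] by linarith
    then have "degree (X\<^sup>2 * A\<^sup>2 + [:b:] * B\<^sup>2) = 2 * degree A + 2"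
      using X2eq[OF 1(1)] by (simp only: degree_add_eq_left)
    then show ?thesis using 1 by (simp add: mdeg_def)
  next
    case 2
    then have "degree (A\<^sup>2) < degree (X\<^sup>2 * B\<^sup>2)" using X2eq[of B] P2[of A] by linarith
    then have "degree (A\<^sup>2 + X\<^sup>2 * B\<^sup>2) = 2 * degree B + 2"
      using X2eq[OF 2(1)] by (simp only: degree_add_eq_right)
    then show ?thesis using 2 by (simp add: mdeg_def)
  qed
qed

lemma comaximal_nonzero: "comaximal A B \<Longrightarrow> A \<noteq> 0 \<or> (B :: 'a poly) \<noteq> 0"
  unfolding comaximal_def by auto

text \<open>Comparing \<open>mdeg_mult\<close> with \<open>mdeg_quadratic\<close> shows that the
  degrees along the chain have second difference 2. With starting values \<open>d\<close> and
  \<open>1 - k + d\<close> the \<open>n\<close>-th degree is therefore \<open>n^2 - k n + d\<close>,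
  and a degree is a natural number.\<close>

lemma degree_chain_nonneg:
  fixes k d :: int
  assumes b: "b \<noteq> 0" and AB: "comaximal A B" and CD: "comaximal C D" and root: "corr b A B C D = 0"
    and d: "int (mdeg A B) = d" "int (mdeg C D) = 1 - k + d"
  shows "0 \<le> int n ^ 2 - k * int n + d"
proof -
  have "\<exists>A B C D. comaximal A B \<and> comaximal C D \<and> corr b A B C D = 0 \<and>
      int (mdeg A B) = int n ^ 2 - k * int n + d \<and>
      int (mdeg C D) = int (Suc n) ^ 2 - k * int (Suc n) + d"
  proof (induction n)
    case 0
    show ?case using assms by (intro exI[of _ A] exI[of _ B] exI[of _ C] exI[of _ D]) simp
  next
    case (Suc n)
    then obtain A B C D where *: "comaximal A B" "comaximal C D" "corr b C D A B = 0"
      "int (mdeg A B) = int n ^ 2 - k * int n + d" "int (mdeg C D) = int (Suc n) ^ 2 - k * int (Suc n) + d"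
      using corr_commute by metis
    obtain C' D' where new: "comaximal C' D'" "corr b C D C' D' = 0"
      "C' * A = X\<^sup>2 * C\<^sup>2 + [:b:] * D\<^sup>2" "C' * B + A * D' = X * C * D" "D' * B = C\<^sup>2 + X\<^sup>2 * D\<^sup>2"
      using other_root[OF b *(2,1,3)] by metis
    have "mdeg C' D' + mdeg A B = 2 * mdeg C D + 2"
      using mdeg_mult[of C' D' A B] mdeg_quadratic[of C D b] comaximal_nonzero *(1,2) new(1)
      unfolding new(3-5) by simp
    then have "int (mdeg C' D') = 2 * int (mdeg C D) + 2 - int (mdeg A B)" by linarith
    also have "\<dots> = int (Suc (Suc n)) ^ 2 - k * int (Suc (Suc n)) + d"
      unfolding *(4,5) by (simp add: algebra_simps power2_eq_square)
    finally show ?case using * new by blast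
  qed
  then show ?thesis by (metis of_nat_0_le_iff)
qed

section \<open>The Frobenius point and its two neighbours\<close>

lemma poly_power2_sum: "(\<Sum>i\<in>S. f i :: 'a poly)\<^sup>2 = (\<Sum>i\<in>S. (f i)\<^sup>2)"
  by (induction S rule: infinite_finite_induct) (simp_all add: poly_power2_add)

lemma X_power_minus_1_factor:
  obtains c :: 'a where "c \<noteq> 0" "X ^ (q - 1) + 1 = [:c:] * (\<Prod>s\<in>-{0}. [:- s, 1:])"
proof -
  have "(1::nat) < 2 ^ r" using r_pos by (intro one_less_power) auto
  then have q1: "q - 1 > 0" by simp
  have "poly (X ^ (q - 1) + 1) s = 0" if "s \<in> -{0}" for s
  proof -
    have "s * s ^ (q - 1) = s" using power_card[of s] by (metis power_eq_if power_not_zero zero_neq_numeral)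
    then show ?thesis using that by simp
  qed
  then have "(\<Prod>s\<in>-{0}. [:- s, 1:]) dvd X ^ (q - 1) + 1"
    by (intro prod_linear_dvd) auto
  then obtain k where k: "X ^ (q - 1) + 1 = (\<Prod>s\<in>-{0}. [:- s, 1:]) * k" by (auto simp: dvd_def)
  have deg: "degree (X ^ (q - 1) + 1) = q - 1"
    using q1 by (subst degree_add_eq_left) (simp_all add: degree_power_eq)
  then have "k \<noteq> 0" using k q1 by auto
  then have "degree k = 0"
    using deg q1 unfolding k by (subst (asm) degree_mult_eq) (auto simp: degree_prod_linear card_nonzero simp del: uminus_eq_self)
  then obtain c where "k = [:c:]" by (metis degree_eq_zeroE)
  then show thesis using that[of c] k \<open>k \<noteq> 0\<close> by (simp only: mult.commute) auto
qed

text \<open>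
  The starting point of the chain is the Frobenius image of \<open>Q\<close>, with first coordinate \<open>X ^ q\<close>; its
  two neighbours are \<open>(L : X E\<^sup>2)\<close> with \<open>E = X ^ (q - 1) + 1\<close> and the polynomials \<open>L\<close> below, for
  \<open>e = 0\<close> and \<open>e = 1\<close>. Here \<open>U = X ^ q tr (X + b / X\<^sup>2)\<close>, where \<open>tr\<close> is the trace polynomial.
\<close>

definition U_poly :: "'a \<Rightarrow> 'a poly" where
  "U_poly b = (\<Sum>i<r. X ^ (q + 2 ^ i) + [:b ^ 2 ^ i:] * X ^ (q - 2 ^ Suc i))"

definition L_poly :: "'a \<Rightarrow> 'a \<Rightarrow> 'a poly" where
  "L_poly e b = U_poly b + X ^ (2 * q) + X ^ (q + 1) + [:e:] * X ^ q"

text \<open>This is \<open>X^(2q)\<close> times \<open>T^2 + T = (X + b/X^2)^q + X + b/X^2\<close>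
  for \<open>T = tr (X + b/X^2)\<close>: squaring shifts the summation index, so only the end terms
  \<open>h r\<close> and \<open>h 0\<close> survive, and \<open>b^q = b\<close>.\<close>

lemma U_poly_square: "(U_poly b)\<^sup>2 + X ^ q * U_poly b = X ^ (3 * q) + [:b:] + X ^ (2 * q + 1) + [:b:] * X ^ (2 * q - 2)"
proof -
  define h where "h i = X ^ (2 * q + 2 ^ i) + [:b ^ 2 ^ i:] * X ^ (2 * q - 2 ^ Suc i)" for i
  have "(X ^ (q + 2 ^ i) + [:b ^ 2 ^ i:] * X ^ (q - 2 ^ Suc i))\<^sup>2 = h (Suc i)" if "i < r" for i
    unfolding h_def poly_power2_add power_mult_distrib
    by (simp add: poly_const_pow algebra_simps diff_mult_distrib2 flip: power_mult)
  then have sq: "(U_poly b)\<^sup>2 = (\<Sum>i<r. h (Suc i))"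
    unfolding U_poly_def poly_power2_sum by (intro sum.cong) auto
  have "X ^ q * (X ^ (q + 2 ^ i) + [:b ^ 2 ^ i:] * X ^ (q - 2 ^ Suc i)) = h i" if "i < r" for i
  proof -
    have "2 ^ Suc i \<le> q" using that by (intro power_increasing) auto
    then have e: "2 * q - 2 ^ Suc i = q + (q - 2 ^ Suc i)" "2 * q + 2 ^ i = q + (q + 2 ^ i)" by simp_all
    show ?thesis unfolding h_def e power_add by (simp add: algebra_simps del: mult_pCons_left mult_pCons_right)
  qed
  then have "X ^ q * U_poly b = (\<Sum>i<r. h i)"
    unfolding U_poly_def sum_distrib_left by (intro sum.cong) auto
  then have "(U_poly b)\<^sup>2 + X ^ q * U_poly b = (\<Sum>i<r. h (Suc i)) + (\<Sum>i<r. h i)"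
    by (simp add: sq)
  also have "(\<Sum>i<r. h (Suc i)) = h 0 + (h 0 + (\<Sum>i<r. h (Suc i)))"
    by simp
  also have "h 0 + (\<Sum>i<r. h (Suc i)) = (\<Sum>i<r. h i) + h r"
    using sum.lessThan_Suc_shift[of h r] sum.lessThan_Suc[of h r] by simp
  also have "h 0 + ((\<Sum>i<r. h i) + h r) + (\<Sum>i<r. h i) = h r + h 0"
    by (simp add: ac_simps)
  also have "\<dots> = X ^ (3 * q) + [:b:] + X ^ (2 * q + 1) + [:b:] * X ^ (2 * q - 2)"
  proof -
    have "h r = X ^ (3 * q) + [:b:]" by (simp add: h_def power_card algebra_simps)
    moreover have "h 0 = X ^ (2 * q + 1) + [:b:] * X ^ (2 * q - 2)"
      unfolding h_def power_0 power_one_right power_Suc mult_1_right by (rule refl)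
    ultimately show ?thesis by (simp only: add.assoc)
  qed
  finally show ?thesis .
qed

text \<open>With \<open>y = x z\<close> the curve reads \<open>z^2 + z = x + b/x^2\<close>, so
  Frobenius sends \<open>z\<close> to \<open>z + T\<close>, where \<open>T\<close> is the trace
  polynomial at \<open>x + b/x^2\<close>. The chord through the Frobenius image and the point
  \<open>(x, x (z + e))\<close> gives the first coordinate
  \<open>X^q (X^q + X + T + e) / (X E^2)\<close>, whose numerator is \<open>L_poly\<close>. The
  identity is the \<open>corr\<close> equation for this fraction with \<open>X^2 E^2\<close>
  removed.\<close>

lemma L_poly_key:
  assumes "e = 0 \<or> e = 1"
  shows "(L_poly e b)\<^sup>2 + X ^ q * L_poly e b = (X ^ (2 * q + 2) + [:b:]) * (X ^ (q - 1) + 1)\<^sup>2"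
proof -
  have q2: "q \<ge> 2" using power_increasing[of 1 r "2::nat"] r_pos by simp
  have e: "[:e:]\<^sup>2 = [:e:]" using assms by (auto simp: poly_const_pow)
  have "(L_poly e b)\<^sup>2 + X ^ q * L_poly e b =
      ((U_poly b)\<^sup>2 + X ^ q * U_poly b) + X ^ (4 * q) + X ^ (3 * q) + X ^ (2 * q + 2) + X ^ (2 * q + 1)
      + ([:e:]\<^sup>2 + [:e:]) * X ^ (2 * q)"
  proof -
    have p: "X ^ (2 * q) = (X ^ q)\<^sup>2" "X ^ (4 * q) = (X ^ q) ^ 4" "X ^ (3 * q) = (X ^ q) ^ 3"
      "X ^ (2 * q + 2) = (X ^ q)\<^sup>2 * X\<^sup>2" "X ^ (2 * q + 1) = (X ^ q)\<^sup>2 * X" "X ^ (q + 1) = X ^ q * X"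
      by (simp_all add: power_add mult.commute power2_eq_square[of X] del: mult_pCons_left mult_pCons_right flip: power_mult)
    have gen: "(u + y\<^sup>2 + y * x + c * y)\<^sup>2 + y * (u + y\<^sup>2 + y * x + c * y) =
        (u\<^sup>2 + y * u) + y ^ 4 + y ^ 3 + y\<^sup>2 * x\<^sup>2 + y\<^sup>2 * x + (c\<^sup>2 + c) * y\<^sup>2" for u y x c :: "'a poly"
      by (simp add: algebra_simps eval_nat_numeral)
    show ?thesis unfolding L_poly_def p by (rule gen)
  qed
  also have "\<dots> = [:b:] + [:b:] * X ^ (2 * q - 2) + X ^ (4 * q) + X ^ (2 * q + 2)"
    unfolding U_poly_square e by (simp add: algebra_simps del: mult_pCons_left mult_pCons_right)
  also have "\<dots> = (X ^ (2 * q + 2) + [:b:]) * (X ^ (2 * q - 2) + 1)"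
  proof -
    have "X ^ (4 * q) = X ^ (2 * q + 2) * X ^ (2 * q - 2)"
      unfolding power_add[symmetric] using q2 by (intro arg_cong[of _ _ "\<lambda>n. X ^ n"]) simp
    then show ?thesis by (simp add: algebra_simps del: mult_pCons_left mult_pCons_right)
  qed
  also have "X ^ (2 * q - 2) + 1 = (X ^ (q - 1) + 1)\<^sup>2"
    unfolding poly_power2_add by (simp add: diff_mult_distrib2 mult.commute flip: power_mult)
  finally show ?thesis .
qed

lemma poly_U_poly:
  assumes "s \<noteq> 0"
  shows "poly (U_poly b) s = s * tr (s + b * inverse (s\<^sup>2))"
proof -
  have "poly (X ^ (q + 2 ^ i) + [:b ^ 2 ^ i:] * X ^ (q - 2 ^ Suc i)) s = s * (s + b * inverse (s\<^sup>2)) ^ 2 ^ i"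
    if "i < r" for i
  proof -
    have le: "2 ^ Suc i \<le> q" using that by (intro power_increasing) auto
    have "s ^ (q - 2 ^ Suc i) = s * inverse (s ^ 2 ^ Suc i)"
      by (simp only: power_diff[OF assms le] power_card divide_inverse)
    moreover have "s ^ 2 ^ Suc i = (s\<^sup>2) ^ 2 ^ i" by (simp flip: power_mult)
    moreover have "s ^ (q + 2 ^ i) = s * s ^ 2 ^ i" by (simp only: power_add power_card)
    ultimately show ?thesis
      by (simp add: power_add_char2 power_mult_distrib power_inverse algebra_simps)
  qed
  then show ?thesis
    unfolding U_poly_def abs_trace_def poly_sum sum_distrib_left by (intro sum.cong) auto
qed

text \<open>On the field \<open>X^q\<close> and \<open>X\<close> agree, so \<open>X^(2q)\<close> and
  \<open>X^(q+1)\<close> cancel and only the trace part remains.\<close>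

lemma poly_L_poly:
  assumes "s \<noteq> 0"
  shows "poly (L_poly e b) s = s * (tr (s + b * inverse (s\<^sup>2)) + e)"
proof -
  have "s ^ (2 * q) = s\<^sup>2" by (metis power_card power_mult mult.commute)
  moreover have "s ^ (q + 1) = s\<^sup>2" by (simp only: power_add power_card) (simp add: power2_eq_square)
  ultimately show ?thesis
    unfolding L_poly_def using poly_U_poly[OF assms, of b]
    by (simp add: power_card algebra_simps)
qed

text \<open>Only the summand \<open>i = r - 1\<close> has a constant term, since its exponent
  \<open>q - 2^(i+1)\<close> is 0. For \<open>b \<noteq> 0\<close> the value is nonzero, so
  \<open>X\<close> does not divide the numerator.\<close>

lemma poly_L_poly_0: "poly (L_poly e b) 0 = b ^ 2 ^ (r - 1)"
proof -
  have "poly (U_poly b) 0 = (\<Sum>i<r. if i = r - 1 then b ^ 2 ^ i else 0)"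
    unfolding U_poly_def poly_sum
  proof (rule sum.cong[OF refl])
    fix i assume "i \<in> {..<r}"
    then have i: "i < r" by simp
    have "q - 2 ^ Suc i = 0 \<longleftrightarrow> i = r - 1"
    proof
      assume "q - 2 ^ Suc i = 0"
      then have "r \<le> Suc i" by (simp add: power_increasing_iff del: power_Suc)
      then show "i = r - 1" using i by simp
    qed (use r_pos in simp)
    then show "poly (X ^ (q + 2 ^ i) + [:b ^ 2 ^ i:] * X ^ (q - 2 ^ Suc i)) 0 = (if i = r - 1 then b ^ 2 ^ i else 0)"
      by (simp add: power_0_left del: power_Suc)
  qed
  then show ?thesis using r_pos by (simp add: L_poly_def power_0_left)
qed

lemma degree_L_poly:
  assumes "r \<ge> 2"
  shows "degree (L_poly e b) = 2 * q"
proof -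
  have q4: "q \<ge> 4" using power_increasing[OF assms, of "2::nat"] by simp
  have "degree (X ^ (q + 2 ^ i) + [:b ^ 2 ^ i:] * X ^ (q - 2 ^ Suc i)) \<le> q + 2 ^ (r - 1)" if "i < r" for i
  proof (rule degree_add_le)
    have "(2::nat) ^ i \<le> 2 ^ (r - 1)" using that by (intro power_increasing) auto
    then show "degree (X ^ (q + 2 ^ i)) \<le> q + 2 ^ (r - 1)" by (simp add: degree_power_eq)
    show "degree ([:b ^ 2 ^ i:] * X ^ (q - 2 ^ Suc i)) \<le> q + 2 ^ (r - 1)"
      using degree_smult_le[of "b ^ 2 ^ i" "X ^ (q - 2 ^ Suc i)"] by (simp add: degree_power_eq)
  qed
  then have "degree (U_poly b) \<le> q + 2 ^ (r - 1)"
    unfolding U_poly_def by (intro degree_sum_le) auto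
  moreover have "(2::nat) ^ (r - 1) < 2 ^ r" using assms by simp
  ultimately have "degree (U_poly b) < 2 * q" by linarith
  then have "degree (U_poly b + X ^ (2 * q)) = 2 * q"
    by (subst degree_add_eq_right) (simp_all add: degree_power_eq)
  moreover have "degree (X ^ (q + 1)) < 2 * q" using q4 by (simp add: degree_power_eq)
  ultimately have "degree (U_poly b + X ^ (2 * q) + X ^ (q + 1)) = 2 * q"
    by (subst degree_add_eq_left) simp_all
  moreover have "degree ([:e:] * X ^ q) < 2 * q"
    using degree_smult_le[of e "X ^ q"] q4 by (simp add: degree_power_eq)
  ultimately show ?thesis
    unfolding L_poly_def by (subst degree_add_eq_left) simp_all
qed

text \<open>The numerator \<open>L\<close> and the denominator \<open>X E^2\<close> have exactly the
  elements of \<open>Z\<close> as common zeros, each a double zero of the denominator. Cancelling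
  the square of their product leaves a comaximal pair and lowers the degree \<open>2 q\<close> of
  the numerator by \<open>2 * card Z\<close>.\<close>

lemma frobenius_neighbour:
  assumes r: "r \<ge> 2" and b: "b \<noteq> 0" and e: "e = 0 \<or> e = 1"
  defines "Z \<equiv> {s. s \<noteq> 0 \<and> tr (s + b * inverse (s\<^sup>2)) = e}"
  obtains C D where "comaximal C D" "corr b (X ^ q) 1 C D = 0" "mdeg C D + 2 * card Z = 2 * q"
proof -
  define L where "L = L_poly e b"
  define Em where "Em = X ^ (q - 1) + 1"
  define G where "G = (\<Prod>s\<in>Z. [:- s, 1:])"
  define H' where "H' = (\<Prod>s\<in>-{0}-Z. [:- s, 1:])"
  obtain c where c: "c \<noteq> 0" "Em = [:c:] * (\<Prod>s\<in>-{0}. [:- s, 1:])"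
    using X_power_minus_1_factor unfolding Em_def by blast
  define H where "H = [:c:] * H'"
  have ZF: "Z \<subseteq> -{0}" by (auto simp: Z_def)
  have Em: "Em = G * H"
    unfolding c(2) G_def H_def H'_def
    using prod.subset_diff[OF ZF, of "\<lambda>s. [:- s, 1:]"] by (simp add: ac_simps del: mult_pCons_left mult_pCons_right)
  have key: "L\<^sup>2 + X ^ q * L = (X ^ (2 * q + 2) + [:b:]) * Em\<^sup>2"
    unfolding L_def Em_def by (rule L_poly_key[OF e])
  have L_zero: "poly L s = 0 \<longleftrightarrow> s \<in> Z" if "s \<noteq> 0" for s
    using that by (simp add: L_def poly_L_poly Z_def add_eq_0_iff_eq)
  have L0: "poly L 0 \<noteq> 0" using b by (simp add: L_def poly_L_poly_0)
  \<comment> \<open>At \<open>s\<close> in \<open>Z\<close> the polynomial \<open>L\<close>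
    vanishes, so \<open>L + X^q\<close> takes the value \<open>s\<close>, which is nonzero. In the
    factorisation \<open>L (L + X^q)\<close> the double zeros of \<open>E^2\<close> on
    \<open>Z\<close> thus all belong to \<open>L\<close>.\<close>
  have "comaximal (L + X ^ q) (G\<^sup>2)"
    unfolding G_def
  proof (intro comaximal_power comaximal_prod comaximal_linear)
    fix s assume "s \<in> Z"
    then show "poly (L + X ^ q) s \<noteq> 0" using L_zero[of s] by (simp add: Z_def)
  qed simp
  moreover have "G\<^sup>2 dvd (L + X ^ q) * L"
  proof -
    have "(L + X ^ q) * L = (X ^ (2 * q + 2) + [:b:]) * Em\<^sup>2"
      unfolding key[symmetric] by (simp add: power2_eq_square distrib_right)
    then show ?thesis unfolding Em power_mult_distrib by (simp only:) (intro dvd_mult dvd_triv_left)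
  qed
  ultimately have "G\<^sup>2 dvd L" using comaximal_commute comaximal_dvd_mult by blast
  then obtain C where C: "L = G\<^sup>2 * C" by (auto simp: dvd_def)
  define D where "D = X * H\<^sup>2"
  have G0: "G \<noteq> 0" by (simp add: G_def)
  have "corr b (X ^ q) 1 L (X * Em\<^sup>2) = X\<^sup>2 * Em\<^sup>2 * (L\<^sup>2 + X ^ q * L + (X ^ (2 * q + 2) + [:b:]) * Em\<^sup>2)"
  proof -
    have Xq: "X ^ q = X * X ^ (q - 1)" by (metis power_eq_if power_not_zero zero_neq_numeral)
    have n1: "(X ^ q)\<^sup>2 + X\<^sup>2 = X\<^sup>2 * Em\<^sup>2"
      unfolding Em_def Xq poly_power2_add by (simp only: distrib_left power_mult_distrib power_one mult_1_right)
    have n2: "X ^ (2 * q + 2) = X\<^sup>2 * (X ^ q)\<^sup>2"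
      by (simp add: power_add mult.commute power2_eq_square[of X] del: mult_pCons_left mult_pCons_right flip: power_mult)
    have gen: "(x2 + y2) * l\<^sup>2 + z * y * (l * (z * m)) + (z\<^sup>2 * y\<^sup>2 + w) * (z * m)\<^sup>2 =
        z\<^sup>2 * m * (l\<^sup>2 + y * l + (z\<^sup>2 * y\<^sup>2 + w) * m)" if "x2 + y2 = z\<^sup>2 * m" for x2 y2 l z y m w :: "'a poly"
      unfolding that by (simp add: algebra_simps power2_eq_square)
    show ?thesis unfolding corr_def n2 power_one mult_1_right by (rule gen[OF n1])
  qed
  also have "\<dots> = 0" unfolding key by simp
  finally have "corr b (X ^ q) 1 L (X * Em\<^sup>2) = 0" .
  moreover have "corr b (X ^ q) 1 L (X * Em\<^sup>2) = G ^ 4 * corr b (X ^ q) 1 C D"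
  proof -
    have "X * Em\<^sup>2 = G\<^sup>2 * D" unfolding Em D_def by (simp only: power_mult_distrib ac_simps)
    moreover have "corr b A B (g * c) (g * d) = g\<^sup>2 * corr b A B c d" for A B g c d
      unfolding corr_def by (simp add: algebra_simps power2_eq_square del: mult_pCons_left mult_pCons_right)
    ultimately show ?thesis unfolding C by (simp flip: power_mult)
  qed
  ultimately have corr0: "corr b (X ^ q) 1 C D = 0" using G0 by simp
  have CL: "poly C s \<noteq> 0" if "poly L s \<noteq> 0" for s using that by (auto simp: C)
  have "comaximal C D"
    unfolding D_def
  proof (intro comaximal_mult_right comaximal_power)
    show "comaximal C X" using comaximal_linear[OF CL[OF L0]] by simp
    show "comaximal C H"
      unfolding H_def
    proof (rule comaximal_mult_right)
      have "[:inverse c:] * [:c:] = 1" using c(1) by (simp add: one_pCons)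
      then show "comaximal C [:c:]" unfolding comaximal_def
        by (intro exI[of _ 0] exI[of _ "[:inverse c:]"]) simp
      show "comaximal C H'" unfolding H'_def
      proof (intro comaximal_prod comaximal_linear CL)
        show "poly L s \<noteq> 0" if "s \<in> -{0} - Z" for s using that L_zero[of s] by simp
      qed simp
    qed
  qed
  moreover have "mdeg C D + 2 * card Z = 2 * q"
  proof -
    have degG: "degree G = card Z" unfolding G_def by (rule degree_prod_linear) simp
    have L2: "degree L = 2 * q" unfolding L_def by (rule degree_L_poly[OF r])
    then have "L \<noteq> 0" using r_pos by auto
    then have "C \<noteq> 0" using C by auto
    then have "2 * card Z + degree C = 2 * q"
      using L2 G0 unfolding C by (simp add: degree_mult_eq degree_power_eq degG)
    moreover have "2 * card Z + degree D = 2 * q - 1"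
    proof -
      have Hn: "H \<noteq> 0" using c(1) by (simp add: H_def H'_def)
      have cz: "card (-{0} - Z) = q - 1 - card Z"
        using card_Diff_subset[OF _ ZF] by (simp add: card_nonzero)
      have "card Z \<le> q - 1" using card_mono[OF _ ZF] by (simp add: card_nonzero)
      moreover have "degree H = q - 1 - card Z"
        using c(1) degree_prod_linear[of "-{0} - Z"] by (simp add: H_def H'_def cz)
      moreover have "degree D = 1 + 2 * degree H"
        using Hn unfolding D_def by (subst degree_mult_eq) (auto simp: degree_power_eq)
      moreover have "1 \<le> q" by (rule one_le_power) simp
      ultimately show ?thesis by linarith
    qed
    ultimately show ?thesis by (simp add: mdeg_def)
  qed
  ultimately show thesis using that corr0 by blast
qed

text \<open>The curve is taken with \<open>b = a^2\<close> because \<open>a^2/s^2\<close> and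
  \<open>a/s\<close> have the same trace. Then \<open>e = 0\<close> gives
  \<open>card Z = (q - 1 + K a)/2\<close> and \<open>e = 1\<close> gives
  \<open>(q - 1 - K a)/2\<close>, so the neighbour has degree
  \<open>2 q - 2 * card Z = 1 - k + q\<close>. Both signs are available, one for each
  neighbour.\<close>

lemma kloosterman_quadratic_nonneg:
  assumes r: "r \<ge> 2" and a: "a \<noteq> 0" and k: "k = K a \<or> k = - K a"
  shows "0 \<le> int n ^ 2 - k * int n + int q"
proof -
  have arg: "tr (s + a\<^sup>2 * inverse (s\<^sup>2)) = tr (s + a * inverse s)" for s
    using tr_square[of "a * inverse s"] by (simp add: tr_add power_mult_distrib power_inverse)
  obtain e :: 'a where e: "e = 0 \<or> e = 1"
    and card: "2 * int (card {s. s \<noteq> 0 \<and> tr (s + a\<^sup>2 * inverse (s\<^sup>2)) = e}) = int q - 1 + k"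
  proof -
    have count: "2 * int (card {s. s \<noteq> 0 \<and> P s}) = (\<Sum>s\<in>-{0::'a}. if P s then 2 else 0)" for P
      by (simp add: sum.If_cases Int_def)
    have sum1: "(\<Sum>s\<in>-{0::'a}. 1) = int q - 1" by (simp add: card_nonzero of_nat_diff)
    show thesis
    proof (cases "k = K a")
      case True
      have "2 * int (card {s. s \<noteq> 0 \<and> tr (s + a\<^sup>2 * inverse (s\<^sup>2)) = 0}) =
          (\<Sum>s\<in>-{0}. 1 + \<psi> (s + a * inverse s))"
        unfolding arg count by (intro sum.cong) (auto simp: add_char_def)
      also have "\<dots> = int q - 1 + k"
        unfolding sum.distrib sum1 by (simp add: True kloosterman_def)
      finally show thesis using that[of 0] by simp
    next
      case False
      then have k': "k = - K a" using k by simp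
      have "2 * int (card {s. s \<noteq> 0 \<and> tr (s + a\<^sup>2 * inverse (s\<^sup>2)) = 1}) =
          (\<Sum>s\<in>-{0}. 1 - \<psi> (s + a * inverse s))"
        unfolding arg count
      proof (rule sum.cong[OF refl])
        fix s
        show "(if tr (s + a * inverse s) = 1 then 2 else 0) = 1 - \<psi> (s + a * inverse s)"
          using tr_cases[of "s + a * inverse s"] by (auto simp: add_char_def)
      qed
      also have "\<dots> = int q - 1 + k"
        unfolding sum_subtractf sum1 by (simp add: k' kloosterman_def)
      finally show thesis using that[of 1] by simp
    qed
  qed
  have a2: "a\<^sup>2 \<noteq> 0" using a by simp
  obtain C D where CD: "comaximal C D" "corr (a\<^sup>2) (X ^ q) 1 C D = 0"
    "mdeg C D + 2 * card {s. s \<noteq> 0 \<and> tr (s + a\<^sup>2 * inverse (s\<^sup>2)) = e} = 2 * q"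
    by (rule frobenius_neighbour[OF r a2 e])
  have "int (mdeg C D) = 1 - k + int q" using CD(3) card by linarith
  moreover have "int (mdeg (X ^ q) 1) = int q"
    by (simp add: mdeg_def degree_power_eq)
  ultimately show ?thesis using degree_chain_nonneg[OF a2 comaximal_1 CD(1,2)] by blast
qed

text \<open>Since \<open>K a\<close> is odd, \<open>\<bar>K a\<bar> = 2 n + 1\<close>, and this
  \<open>n\<close> is an integer nearest to the minimum of the quadratic. There nonnegativity says
  \<open>n (n + 1) \<le> q\<close>. Equality would make an odd one of \<open>n\<close>,
  \<open>n + 1\<close> divide a power of 2, forcing \<open>q \<le> 2\<close>; so
  \<open>K^2 = 4 n (n + 1) + 1 < 4 q\<close>.\<close>

lemma kloosterman_square_less:
  assumes r: "r \<ge> 2" and a: "a \<noteq> 0"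
  shows "(K a)\<^sup>2 < 4 * int q"
proof -
  have "odd (K a)"
  proof -
    have "4 dvd K a - (-1)" using kloosterman_cong_4[OF assms] by (simp add: cong_iff_dvd_diff)
    then show ?thesis by presburger
  qed
  then obtain m where m: "\<bar>K a\<bar> = 2 * m + 1" by (metis dvd_abs_iff oddE)
  then have "m \<ge> 0" by linarith
  then obtain n :: nat where n: "\<bar>K a\<bar> = 2 * int n + 1" using m by (metis nonneg_int_cases)
  have "0 \<le> int n ^ 2 - \<bar>K a\<bar> * int n + int q"
    by (rule kloosterman_quadratic_nonneg[OF assms]) linarith
  then have le: "int (n * (n + 1)) \<le> int q" unfolding n by (simp add: algebra_simps power2_eq_square)
  have "n * (n + 1) \<noteq> q"
  proof
    assume eq: "n * (n + 1) = q"
    have pow: "m = 1" if "odd m" "m dvd q" for m :: nat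
    proof -
      have "coprime m (2 ^ r)" using that by simp
      then show ?thesis using that by (metis coprime_common_divisor_nat dvd_refl nat_dvd_1_iff_1)
    qed
    have "n = 1 \<or> n + 1 = 1"
    proof (cases "odd n")
      case True
      then show ?thesis using pow[of n] eq by (metis dvd_triv_left)
    next
      case False
      then show ?thesis using pow[of "n + 1"] eq by (metis dvd_triv_right even_plus_one_iff)
    qed
    then have "q \<le> 2" using eq by auto
    moreover have "(2::nat) ^ 2 \<le> 2 ^ r" using r by (rule power_increasing) simp
    ultimately show False by simp
  qed
  with le have "int (n * (n + 1)) < int q" by linarith
  moreover have "(K a)\<^sup>2 = 4 * int (n * (n + 1)) + 1"
  proof -
    have "(K a)\<^sup>2 = \<bar>K a\<bar>\<^sup>2" by simp
    also have "\<dots> = 4 * int (n * (n + 1)) + 1" unfolding n by (simp add: algebra_simps power2_eq_square)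
    finally show ?thesis .
  qed
  ultimately show ?thesis by linarith
qed

lemma kloosterman_abs_less:
  assumes "r \<ge> 2" "a \<noteq> 0"
  shows "\<bar>real_of_int (K a)\<bar> < 2 * sqrt (real q)"
proof -
  have "real_of_int ((K a)\<^sup>2) < real_of_int (4 * int q)"
    using kloosterman_square_less[OF assms] by (simp only: of_int_less_iff)
  then have "\<bar>real_of_int (K a)\<bar>\<^sup>2 < (2 * sqrt (real q))\<^sup>2"
    by (simp add: power_mult_distrib)
  then show ?thesis by (rule power2_less_imp_less) simp
qed

section \<open>Recursions and weight formulas\<close>

lemma sum_kloosterman_square_arg: "(\<Sum>a\<in>-{0}. K (a\<^sup>2) ^ l) = MK TYPE('a) r l"
  unfolding MK_def
proof (rule sum.reindex_bij_betw)
  show "bij_betw (\<lambda>a::'a. a\<^sup>2) (-{0}) (-{0})"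
  proof (rule bij_betw_imageI)
    show "inj_on (\<lambda>a::'a. a\<^sup>2) (-{0})" using inj_square by (rule inj_on_subset) simp
    show "(\<lambda>a::'a. a\<^sup>2) ` (-{0}) = -{0}"
    proof (intro equalityI subsetI)
      fix x :: 'a assume "x \<in> -{0}"
      moreover obtain y where "y\<^sup>2 = x" using ex_sqrt by blast
      ultimately show "x \<in> (\<lambda>a. a\<^sup>2) ` (-{0})" by force
    qed auto
  qed
qed

lemma recursion_SO_plus_2:
  fixes N :: nat
  defines "N \<equiv> card (SO_plus :: ('a ^ (1 + 1) ^ (1 + 1)) set)"
  assumes "h \<ge> 1"
  shows "MK TYPE('a) r h =
    (\<Sum>l=0..<h. (-1) ^ (h + l + 1) * int (h choose l) * (int q - 1) ^ (h - l) * MK TYPE('a) r l) +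
    int q * (\<Sum>j=0..min N h. (-1) ^ (h + j) * int (card (zero_sum_sets (SO_plus :: ('a ^ (1 + 1) ^ (1 + 1)) set) trace j)) *
      (\<Sum>t=j..h. fact t * int (Stirling h t) * 2 ^ (h - t) * binom (int N - int j) (int N - int t)))"
proof -
  \<comment> \<open>The argument \<open>a^2\<close> does no harm to the moments, because squaring
    permutes the nonzero elements.\<close>
  have "int (card (SO_plus :: ('a ^ (1 + 1) ^ (1 + 1)) set)) - (\<Sum>g\<in>SO_plus. \<psi> (a * trace (g :: 'a^(1+1)^(1+1)))) =
      1 * (int q - 1 - K (a\<^sup>2))" if "a \<noteq> 0" for a
    using that by (simp add: sum_char_SO_plus_2 card_SO_plus_2 of_nat_diff)
  from moment_recursion[OF _ assms(2) this] show ?thesis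
    unfolding N_def sum_kloosterman_square_arg by simp
qed

lemma recursion_O_plus_2:
  fixes N :: nat
  defines "N \<equiv> card (O_plus :: ('a ^ (1 + 1) ^ (1 + 1)) set)"
  assumes "h \<ge> 1"
  shows "MK TYPE('a) r h =
    (\<Sum>l=0..<h. (-1) ^ (h + l + 1) * int (h choose l) * (int q - 1) ^ (h - l) * MK TYPE('a) r l) +
    int q * (\<Sum>j=0..min N h. (-1) ^ (h + j) * int (card (zero_sum_sets (O_plus :: ('a ^ (1 + 1) ^ (1 + 1)) set) trace j)) *
      (\<Sum>t=j..h. fact t * int (Stirling h t) * 2 ^ (h - t) * binom (int N - int j) (int N - int t)))"
proof -
  have "int (card (O_plus :: ('a ^ (1 + 1) ^ (1 + 1)) set)) - (\<Sum>g\<in>O_plus. \<psi> (a * trace (g :: 'a^(1+1)^(1+1)))) =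
      1 * (int q - 1 - K (a\<^sup>2))" if "a \<noteq> 0" for a
    using that by (simp add: sum_char_O_plus_2 card_O_plus_2 of_nat_diff)
  from moment_recursion[OF _ assms(2) this] show ?thesis
    unfolding N_def sum_kloosterman_square_arg by simp
qed

text \<open>Dividing by \<open>c^h = q^(2h)\<close> produces the exponent \<open>1 - 2h\<close>,
  negative for \<open>h \<ge> 1\<close>, which is why the recursions in dimension 4 are stated over
  the reals.\<close>

lemma divide_by_power:
  assumes "(int q ^ 2) ^ h * A = (int q ^ 2) ^ h * B + int q * Y"
  shows "real_of_int A = real_of_int B + real q powi (1 - 2 * int h) * real_of_int Y"
proof -
  have "real q powi (1 - 2 * int h) = real q powi 1 / real q powi (int (2 * h))"
    by (subst power_int_diff[symmetric]) simp_all
  then have pow: "real q powi (1 - 2 * int h) = real q / (real q ^ 2) ^ h"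
    by (simp only: power_int_1_right power_int_of_nat power_mult)
  have "(real q ^ 2) ^ h * real_of_int A = (real q ^ 2) ^ h * real_of_int B + real q * real_of_int Y"
    using arg_cong[OF assms, of real_of_int] by simp
  then show ?thesis unfolding pow by (simp add: field_simps)
qed

lemma recursion_SO_plus_4:
  fixes N :: nat
  defines "N \<equiv> card (SO_plus :: ('a ^ (2 + 2) ^ (2 + 2)) set)"
  assumes "h \<ge> 1"
  shows "real_of_int (MK2 TYPE('a) r h) =
    real_of_int (\<Sum>l=0..<h. (-1) ^ (h + l + 1) * int (h choose l) * (int q ^ 4 - int q ^ 3 - 2 * int q ^ 2 + 1) ^ (h - l) * MK2 TYPE('a) r l) +
    real q powi (1 - 2 * int h) * real_of_int (\<Sum>j=0..min N h. (-1) ^ (h + j) * int (card (zero_sum_sets (SO_plus :: ('a ^ (2 + 2) ^ (2 + 2)) set) trace j)) *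
      (\<Sum>t=j..h. fact t * int (Stirling h t) * 2 ^ (h - t) * binom (int N - int j) (int N - int t)))" (is ?thesis1)
    and "real_of_int (MK TYPE('a) r (2 * h)) =
    real_of_int (\<Sum>l=0..<h. (-1) ^ (h + l + 1) * int (h choose l) * (int q ^ 4 - int q ^ 3 - 2 * int q ^ 2 + int q + 1) ^ (h - l) * MK TYPE('a) r (2 * l)) +
    real q powi (1 - 2 * int h) * real_of_int (\<Sum>j=0..min N h. (-1) ^ (h + j) * int (card (zero_sum_sets (SO_plus :: ('a ^ (2 + 2) ^ (2 + 2)) set) trace j)) *
      (\<Sum>t=j..h. fact t * int (Stirling h t) * 2 ^ (h - t) * binom (int N - int j) (int N - int t)))" (is ?thesis2)
proof -
  have w: "int N - (\<Sum>g\<in>SO_plus. \<psi> (a * trace (g :: 'a^(2+2)^(2+2)))) =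
      int q ^ 2 * (int q ^ 4 - int q ^ 3 - 2 * int q ^ 2 + 1 - K2 a)" if "a \<noteq> 0" for a
    unfolding N_def card_SO_plus_4 sum_char_SO_plus_4[OF that]
    by (simp add: algebra_simps eval_nat_numeral)
  have w': "int N - (\<Sum>g\<in>SO_plus. \<psi> (a * trace (g :: 'a^(2+2)^(2+2)))) =
      int q ^ 2 * (int q ^ 4 - int q ^ 3 - 2 * int q ^ 2 + int q + 1 - (K a)\<^sup>2)" if "a \<noteq> 0" for a
    unfolding w[OF that] kloosterman_square[OF that] by simp
  have fin: "finite (SO_plus :: ('a^(2+2)^(2+2)) set)" by simp
  note rec = moment_recursion[OF fin assms(2), folded N_def]
  show ?thesis1
    unfolding MK2_def by (rule divide_by_power, rule rec, rule w)
  have sq: "MK TYPE('a) r (2 * l) = (\<Sum>a\<in>-{0}. ((K a)\<^sup>2) ^ l)" for l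
    by (simp add: MK_def power_mult)
  show ?thesis2
    unfolding sq by (rule divide_by_power, rule rec, rule w')
qed

text \<open>The two groups in dimension 2 differ only in the number \<open>n\<close> of elements of
  trace 0. The fibre over a nonzero \<open>b\<close> has 2 elements or none according to the trace
  of \<open>1/b\<close>, so only the elements of \<open>T\<close> remain.\<close>

lemma card_zero_sum_sets_dim_2:
  fixes f :: "'b \<Rightarrow> 'a"
  assumes fin: "finite G" and count: "\<And>b. int (card {g\<in>G. f g = b}) = (if b = 0 then n else 1 + \<psi> (inverse b))"
    and T: "T = {\<beta>. \<beta> \<noteq> 0 \<and> tr (inverse \<beta>) = 0}"
  shows "int (card (zero_sum_sets G f j)) =
    (\<Sum>\<nu> | \<nu> \<in> insert 0 T \<rightarrow>\<^sub>E UNIV \<and> \<nu> 0 + (\<Sum>\<beta>\<in>T. \<nu> \<beta>) = j \<and> (\<Sum>\<beta>\<in>T. of_nat (\<nu> \<beta>) * \<beta>) = 0.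
       binom n (int (\<nu> 0)) * (\<Prod>\<beta>\<in>T. binom 2 (int (\<nu> \<beta>))))"
proof -
  have img: "f ` G \<subseteq> insert 0 T"
  proof
    fix b assume "b \<in> f ` G"
    then have "card {g\<in>G. f g = b} \<noteq> 0" using fin by (auto simp: card_eq_0_iff)
    then show "b \<in> insert 0 T" using count[of b] by (auto simp: T add_char_def split: if_splits)
  qed
  have 0: "0 \<notin> T" "finite T" by (auto simp: T)
  have two: "int (card {g\<in>G. f g = b}) = 2" if "b \<in> T" for b
    using that unfolding count by (simp add: T add_char_def)
  have "int (card (zero_sum_sets G f j)) =
      (\<Sum>\<nu> | \<nu> \<in> insert 0 T \<rightarrow>\<^sub>E UNIV \<and> (\<Sum>\<beta>\<in>insert 0 T. \<nu> \<beta>) = j \<and> (\<Sum>\<beta>\<in>insert 0 T. of_nat (\<nu> \<beta>) * \<beta>) = 0.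
         \<Prod>\<beta>\<in>insert 0 T. binom (int (card {g\<in>G. f g = \<beta>})) (int (\<nu> \<beta>)))"
    using fin 0 img by (subst card_zero_sum_sets[of G "insert 0 T"]) (simp_all only: finite_insert of_nat_sum of_nat_prod binom_of_nat)
  also have "\<dots> = (\<Sum>\<nu> | \<nu> \<in> insert 0 T \<rightarrow>\<^sub>E UNIV \<and> \<nu> 0 + (\<Sum>\<beta>\<in>T. \<nu> \<beta>) = j \<and> (\<Sum>\<beta>\<in>T. of_nat (\<nu> \<beta>) * \<beta>) = 0.
       binom n (int (\<nu> 0)) * (\<Prod>\<beta>\<in>T. binom 2 (int (\<nu> \<beta>))))"
  proof (rule sum.cong)
    fix \<nu> :: "'a \<Rightarrow> nat"
    have "(\<Prod>\<beta>\<in>T. binom (int (card {g\<in>G. f g = \<beta>})) (int (\<nu> \<beta>))) = (\<Prod>\<beta>\<in>T. binom 2 (int (\<nu> \<beta>)))"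
      by (intro prod.cong refl) (simp only: two)
    then show "(\<Prod>\<beta>\<in>insert 0 T. binom (int (card {g\<in>G. f g = \<beta>})) (int (\<nu> \<beta>))) =
        binom n (int (\<nu> 0)) * (\<Prod>\<beta>\<in>T. binom 2 (int (\<nu> \<beta>)))"
      using 0 count[of 0] by simp
  qed (use 0 in simp)
  finally show ?thesis .
qed

text \<open>The fibre over a nonzero \<open>\<beta>\<close> depends on \<open>K (1/\<beta>)\<close>
  alone, so the product is regrouped by this value. The Weil bound and the congruence modulo 4
  ensure that the range of \<open>t\<close> contains every value; a \<open>t\<close> that is not
  attained contributes an empty product.\<close>

lemma card_zero_sum_sets_dim_4:
  fixes m :: "int \<Rightarrow> int"
  assumes r: "r \<ge> 2" and m0: "m0 = int q ^ 3 * (2 * int q ^ 2 - int q - 2)"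
    and m: "\<And>t. m t = int q ^ 2 * (int q ^ 3 - int q ^ 2 - 2 * int q + t)"
  shows "int (card (zero_sum_sets (SO_plus :: ('a ^ (2 + 2) ^ (2 + 2)) set) trace j)) =
    (\<Sum>\<nu> | (\<Sum>\<beta>\<in>(UNIV :: 'a set). \<nu> \<beta>) = j \<and> (\<Sum>\<beta>\<in>(UNIV :: 'a set). of_nat (\<nu> \<beta>) * \<beta>) = 0.
       binom m0 (int (\<nu> 0)) *
       (\<Prod>t | \<bar>real_of_int t\<bar> < 2 * sqrt (real q) \<and> [t = -1] (mod 4).
          \<Prod>\<beta> | \<beta> \<noteq> 0 \<and> K (inverse \<beta>) = t. binom (m t) (int (\<nu> \<beta>))))"
proof -
  let ?n = "\<lambda>\<beta>::'a. int (card {g\<in>SO_plus. trace (g :: 'a ^ (2 + 2) ^ (2 + 2)) = \<beta>})"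
  let ?T = "{t. \<bar>real_of_int t\<bar> < 2 * sqrt (real q) \<and> [t = -1] (mod 4)}"
  have "?T \<subseteq> {- \<lceil>2 * sqrt (real q)\<rceil> .. \<lceil>2 * sqrt (real q)\<rceil>}"
    by (auto simp: abs_less_iff) linarith+
  then have finT: "finite ?T" by (rule finite_subset) simp
  have img: "(\<lambda>\<beta>. K (inverse \<beta>)) ` (-{0}) \<subseteq> ?T"
    using kloosterman_abs_less[OF r] kloosterman_cong_4[OF r] by auto
  have "int (card (zero_sum_sets (SO_plus :: ('a ^ (2 + 2) ^ (2 + 2)) set) trace j)) =
      (\<Sum>\<nu> | \<nu> \<in> UNIV \<rightarrow>\<^sub>E UNIV \<and> (\<Sum>\<beta>\<in>(UNIV :: 'a set). \<nu> \<beta>) = j \<and> (\<Sum>\<beta>\<in>(UNIV :: 'a set). of_nat (\<nu> \<beta>) * \<beta>) = 0.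
         \<Prod>\<beta>\<in>UNIV. binom (?n \<beta>) (int (\<nu> \<beta>)))"
    by (subst card_zero_sum_sets[of _ UNIV]) (simp_all only: finite subset_UNIV of_nat_sum of_nat_prod binom_of_nat)
  also have "\<dots> = (\<Sum>\<nu> | (\<Sum>\<beta>\<in>(UNIV :: 'a set). \<nu> \<beta>) = j \<and> (\<Sum>\<beta>\<in>(UNIV :: 'a set). of_nat (\<nu> \<beta>) * \<beta>) = 0.
       binom m0 (int (\<nu> 0)) * (\<Prod>t\<in>?T. \<Prod>\<beta> | \<beta> \<noteq> 0 \<and> K (inverse \<beta>) = t. binom (m t) (int (\<nu> \<beta>))))"
  proof (rule sum.cong)
    fix \<nu> :: "'a \<Rightarrow> nat"
    have "(\<Prod>\<beta>\<in>UNIV. binom (?n \<beta>) (int (\<nu> \<beta>))) =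
        binom (?n 0) (int (\<nu> 0)) * (\<Prod>\<beta>\<in>UNIV - {0}. binom (?n \<beta>) (int (\<nu> \<beta>)))"
      by (rule prod.remove) simp_all
    also have "?n 0 = m0" unfolding m0 by (rule card_SO_plus_4_trace_0)
    also have "(\<Prod>\<beta>\<in>UNIV - {0}. binom (?n \<beta>) (int (\<nu> \<beta>))) =
        (\<Prod>\<beta>\<in>-{0}. binom (m (K (inverse \<beta>))) (int (\<nu> \<beta>)))"
      by (intro prod.cong) (auto simp: card_SO_plus_4_trace m)
    also have "\<dots> = (\<Prod>t\<in>?T. \<Prod>\<beta>\<in>{\<beta>\<in>-{0}. K (inverse \<beta>) = t}. binom (m (K (inverse \<beta>))) (int (\<nu> \<beta>)))"
      by (rule prod.group[symmetric, OF _ finT img]) simp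
    also have "\<dots> = (\<Prod>t\<in>?T. \<Prod>\<beta> | \<beta> \<noteq> 0 \<and> K (inverse \<beta>) = t. binom (m t) (int (\<nu> \<beta>)))"
      by (intro prod.cong) auto
    finally show "(\<Prod>\<beta>\<in>UNIV. binom (?n \<beta>) (int (\<nu> \<beta>))) =
        binom m0 (int (\<nu> 0)) * (\<Prod>t\<in>?T. \<Prod>\<beta> | \<beta> \<noteq> 0 \<and> K (inverse \<beta>) = t. binom (m t) (int (\<nu> \<beta>)))" .
  qed simp
  finally show ?thesis .
qed

end

theorem theorem1:
  fixes q r N1 N2 N3 :: nat
    and gs1 gs2 :: "('a::{field,finite} ^ (1 + 1) ^ (1 + 1)) list"
    and gs3 :: "('a ^ (2 + 2) ^ (2 + 2)) list"
    and C1 C2 C3 :: "nat \<Rightarrow> nat"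
    and T :: "'a set"
    and m0 :: int and m :: "int \<Rightarrow> int"
  assumes "q = 2 ^ r" and "CARD('a) = q"
    and "distinct gs1" and "set gs1 = SO_plus"
    and "distinct gs2" and "set gs2 = O_plus"
    and "distinct gs3" and "set gs3 = SO_plus"
    and "N1 = card (SO_plus :: ('a ^ (1 + 1) ^ (1 + 1)) set)"
    and "N2 = card (O_plus :: ('a ^ (1 + 1) ^ (1 + 1)) set)"
    and "N3 = card (SO_plus :: ('a ^ (2 + 2) ^ (2 + 2)) set)"
    and "C1 = weight_distribution (trace_code gs1)"
    and "C2 = weight_distribution (trace_code gs2)"
    and "C3 = weight_distribution (trace_code gs3)"
    and "T = {\<beta>. \<beta> \<noteq> 0 \<and> abs_trace r (inverse \<beta>) = 0}"
    and "m0 = int q ^ 3 * (2 * int q ^ 2 - int q - 2)"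
    and "\<And>t. m t = int q ^ 2 * (int q ^ 3 - int q ^ 2 - 2 * int q + t)"
  shows
    "N1 = q - 1 \<and> N2 = 2 * (q - 1) \<and> N3 = q ^ 2 * (q ^ 2 - 1) ^ 2 \<and>
     (3 \<le> r \<longrightarrow>
        (\<forall>h\<ge>1. MK TYPE('a) r h =
           (\<Sum>l=0..<h. (-1) ^ (h + l + 1) * int (h choose l) * (int q - 1) ^ (h - l) * MK TYPE('a) r l)
           + int q * (\<Sum>j=0..min N1 h. (-1) ^ (h + j) * int (C1 j) *
               (\<Sum>t=j..h. fact t * int (Stirling h t) * 2 ^ (h - t) * binom (int N1 - int j) (int N1 - int t)))) \<and>
        (\<forall>j\<le>N1. int (C1 j) =
           (\<Sum>\<nu> | \<nu> \<in> insert 0 T \<rightarrow>\<^sub>E UNIV \<and> \<nu> 0 + (\<Sum>\<beta>\<in>T. \<nu> \<beta>) = j \<and> (\<Sum>\<beta>\<in>T. of_nat (\<nu> \<beta>) * \<beta>) = 0.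
              binom 1 (int (\<nu> 0)) * (\<Prod>\<beta>\<in>T. binom 2 (int (\<nu> \<beta>)))))) \<and>
     (3 \<le> r \<longrightarrow>
        (\<forall>h\<ge>1. MK TYPE('a) r h =
           (\<Sum>l=0..<h. (-1) ^ (h + l + 1) * int (h choose l) * (int q - 1) ^ (h - l) * MK TYPE('a) r l)
           + int q * (\<Sum>j=0..min N2 h. (-1) ^ (h + j) * int (C2 j) *
               (\<Sum>t=j..h. fact t * int (Stirling h t) * 2 ^ (h - t) * binom (int N2 - int j) (int N2 - int t)))) \<and>
        (\<forall>j\<le>N2. int (C2 j) =
           (\<Sum>\<nu> | \<nu> \<in> insert 0 T \<rightarrow>\<^sub>E UNIV \<and> \<nu> 0 + (\<Sum>\<beta>\<in>T. \<nu> \<beta>) = j \<and> (\<Sum>\<beta>\<in>T. of_nat (\<nu> \<beta>) * \<beta>) = 0.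
              binom (int q) (int (\<nu> 0)) * (\<Prod>\<beta>\<in>T. binom 2 (int (\<nu> \<beta>)))))) \<and>
     (2 \<le> r \<longrightarrow>
        (\<forall>h\<ge>1. real_of_int (MK2 TYPE('a) r h) =
           real_of_int (\<Sum>l=0..<h. (-1) ^ (h + l + 1) * int (h choose l) * (int q ^ 4 - int q ^ 3 - 2 * int q ^ 2 + 1) ^ (h - l) * MK2 TYPE('a) r l)
           + real q powi (1 - 2 * int h) * real_of_int (\<Sum>j=0..min N3 h. (-1) ^ (h + j) * int (C3 j) *
               (\<Sum>t=j..h. fact t * int (Stirling h t) * 2 ^ (h - t) * binom (int N3 - int j) (int N3 - int t)))) \<and>
        (\<forall>h\<ge>1. real_of_int (MK TYPE('a) r (2 * h)) =
           real_of_int (\<Sum>l=0..<h. (-1) ^ (h + l + 1) * int (h choose l) * (int q ^ 4 - int q ^ 3 - 2 * int q ^ 2 + int q + 1) ^ (h - l) * MK TYPE('a) r (2 * l))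
           + real q powi (1 - 2 * int h) * real_of_int (\<Sum>j=0..min N3 h. (-1) ^ (h + j) * int (C3 j) *
               (\<Sum>t=j..h. fact t * int (Stirling h t) * 2 ^ (h - t) * binom (int N3 - int j) (int N3 - int t)))) \<and>
        (\<forall>j\<le>N3. int (C3 j) =
           (\<Sum>\<nu> | (\<Sum>\<beta>\<in>(UNIV :: 'a set). \<nu> \<beta>) = j \<and> (\<Sum>\<beta>\<in>(UNIV :: 'a set). of_nat (\<nu> \<beta>) * \<beta>) = 0.
              binom m0 (int (\<nu> 0)) *
              (\<Prod>t | \<bar>real_of_int t\<bar> < 2 * sqrt (real q) \<and> [t = -1] (mod 4).
                 \<Prod>\<beta> | \<beta> \<noteq> 0 \<and> kloosterman r (inverse \<beta>) = t. binom (m t) (int (\<nu> \<beta>))))))"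
proof -
  interpret B: binary_field r "TYPE('a)"
    using assms(1,2) by unfold_locales simp
  note q = assms(1) and N1 = assms(9) and N2 = assms(10) and N3 = assms(11)
  have C1: "C1 j = card (zero_sum_sets (SO_plus :: ('a ^ (1 + 1) ^ (1 + 1)) set) trace j)" for j
    using weight_distribution_trace_code[OF assms(3)] assms(4,12) by simp
  have C2: "C2 j = card (zero_sum_sets (O_plus :: ('a ^ (1 + 1) ^ (1 + 1)) set) trace j)" for j
    using weight_distribution_trace_code[OF assms(5)] assms(6,13) by simp
  have C3: "C3 j = card (zero_sum_sets (SO_plus :: ('a ^ (2 + 2) ^ (2 + 2)) set) trace j)" for j
    using weight_distribution_trace_code[OF assms(7)] assms(8,14) by simp
  have T: "T = {\<beta>. \<beta> \<noteq> 0 \<and> abs_trace r (inverse \<beta>) = 0}" by (fact assms(15))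
  \<comment> \<open>The subtraction \<open>q^2 - 1\<close> is one of natural numbers in the goal and
    one of integers in \<open>card_SO_plus_4\<close>; this inequality reconciles them.\<close>
  have q1: "1 \<le> q ^ 2" unfolding q by (simp add: one_le_power)
  have "int N3 = int (q ^ 2 * (q ^ 2 - 1) ^ 2)"
    using B.card_SO_plus_4 q1 unfolding N3 q by (simp add: of_nat_diff)
  then have "N3 = q ^ 2 * (q ^ 2 - 1) ^ 2" by (simp only: of_nat_eq_iff)
  moreover have "N1 = q - 1" "N2 = 2 * (q - 1)"
    unfolding N1 N2 q by (rule B.card_SO_plus_2, rule B.card_O_plus_2)
  moreover note B.recursion_SO_plus_2[folded N1 q C1] B.recursion_O_plus_2[folded N2 q C2]
    B.recursion_SO_plus_4[folded N3 q C3]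
  moreover have "int (C1 j) =
      (\<Sum>\<nu> | \<nu> \<in> insert 0 T \<rightarrow>\<^sub>E UNIV \<and> \<nu> 0 + (\<Sum>\<beta>\<in>T. \<nu> \<beta>) = j \<and> (\<Sum>\<beta>\<in>T. of_nat (\<nu> \<beta>) * \<beta>) = 0.
         binom 1 (int (\<nu> 0)) * (\<Prod>\<beta>\<in>T. binom 2 (int (\<nu> \<beta>))))" for j
    unfolding C1 by (rule B.card_zero_sum_sets_dim_2[OF _ B.card_SO_plus_2_trace T]) simp
  moreover have "int (C2 j) =
      (\<Sum>\<nu> | \<nu> \<in> insert 0 T \<rightarrow>\<^sub>E UNIV \<and> \<nu> 0 + (\<Sum>\<beta>\<in>T. \<nu> \<beta>) = j \<and> (\<Sum>\<beta>\<in>T. of_nat (\<nu> \<beta>) * \<beta>) = 0.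
         binom (int q) (int (\<nu> 0)) * (\<Prod>\<beta>\<in>T. binom 2 (int (\<nu> \<beta>))))" for j
    unfolding C2 q by (rule B.card_zero_sum_sets_dim_2[OF _ B.card_O_plus_2_trace T]) simp
  moreover note B.card_zero_sum_sets_dim_4[folded C3 q, OF _ assms(16,17)]
  ultimately show ?thesis by (intro conjI impI allI) assumption+
qed

end
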